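(* Let $n\ge1$ clients hold scalars $\ell_1,\dots,\ell_n\in[0,B]$, let $b\ge 2$ be a power of $2$, let $0=l_0<l_1<\dots<l_b=B$ be bin edges, and let $\theta\in(0,1)$. Fix $\delta>0$. Suppose that $\sigma\ge1/2$ and a positive integer $c$ are given, and that the modular arithmetic is performed with an integer base $M\ge2+2cn+2n\sqrt{2\sigma^2\log(16nb/\delta)}$. Then the private quantile algorithm described in the context satisfies: (a) It is $\frac12\epsilon^2$-concentrated differentially private with $$\epsilon=\min\left\{\sqrt{\frac{c^2\log_2^2b}{n\sigma^2}+\psi b},\ \frac{c\log_2b}{\sqrt n\,\sigma}+\psi\sqrt{2b}\right\},$$ where $\psi=10\sum_{i=1}^{n-1}\exp\left(-2\pi^2\sigma^2\frac{i}{i+1}\right)\le10(n-1)\exp(-2\pi^2\sigma^2)$. (b) With probability at least $1-\delta$, the quantile error of the cumulative function $\hat H$ returned by the algorithm satisfies $$\Delta_\theta(\hat H,H)\le R^*_\theta(\hat H)+\sqrt{\frac{4\sigma^2}{c^2n}\,\log_2b\,\log\frac{4b}{\delta}},$$ where $R^*_\theta(\hat H)$ is the error in the estimation of the $(1-\theta)$-quantile of the cumulative function $\hat H$.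
   Context: Discrete Gaussian: $\mathcal{N}_{\mathbb{Z}}(0,\sigma^2)$ is the distribution on $\mathbb{Z}$ with $\mathbb{P}(\xi=k)\propto\exp(-k^2/(2\sigma^2))$. Hierarchical histograms: these are indexed by pairs $(r,j)$ with level $r\in\{0,\dots,\log_2b-1\}$ and $j\in\{1,\dots,b/2^r\}$; the node $(r,j)$ represents the block of bins $\{2^r(j-1)+1,\dots,2^rj\}$. For a scalar $\ell\in[0,B]$ its hierarchical histogram is $x(r,j)=\mathbb{I}(l_{2^r(j-1)}\le\ell<l_{2^rj})$. Let $x_i$ be the histogram of $\ell_i$ and $h=\sum_{i=1}^nx_i$. For $j\in[b]=\{1,\dots,b\}$ let $P_j$ be the maximal dyadic partition of $\{1,\dots,j\}$, i.e. the partition of $\{1,\dots,j\}$ into the fewest blocks represented by nodes $(r,o)$ of the tree. The true cumulative function is $H(j)=\sum_{(r,o)\in P_j}h(r,o)$. Algorithm: each client $i$ samples independent $\xi_i(r,j)\sim\mathcal{N}_{\mathbb{Z}}(0,\sigma^2)$ for all $(r,j)$ and forms $\tilde x_i(r,j)=(c\,x_i(r,j)+\xi_i(r,j))\bmod M$. The sum $s=(\sum_{i=1}^n\tilde x_i)\bmod M$ (coordinatewise) is computed by a secure summation oracle, which reveals nothing but $s$; residues mod $M$ are represented by integers in the interval centered at $0$, i.e. in $[-M/2,M/2)$. The server sets $\hat h=s/c$ and $\hat H(j)=\sum_{(r,o)\in P_j}\hat h(r,o)$ for $j\in[b]$, and returns the quantile estimate $l_{j^*_\theta(\hat H)}$ obtained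 from $\hat H$, with $j^*_\theta$ defined below. Error criterion: for a function $K:[b]\to\mathbb{R}$ let $R_\theta(K,j)=\left|\frac{K(j)}{n}-(1-\theta)\right|$, $R^*_\theta(K)=\min_{j\in[b]}R_\theta(K,j)$, $j^*_\theta(K)=\arg\min_{j\in[b]}R_\theta(K,j)$ (ties broken in an arbitrary but deterministic manner), and the quantile error is $\Delta_\theta(\hat H,H)=R_\theta(H,j^*_\theta(\hat H))$. Concentrated differential privacy: a randomized algorithm $\mathcal{A}$ is $\frac12\epsilon^2$-concentrated differentially private if the Rényi divergence of order $\alpha$ satisfies $D_\alpha(\mathcal{A}(X)\,\|\,\mathcal{A}(X'))\le\alpha\epsilon^2/2$ for all $\alpha\in(0,\infty)$ and all sequences $X,X'$ of inputs that differ by the addition or removal of one client's data.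
   Formalization: Two false claims are corrected: for b = 2 the privacy bound is stated only for orders α ≥ 1 (it fails for α < 1, e.g. n = c = 1, σ = α = 1/2), and the bound on ψ reads 10(n−1)exp(−π²σ²), since the bound with exp(−2π²σ²) fails for every n ≥ 2. *)

theory Defs
  imports "HOL-Probability.Probability"
begin

definition discrete_gaussian :: "real \<Rightarrow> int pmf" where
  "discrete_gaussian \<sigma> = embed_pmf (\<lambda>k. exp (- (real_of_int k)\<^sup>2 / (2 * \<sigma>\<^sup>2)) /
     (\<Sum>\<^sub>\<infinity>j\<in>(UNIV :: int set). exp (- (real_of_int j)\<^sup>2 / (2 * \<sigma>\<^sup>2))))"

text \<open>\<^const>\<open>embed_pmf\<close> is meaningful only if the weights sum to 1; this holds for every
  \<open>\<sigma> > 0\<close>.\<close>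

lemma discrete_gaussian_summable:
  assumes "\<sigma> > 0"
  shows "(\<lambda>j::int. exp (- (real_of_int j)\<^sup>2 / (2 * \<sigma>\<^sup>2))) summable_on UNIV"
proof -
  define q where "q = exp (- 1 / (2 * \<sigma>\<^sup>2))"
  have q: "0 \<le> q" "q < 1" using assms by (auto simp: q_def)
  have nat: "(\<lambda>n::nat. exp (- (real n)\<^sup>2 / (2 * \<sigma>\<^sup>2))) summable_on UNIV"
  proof (rule summable_on_comparison_test)
    show "(\<lambda>n::nat. q ^ n) summable_on UNIV"
      using q by (intro norm_summable_imp_summable_on) (auto simp: summable_geometric)
    show "exp (- (real n)\<^sup>2 / (2 * \<sigma>\<^sup>2)) \<le> q ^ n" for n
    proof -
      have "real n \<le> real (n * n)" by (intro of_nat_mono) (cases n; simp)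
      then have "real n / (2 * \<sigma>\<^sup>2) \<le> (real n)\<^sup>2 / (2 * \<sigma>\<^sup>2)"
        by (intro divide_right_mono) (auto simp: power2_eq_square)
      then show ?thesis
        by (simp add: q_def exp_of_nat_mult[symmetric])
    qed
  qed auto
  have "(\<lambda>j::int. exp (- (real_of_int j)\<^sup>2 / (2 * \<sigma>\<^sup>2))) summable_on (range int)"
    by (subst summable_on_reindex) (use nat in \<open>auto simp: o_def\<close>)
  moreover have "(\<lambda>j::int. exp (- (real_of_int j)\<^sup>2 / (2 * \<sigma>\<^sup>2))) summable_on (range (\<lambda>n. - int n))"
    by (subst summable_on_reindex) (use nat in \<open>auto simp: o_def inj_def\<close>)
  moreover have "range int \<union> range (\<lambda>n. - int n) = UNIV"
  proof -
    have "x \<in> range int \<union> range (\<lambda>n. - int n)" for x :: int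
      by (cases x rule: int_cases2) auto
    then show ?thesis by blast
  qed
  ultimately show ?thesis
    using summable_on_union by fastforce
qed

lemma pmf_discrete_gaussian:
  assumes "\<sigma> > 0"
  shows "pmf (discrete_gaussian \<sigma>) k = exp (- (real_of_int k)\<^sup>2 / (2 * \<sigma>\<^sup>2)) /
     (\<Sum>\<^sub>\<infinity>j\<in>(UNIV :: int set). exp (- (real_of_int j)\<^sup>2 / (2 * \<sigma>\<^sup>2)))"
proof -
  let ?w = "\<lambda>j::int. exp (- (real_of_int j)\<^sup>2 / (2 * \<sigma>\<^sup>2))"
  define Z where "Z = infsum ?w UNIV"
  note s = discrete_gaussian_summable[OF assms]
  have "?w 0 \<le> Z" unfolding Z_def
    using finite_sum_le_infsum[OF s, of "{0}"] by simp
  then have Z: "Z > 0" by simp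
  have abs: "Infinite_Set_Sum.abs_summable_on ?w UNIV"
    unfolding abs_summable_equivalent[symmetric] using s by (simp add: o_def)
  have Z': "infsetsum ?w UNIV = Z"
    unfolding Z_def using abs by (rule infsetsum_infsum)
  have abs': "Infinite_Set_Sum.abs_summable_on (\<lambda>j. ?w j * (1 / Z)) UNIV"
    using abs by (rule abs_summable_on_cmult_left)
  have "(\<integral>\<^sup>+ j. ennreal (?w j * (1 / Z)) \<partial>count_space UNIV) = ennreal (infsetsum (\<lambda>j. ?w j * (1 / Z)) UNIV)"
    using abs' Z by (intro nn_integral_conv_infsetsum) auto
  also have "infsetsum (\<lambda>j. ?w j * (1 / Z)) UNIV = infsetsum ?w UNIV * (1 / Z)"
    using abs by (rule infsetsum_cmult_left)
  finally have "(\<integral>\<^sup>+ j. ennreal (?w j / Z) \<partial>count_space UNIV) = 1" using Z Z' by simp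
  then show ?thesis
    unfolding discrete_gaussian_def Z_def[symmetric]
    using Z by (subst pmf_embed_pmf) auto
qed

text \<open>
  \<open>D\<^sub>\<alpha>(P \<parallel> Q) = ln (E\<^bsub>x \<sim> P\<^esub> [(P(x)/Q(x)) powr (\<alpha> - 1)]) / (\<alpha> - 1)\<close>, with the Kullback--Leibler divergence
  at \<open>\<alpha> = 1\<close>. The value is \<open>\<infinity>\<close> if the expectation diverges, if \<open>\<alpha> \<ge> 1\<close> and \<open>P\<close> is not
  absolutely continuous with respect to \<open>Q\<close>, and if \<open>\<alpha> < 1\<close> and the supports are disjoint (the
  expectation is then 0, since \<open>x / 0 = 0\<close> and \<open>0 powr a = 0\<close>). For \<open>\<alpha> = 1\<close> the negative part of
  the integrand is always integrable, so non-integrability means that the integral is \<open>\<infinity>\<close>.\<close>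

definition renyi_divergence :: "real \<Rightarrow> 'a pmf \<Rightarrow> 'a pmf \<Rightarrow> ereal" where
  "renyi_divergence \<alpha> P Q =
    (if \<alpha> = 1 then
       (let f = (\<lambda>x. ln (pmf P x / pmf Q x)) in
        if set_pmf P \<subseteq> set_pmf Q \<and> integrable (measure_pmf P) f
        then ereal (measure_pmf.expectation P f) else \<infinity>)
     else
       (let f = (\<lambda>x. (pmf P x / pmf Q x) powr (\<alpha> - 1)) in
        if (\<alpha> > 1 \<longrightarrow> set_pmf P \<subseteq> set_pmf Q) \<and> integrable (measure_pmf P) f
           \<and> measure_pmf.expectation P f > 0
        then ereal (ln (measure_pmf.expectation P f) / (\<alpha> - 1)) else \<infinity>))"

text \<open>\<open>concentrated_dp A nb \<epsilon> orders\<close>: \<open>\<epsilon>\<^sup>2/2\<close>-concentrated differential privacy of \<open>A\<close> for the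
  neighbouring relation \<open>nb\<close>, with the Renyi orders ranging over \<open>orders\<close>; \<open>{0<..}\<close> is
  the full range. The range is a parameter because discrete Gaussians satisfy the bound
  \<open>\<alpha> \<Delta>\<^sup>2 / (2 \<sigma>\<^sup>2)\<close> on the divergence between integer shifts by \<open>\<Delta>\<close> only for \<open>\<alpha> \<ge> 1\<close>: for
  \<open>\<alpha> < 1\<close> and \<open>(1 - \<alpha>) \<Delta>\<close> not an integer the divergence is strictly larger.\<close>

definition concentrated_dp ::
  "('x \<Rightarrow> 'y pmf) \<Rightarrow> ('x \<Rightarrow> 'x \<Rightarrow> bool) \<Rightarrow> real \<Rightarrow> real set \<Rightarrow> bool" where
  "concentrated_dp A nb \<epsilon> orders \<longleftrightarrow>
     (\<forall>X X'. nb X X' \<longrightarrow>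
        (\<forall>\<alpha>\<in>orders. renyi_divergence \<alpha> (A X) (A X') \<le> ereal (\<alpha> * \<epsilon>\<^sup>2 / 2)))"

text \<open>The protocol always has \<open>n\<close> participants, all adding noise. A data set assigns to each
  client \<open>i \<in> {1..n}\<close> a scalar \<open>Some v\<close>, or \<open>None\<close> if the data of client \<open>i\<close> is not present.
  The values outside \<open>{1..n}\<close> are irrelevant.\<close>

definition valid_data :: "nat \<Rightarrow> real \<Rightarrow> (nat \<Rightarrow> real option) \<Rightarrow> bool" where
  "valid_data n B X \<longleftrightarrow> (\<forall>i\<in>{1..n}. \<forall>v. X i = Some v \<longrightarrow> v \<in> {0..B})"

definition add_remove_neighbours ::
  "nat \<Rightarrow> real \<Rightarrow> (nat \<Rightarrow> real option) \<Rightarrow> (nat \<Rightarrow> real option) \<Rightarrow> bool" where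
  "add_remove_neighbours n B X X' \<longleftrightarrow> valid_data n B X \<and> valid_data n B X' \<and>
     (\<exists>i\<in>{1..n}. (\<forall>k\<in>{1..n} - {i}. X k = X' k) \<and> (X i = None \<longleftrightarrow> X' i \<noteq> None))"

definition nodes :: "nat \<Rightarrow> (nat \<times> nat) set" where
  "nodes b = {(r, j). real r \<le> log 2 (real b) - 1 \<and> 1 \<le> j \<and> j \<le> b div 2 ^ r}"

definition block :: "nat \<times> nat \<Rightarrow> nat set" where
  "block = (\<lambda>(r, j). {2 ^ r * (j - 1) + 1 .. 2 ^ r * j})"

text \<open>Absent data contributes the zero histogram.\<close>

definition histogram :: "(nat \<Rightarrow> real) \<Rightarrow> real option \<Rightarrow> nat \<times> nat \<Rightarrow> int" where
  "histogram l v = (\<lambda>(r, j). case v of None \<Rightarrow> 0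
     | Some u \<Rightarrow> of_bool (l (2 ^ r * (j - 1)) \<le> u \<and> u < l (2 ^ r * j)))"

definition total_histogram ::
  "nat \<Rightarrow> (nat \<Rightarrow> real) \<Rightarrow> (nat \<Rightarrow> real option) \<Rightarrow> nat \<times> nat \<Rightarrow> int" where
  "total_histogram n l X \<nu> = (\<Sum>i = 1..n. histogram l (X i) \<nu>)"

definition dyadic_partition :: "nat \<Rightarrow> nat \<Rightarrow> (nat \<times> nat) set \<Rightarrow> bool" where
  "dyadic_partition b j S \<longleftrightarrow>
     S \<subseteq> nodes b \<and> disjoint_family_on block S \<and> (\<Union>\<nu>\<in>S. block \<nu>) = {1..j}"

definition max_dyadic_partition :: "nat \<Rightarrow> nat \<Rightarrow> (nat \<times> nat) set" where
  "max_dyadic_partition b j = (ARG_MIN card S. dyadic_partition b j S)"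

definition cumulative :: "nat \<Rightarrow> (nat \<times> nat \<Rightarrow> real) \<Rightarrow> nat \<Rightarrow> real" where
  "cumulative b h j = (\<Sum>\<nu>\<in>max_dyadic_partition b j. h \<nu>)"

definition true_cumulative ::
  "nat \<Rightarrow> nat \<Rightarrow> (nat \<Rightarrow> real) \<Rightarrow> (nat \<Rightarrow> real option) \<Rightarrow> nat \<Rightarrow> real" where
  "true_cumulative n b l X = cumulative b (\<lambda>\<nu>. real_of_int (total_histogram n l X \<nu>))"

definition quantile_risk :: "nat \<Rightarrow> real \<Rightarrow> (nat \<Rightarrow> real) \<Rightarrow> nat \<Rightarrow> real" where
  "quantile_risk n \<theta> K j = \<bar>K j / real n - (1 - \<theta>)\<bar>"

definition min_quantile_risk :: "nat \<Rightarrow> nat \<Rightarrow> real \<Rightarrow> (nat \<Rightarrow> real) \<Rightarrow> real" where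
  "min_quantile_risk n b \<theta> K = Min (quantile_risk n \<theta> K ` {1..b})"

text \<open>A deterministic rule for choosing a minimiser; every rule for breaking ties is allowed.\<close>

definition quantile_selector :: "nat \<Rightarrow> nat \<Rightarrow> real \<Rightarrow> ((nat \<Rightarrow> real) \<Rightarrow> nat) \<Rightarrow> bool" where
  "quantile_selector n b \<theta> jst \<longleftrightarrow>
     (\<forall>K. is_arg_min (quantile_risk n \<theta> K) (\<lambda>j. j \<in> {1..b}) (jst K))"

definition quantile_error ::
  "nat \<Rightarrow> real \<Rightarrow> ((nat \<Rightarrow> real) \<Rightarrow> nat) \<Rightarrow> (nat \<Rightarrow> real) \<Rightarrow> (nat \<Rightarrow> real) \<Rightarrow> real" where
  "quantile_error n \<theta> jst K H = quantile_risk n \<theta> H (jst K)"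

text \<open>The representative of \<open>x\<close> modulo \<open>M\<close> in \<open>[-M/2, M/2)\<close>.\<close>

definition centered_mod :: "int \<Rightarrow> int \<Rightarrow> int" where
  "centered_mod x M = (x + M div 2) mod M - M div 2"

lemma centered_mod_cong: "centered_mod x M mod M = x mod M"
  by (simp add: centered_mod_def mod_diff_left_eq)

lemma centered_mod_range:
  assumes "M > 0"
  shows "- real_of_int M / 2 \<le> real_of_int (centered_mod x M)"
    and "real_of_int (centered_mod x M) < real_of_int M / 2"
proof -
  have "0 \<le> (x + M div 2) mod M" "(x + M div 2) mod M < M" using assms by auto
  moreover have "2 * (M div 2) \<le> M" "M \<le> 2 * (M div 2) + 1" by linarith+
  ultimately have "- M \<le> 2 * centered_mod x M" "2 * centered_mod x M < M"
    unfolding centered_mod_def right_diff_distrib by auto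
  then have "real_of_int (- M) \<le> real_of_int (2 * centered_mod x M)"
      "real_of_int (2 * centered_mod x M) < real_of_int M"
    by (simp_all only: of_int_le_iff of_int_less_iff)
  then show "- real_of_int M / 2 \<le> real_of_int (centered_mod x M)"
    "real_of_int (centered_mod x M) < real_of_int M / 2" by simp_all
qed

definition client_noise :: "nat \<Rightarrow> nat \<Rightarrow> real \<Rightarrow> (nat \<times> (nat \<times> nat) \<Rightarrow> int) pmf" where
  "client_noise n b \<sigma> = Pi_pmf ({1..n} \<times> nodes b) 0 (\<lambda>_. discrete_gaussian \<sigma>)"

definition client_message ::
  "(nat \<Rightarrow> real) \<Rightarrow> nat \<Rightarrow> int \<Rightarrow> real option \<Rightarrow> (nat \<times> nat \<Rightarrow> int) \<Rightarrow> nat \<times> nat \<Rightarrow> int" where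
  "client_message l c M v \<xi> \<nu> = centered_mod (int c * histogram l v \<nu> + \<xi> \<nu>) M"

text \<open>The output of the oracle is indexed by the nodes of the tree; it is set to 0 elsewhere.\<close>

definition secure_sum ::
  "nat \<Rightarrow> nat \<Rightarrow> int \<Rightarrow> (nat \<Rightarrow> nat \<times> nat \<Rightarrow> int) \<Rightarrow> nat \<times> nat \<Rightarrow> int" where
  "secure_sum n b M x \<nu> = (if \<nu> \<in> nodes b then centered_mod (\<Sum>i = 1..n. x i \<nu>) M else 0)"

text \<open>The output consists of everything that is revealed or released: the sum \<open>s\<close> revealed by
  the oracle, the cumulative function computed by the server, and the quantile estimate.\<close>

definition private_quantile ::
  "nat \<Rightarrow> nat \<Rightarrow> (nat \<Rightarrow> real) \<Rightarrow> nat \<Rightarrow> int \<Rightarrow> real \<Rightarrow> ((nat \<Rightarrow> real) \<Rightarrow> nat) \<Rightarrow>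
     (nat \<Rightarrow> real option) \<Rightarrow> ((nat \<times> nat \<Rightarrow> int) \<times> (nat \<Rightarrow> real) \<times> real) pmf" where
  "private_quantile n b l c M \<sigma> jst X =
     map_pmf (\<lambda>\<xi>.
       let s = secure_sum n b M (\<lambda>i. client_message l c M (X i) (\<lambda>\<nu>. \<xi> (i, \<nu>)));
           Hhat = cumulative b (\<lambda>\<nu>. real_of_int (s \<nu>) / real c)
       in (s, Hhat, l (jst Hhat)))
     (client_noise n b \<sigma>)"

definition privacy_psi :: "nat \<Rightarrow> real \<Rightarrow> real" where
  "privacy_psi n \<sigma> = 10 * (\<Sum>i = 1..n - 1. exp (- 2 * pi\<^sup>2 * \<sigma>\<^sup>2 * (real i / (real i + 1))))"

definition privacy_epsilon :: "nat \<Rightarrow> nat \<Rightarrow> nat \<Rightarrow> real \<Rightarrow> real" where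
  "privacy_epsilon n b c \<sigma> =
     min (sqrt ((real c)\<^sup>2 * (log 2 (real b))\<^sup>2 / (real n * \<sigma>\<^sup>2) + privacy_psi n \<sigma> * real b))
         (real c * log 2 (real b) / (sqrt (real n) * \<sigma>) + privacy_psi n \<sigma> * sqrt (2 * real b))"

end

theory Submission
  imports Defs
begin

text \<open>
  Privacy. The law of the sum of \<open>n\<close> discrete Gaussians is the Gaussian weight of variance \<open>n \<sigma>\<^sup>2\<close>
  times a factor whose logarithm oscillates by at most \<open>\<psi> / 2\<close>: each convolution contributes the
  oscillation of a periodised Gaussian, which Poisson summation bounds. Poisson summation also
  shows that the sum is subgaussian. Hence the privacy loss of a shift is a subgaussian linear term
  plus an error in \<open>[-\<psi>/2, \<psi>/2]\<close>. Bounding the error by its maximum gives the first term of the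
  minimum in \<open>\<epsilon>\<close>; combining Hoeffding's lemma for the error with the linear term by convexity
  gives the second. One client changes at most \<open>log 2 b\<close> nodes, and the bounds pass to the output by
  data processing. Orders below 1 follow from the case \<open>\<alpha> = 1\<close> by Jensen's inequality and skew
  symmetry, at the price of a factor 2, which is available when \<open>log 2 b \<ge> 2\<close>.

  Utility. The maximal dyadic partition has at most \<open>2 log 2 b\<close> blocks, so Chernoff bounds control the
  noise of all cumulative sums with failure probability \<open>\<delta>/2\<close>, and with failure probability \<open>\<delta>/4\<close>
  no coordinate wraps around modulo \<open>M\<close>.
\<close>

section \<open>Poisson summation for Gaussian sums\<close>

text \<open>A sum of discrete Gaussians is not a discrete Gaussian, so the privacy loss of a shift
  is only approximately affine. The comparison with the Gaussian case travels through the proof as a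
  moment bound exp (t * (u + (1 + t) * w)): this shape multiplies over independent nodes, survives
  data processing and turns into the divergence bound u + \<alpha> * w. The two members of the
  minimum are the choices u = \<psi>/2, w = a^2/2 and u = 0, w = (a + \<psi>/2)^2/2 with a = c /
  (sqrt n * \<sigma>). Orders below 1 resist because moments with t > 0 say nothing direct about
  negative t, and because u does not shrink with \<alpha>. They are paid for by slack in \<epsilon>:
  with m = log 2 b, divergences add over at most m changed nodes, which gives m * a^2 and m *
  \<psi>, whereas the square of the first term of \<epsilon> allows m^2 * a^2 and 2^m *
  \<psi>.\<close>

lemma cosine_coefficients_unique:
  fixes f :: "real \<Rightarrow> real"
  assumes cont: "continuous_on {0..1} f"
    and sym: "\<And>u. u \<in> {0..1} \<Longrightarrow> f (1 - u) = f u"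
    and coeff: "\<And>j::nat. ((\<lambda>u. f u * cos (2 * pi * real j * u)) has_integral 0) {0..1}"
    and u: "u \<in> {0..1}"
  shows "f u = 0"
proof -
  \<comment> \<open>The product formula for cosines trades one factor
    \<open>cos (2 * pi * u)\<close> for the frequencies j + 1 and j - 1, so \<open>j\<close> must
    stay arbitrary in the induction. At j = 0 the frequency -1 is replaced by 1, since natural
    subtraction would give 0.\<close>
  have power: "((\<lambda>u. f u * cos (2 * pi * real j * u) * cos (2 * pi * u) ^ k) has_integral 0) {0..1}"
    for j k :: nat
  proof (induction k arbitrary: j)
    case 0
    then show ?case using coeff by simp
  next
    case (Suc k)
    have "((\<lambda>u. (1/2) * (f u * cos (2 * pi * real (Suc j) * u) * cos (2 * pi * u) ^ k) +
        (1/2) * (f u * cos (2 * pi * real (if j = 0 then 1 else j - 1) * u) * cos (2 * pi * u) ^ k))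
        has_integral (1/2) * 0 + (1/2) * 0) {0..1}"
      by (intro has_integral_add has_integral_mult_right Suc.IH)
    moreover have "(1/2) * (f u * cos (2 * pi * real (Suc j) * u) * cos (2 * pi * u) ^ k) +
        (1/2) * (f u * cos (2 * pi * real (if j = 0 then 1 else j - 1) * u) * cos (2 * pi * u) ^ k)
        = f u * cos (2 * pi * real j * u) * cos (2 * pi * u) ^ Suc k" for u
    proof (cases "j = 0")
      case False
      then have e: "2 * pi * real (Suc j) * u = 2 * pi * real j * u + 2 * pi * u"
          "2 * pi * real (j - 1) * u = 2 * pi * real j * u - 2 * pi * u"
        by (auto simp: algebra_simps of_nat_diff)
      have "cos (2 * pi * real (Suc j) * u) + cos (2 * pi * real (j - 1) * u) =
          2 * cos (2 * pi * real j * u) * cos (2 * pi * u)"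
        unfolding e cos_add cos_diff by simp
      then have "f u * (cos (2 * pi * real (Suc j) * u) + cos (2 * pi * real (j - 1) * u)) / 2 * cos (2 * pi * u) ^ k
          = f u * (2 * cos (2 * pi * real j * u) * cos (2 * pi * u)) / 2 * cos (2 * pi * u) ^ k"
        by metis
      then show ?thesis using False by (simp add: algebra_simps add_divide_distrib)
    qed simp
    ultimately show ?case by simp
  qed
  have monom: "((\<lambda>u. f u * cos (2 * pi * u) ^ k) has_integral 0) {0..1}" for k
    using power[of 0 k] by simp
  \<comment> \<open>By its symmetry about 1/2, \<open>f\<close> is a continuous function
    \<open>g\<close> of this coordinate: \<open>arccos\<close> inverts it on the left half of the
    interval and \<open>sym\<close> covers the right half. The range [0, 1] is the one on which
    Bernstein polynomials live.\<close>
  define t where "t = (\<lambda>u. (1 + cos (2 * pi * u)) / 2)"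
  have t01: "t u \<in> {0..1}" for u
  proof -
    have "0 \<le> 1 + cos (2 * pi * u)"
      using cos_ge_minus_one[of "2 * pi * u"] by linarith
    then show ?thesis by (simp add: t_def)
  qed
  have t_eq: "2 * t u - 1 = cos (2 * pi * u)" for u
    by (simp add: t_def field_simps)
  define g where "g = (\<lambda>x. f (arccos (2 * x - 1) / (2 * pi)))"
  have range: "arccos (2 * x - 1) / (2 * pi) \<in> {0..1}" if "x \<in> {0..1}" for x
    using that arccos_lbound[of "2*x-1"] arccos_ubound[of "2*x-1"] by (auto simp: field_simps)
  have "continuous_on {0..1} (\<lambda>x. arccos (2 * x - 1) / (2 * pi))"
    by (intro continuous_intros continuous_on_arccos) auto
  then have g_cont: "continuous_on {0..1} g"
    unfolding g_def by (rule continuous_on_compose2[OF cont]) (use range in auto)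
  have g_t: "g (t u) = f u" if "u \<in> {0..1}" for u
  proof (cases "u \<le> 1/2")
    case True
    then have "arccos (cos (2 * pi * u)) = 2 * pi * u"
      using that by (intro arccos_cos) (auto simp: field_simps)
    then show ?thesis by (simp add: g_def t_eq)
  next
    case False
    have "cos (2 * pi * (1 - u)) = cos (2 * pi * u)"
      by (simp add: right_diff_distrib cos_diff)
    moreover have "arccos (cos (2 * pi * (1 - u))) = 2 * pi * (1 - u)"
      using that False by (intro arccos_cos) (auto simp: field_simps)
    ultimately show ?thesis using sym[OF that] by (simp add: g_def t_eq)
  qed
  obtain B where B: "\<And>u. u \<in> {0..1} \<Longrightarrow> \<bar>f u\<bar> \<le> B"
    using compact_continuous_image[OF cont] by (fastforce dest!: compact_imp_bounded simp: bounded_iff)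
  have Bern: "((\<lambda>u. f u * (t u ^ a * (1 - t u) ^ m)) has_integral 0) {0..1}" for a m
  proof -
    define p :: "real poly" where "p = [:1/2, 1/2:] ^ a * [:1/2, -1/2:] ^ m"
    have "t u = 1 / 2 + cos (2 * pi * u) / 2" "1 - t u = 1 / 2 - cos (2 * pi * u) / 2" for u
      by (simp_all add: t_def field_simps)
    then have "f u * (t u ^ a * (1 - t u) ^ m) = f u * poly p (cos (2 * pi * u))" for u
      by (simp add: p_def)
    then have "f u * (t u ^ a * (1 - t u) ^ m) =
        (\<Sum>i\<le>degree p. coeff p i * (f u * cos (2 * pi * u) ^ i))" for u
      by (simp add: poly_altdef sum_distrib_left mult.left_commute)
    moreover have "((\<lambda>u. \<Sum>i\<le>degree p. coeff p i * (f u * cos (2 * pi * u) ^ i)) has_integral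
        (\<Sum>i\<le>degree p. coeff p i * 0)) {0..1}"
      by (intro has_integral_sum has_integral_mult_right monom) auto
    ultimately show ?thesis by simp
  qed
  have f2: "(\<lambda>u. (f u)\<^sup>2) integrable_on {0..1}"
    by (intro integrable_continuous_interval continuous_intros cont)
  \<comment> \<open>\<open>f\<close> is orthogonal to every polynomial in \<open>t\<close>, so the
    integral of f^2 equals that of f * (f - q) for a Bernstein approximation \<open>q\<close> of
    \<open>g\<close>, and this is at most e * B.\<close>
  have small: "integral {0..1} (\<lambda>u. (f u)\<^sup>2) \<le> e * B" if "e > 0" for e
  proof -
    obtain N where N: "\<And>x. x \<in> {0..1} \<Longrightarrow> \<bar>g x - (\<Sum>k\<le>N. g (k/N) * Bernstein N k x)\<bar> < e"
      using Bernstein_Weierstrass[OF g_cont \<open>e > 0\<close>] by blast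
    define q where "q = (\<lambda>u. \<Sum>k\<le>N. g (k/N) * Bernstein N k (t u))"
    have "((\<lambda>u. \<Sum>k\<le>N. (g (k/N) * real (N choose k)) * (f u * (t u ^ k * (1 - t u) ^ (N - k)))) has_integral
        (\<Sum>k\<le>N. (g (k/N) * real (N choose k)) * 0)) {0..1}"
      by (intro has_integral_sum has_integral_mult_right Bern) auto
    then have fq: "((\<lambda>u. f u * q u) has_integral 0) {0..1}"
      by (simp add: q_def Bernstein_def sum_distrib_left ac_simps)
    have "((\<lambda>u. (f u)\<^sup>2 - f u * q u) has_integral integral {0..1} (\<lambda>u. (f u)\<^sup>2) - 0) {0..1}"
      by (intro has_integral_diff fq integrable_integral f2)
    moreover have "((\<lambda>u. e * B) has_integral e * B) {0..1::real}"
      using has_integral_const_real[of "e * B" 0 1] by simp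
    ultimately have "integral {0..1} (\<lambda>u. (f u)\<^sup>2) - 0 \<le> e * B"
    proof (rule has_integral_le)
      fix u :: real assume u: "u \<in> {0..1}"
      have "(f u)\<^sup>2 - f u * q u = f u * (g (t u) - q u)"
        by (simp add: g_t[OF u] power2_eq_square algebra_simps)
      also have "\<dots> \<le> \<bar>f u\<bar> * \<bar>g (t u) - q u\<bar>"
        by (metis abs_ge_self abs_mult)
      also have "\<dots> \<le> B * e"
        using N[OF t01[of u]] B[OF u] by (intro mult_mono) (auto simp: q_def)
      finally show "(f u)\<^sup>2 - f u * q u \<le> e * B" by (simp add: mult.commute)
    qed
    then show ?thesis by simp
  qed
  have "integral {0..1} (\<lambda>u. (f u)\<^sup>2) \<le> 0"
  proof (rule field_le_epsilon)
    fix e :: real assume "e > 0"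
    have "B \<ge> 0" using B[of 0] by auto
    then have "e / (B + 1) * B \<le> e" using \<open>e > 0\<close> by (simp add: field_simps)
    then show "integral {0..1} (\<lambda>u. (f u)\<^sup>2) \<le> 0 + e"
      using small[of "e / (B + 1)"] \<open>e > 0\<close> \<open>B \<ge> 0\<close> by auto
  qed
  moreover have "integral {0..1} (\<lambda>u. (f u)\<^sup>2) \<ge> 0"
    by (intro integral_nonneg f2) auto
  ultimately have "((\<lambda>u. (f u)\<^sup>2) has_integral 0) {0..1}"
    using integrable_integral[OF f2] by simp
  then have "(f u)\<^sup>2 = 0"
    by (rule has_integral_0_cbox_imp_0[of 0 1 "\<lambda>u. (f u)\<^sup>2", unfolded cbox_interval, rotated 2])
       (use u in \<open>auto intro!: continuous_intros cont\<close>)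
  then show ?thesis by simp
qed

section \<open>Sums over the integers and termwise integration\<close>

lemma filterlim_symmetric_int_intervals:
  "filterlim (\<lambda>N. {- int N..int N}) (finite_subsets_at_top UNIV) sequentially"
proof (rule filterlim_finite_subsets_at_top[THEN iffD2], intro allI impI)
  fix X :: "int set" assume X: "finite X \<and> X \<subseteq> UNIV"
  define K where "K = (\<Sum>x\<in>X. nat \<bar>x\<bar>)"
  have "nat \<bar>x\<bar> \<le> K" if "x \<in> X" for x
    unfolding K_def using X that by (intro member_le_sum) auto
  then have "X \<subseteq> {- int N..int N}" if "N \<ge> K" for N
    using that by (fastforce simp: abs_le_iff)
  then show "\<forall>\<^sub>F N in sequentially. finite {- int N..int N} \<and> X \<subseteq> {- int N..int N} \<and> {- int N..int N} \<subseteq> UNIV"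
    unfolding eventually_sequentially by auto
qed

lemma has_sum_int_imp_tendsto:
  assumes "(f has_sum S) (UNIV :: int set)"
  shows "(\<lambda>N. \<Sum>y\<in>{- int N..int N}. f y) \<longlonglongrightarrow> S"
  using filterlim_compose[OF assms[unfolded has_sum_def] filterlim_symmetric_int_intervals] .

text \<open>Uniform convergence along the net of finite sets carries over both continuity and
  integration. The integral and the sum of the \<open>c k\<close> are delivered as one common
  \<open>S\<close> whose value is left open; each application identifies it by its own
  computation.\<close>

lemma has_sum_integral_M_test:
  fixes f :: "'a \<Rightarrow> real \<Rightarrow> real"
  assumes bound: "\<And>k u. u \<in> {a..b} \<Longrightarrow> \<bar>f k u\<bar> \<le> M k" and M: "M summable_on UNIV"
    and cont: "\<And>k. continuous_on {a..b} (f k)"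
    and int: "\<And>k. (f k has_integral c k) {a..b}"
  shows "continuous_on {a..b} (\<lambda>u. \<Sum>\<^sub>\<infinity>k. f k u)"
    and "\<exists>S. ((\<lambda>u. \<Sum>\<^sub>\<infinity>k. f k u) has_integral S) {a..b} \<and> (c has_sum S) UNIV"
proof -
  have lim: "uniform_limit {a..b} (\<lambda>X u. \<Sum>k\<in>X. f k u) (\<lambda>u. \<Sum>\<^sub>\<infinity>k. f k u) (finite_subsets_at_top UNIV)"
    by (rule Weierstrass_m_test_general[OF _ M]) (use bound in auto)
  show "continuous_on {a..b} (\<lambda>u. \<Sum>\<^sub>\<infinity>k. f k u)"
    by (rule uniform_limit_theorem[OF _ lim]) (auto intro!: always_eventually continuous_intros cont)
  obtain I J where IJ: "\<And>X. ((\<lambda>u. \<Sum>k\<in>X. f k u) has_integral I X) {a..b}"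
      "((\<lambda>u. \<Sum>\<^sub>\<infinity>k. f k u) has_integral J) {a..b}" "(I \<longlongrightarrow> J) (finite_subsets_at_top UNIV)"
    by (rule uniform_limit_integral[OF lim]) (auto intro!: continuous_intros cont)
  have "I X = sum c X" if "finite X" for X
    by (rule has_integral_unique[OF IJ(1) has_integral_sum[OF that int]])
  then have "(c has_sum J) UNIV"
    unfolding has_sum_def using IJ(3)
    by (subst tendsto_cong[of _ I]) (auto simp: eventually_finite_subsets_at_top)
  then show "\<exists>S. ((\<lambda>u. \<Sum>\<^sub>\<infinity>k. f k u) has_integral S) {a..b} \<and> (c has_sum S) UNIV"
    using IJ(2) by blast
qed

section \<open>Fourier coefficients of the periodised Gaussian\<close>

lemma gaussian_cos_integral:
  fixes r t :: real
  assumes "r > 0"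
  shows "has_bochner_integral lborel (\<lambda>v. exp (- v\<^sup>2 / (2 * r\<^sup>2)) * cos (t * v))
    (sqrt (2 * pi) * r * exp (- (r * t)\<^sup>2 / 2))"
proof -
  have nd: "prob_space std_normal_distribution"
    using real_dist_normal_dist by (simp add: real_distribution_def)
  interpret prob_space std_normal_distribution by (fact nd)
  have i: "integrable std_normal_distribution (\<lambda>x. iexp (s * x))" for s :: real
    by (intro integrable_iexp) auto
  have "has_bochner_integral lborel (\<lambda>x. std_normal_density x * cos (s * x)) (exp (- s\<^sup>2 / 2))" for s :: real
  proof -
    have "has_bochner_integral std_normal_distribution (\<lambda>x. iexp (s * x)) (complex_of_real (exp (- s\<^sup>2 / 2)))"
      using i[of s] char_std_normal_distribution
      by (simp add: has_bochner_integral_iff char_def fun_eq_iff)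
    then have "has_bochner_integral std_normal_distribution (\<lambda>x. Re (iexp (s * x))) (Re (complex_of_real (exp (- s\<^sup>2 / 2))))"
      by (rule has_bochner_integral_bounded_linear[OF bounded_linear_Re])
    then have "has_bochner_integral std_normal_distribution (\<lambda>x. cos (s * x)) (exp (- s\<^sup>2 / 2))"
      by (simp add: Re_exp)
    then show ?thesis
      by (simp add: has_bochner_integral_iff integrable_density integral_density)
  qed
  \<comment> \<open>The real part of the characteristic function of the standard normal law, taken
    at \<open>r * t\<close>; the substitution v = r * x then rescales to standard deviation
    \<open>r\<close>.\<close>
  note this[of "r * t"]
  then have "has_bochner_integral lborel (\<lambda>x. std_normal_density (0 + (1 / r) * x) * cos (r * t * (0 + (1 / r) * x)))
      (exp (- (r * t)\<^sup>2 / 2) /\<^sub>R \<bar>1 / r\<bar>)"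
    using assms by (subst (asm) lborel_has_bochner_integral_real_affine_iff[where c="1 / r" and t=0]) auto
  then have "has_bochner_integral lborel (\<lambda>x. sqrt (2 * pi) * (std_normal_density (0 + (1 / r) * x) * cos (r * t * (0 + (1 / r) * x))))
      (sqrt (2 * pi) * (exp (- (r * t)\<^sup>2 / 2) /\<^sub>R \<bar>1 / r\<bar>))"
    by (rule has_bochner_integral_mult_right[rotated])
  moreover have "(\<lambda>x. sqrt (2 * pi) * (std_normal_density (0 + (1 / r) * x) * cos (r * t * (0 + (1 / r) * x)))) =
      (\<lambda>v. exp (- v\<^sup>2 / (2 * r\<^sup>2)) * cos (t * v))"
    using assms by (auto simp: std_normal_density_def power_divide fun_eq_iff mult.commute)
  ultimately show ?thesis using assms by (simp add: ac_simps)
qed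

text \<open>A theta function: the unnormalised Gaussian of standard deviation \<open>r\<close>,
  summed over all integer translates. Its value at 0 is the normalising constant of
  \<open>discrete_gaussian r\<close>.\<close>

definition gauss_sum :: "real \<Rightarrow> real \<Rightarrow> real" where
  "gauss_sum r u = (\<Sum>\<^sub>\<infinity>y::int. exp (- (u - of_int y)\<^sup>2 / (2 * r\<^sup>2)))"

text \<open>From (u - y)^2 \<ge> y^2/2 - u^2. The dependence on \<open>u\<close> is split off as a
  factor, which leaves a majorant in \<open>y\<close> alone, a centred Gaussian of deviation sqrt 2
  * r; this serves both summability and uniform convergence for bounded \<open>u\<close>.\<close>

lemma shifted_gaussian_le:
  fixes u y r :: real
  shows "exp (- (u - y)\<^sup>2 / (2 * r\<^sup>2)) \<le> exp (u\<^sup>2 / (2 * r\<^sup>2)) * exp (- y\<^sup>2 / (2 * (sqrt 2 * r)\<^sup>2))"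
proof -
  have "- (u - y)\<^sup>2 \<le> u\<^sup>2 - y\<^sup>2 / 2"
    using zero_le_power2[of "2 * u - y"] by (simp add: power2_eq_square algebra_simps)
  then have "- (u - y)\<^sup>2 / (2 * r\<^sup>2) \<le> (u\<^sup>2 - y\<^sup>2 / 2) / (2 * r\<^sup>2)"
    by (intro divide_right_mono) auto
  also have "\<dots> = u\<^sup>2 / (2 * r\<^sup>2) + (- y\<^sup>2 / (2 * (sqrt 2 * r)\<^sup>2))"
    by (simp add: power_mult_distrib diff_divide_distrib)
  finally show ?thesis by (simp flip: exp_add)
qed

lemma gauss_sum_summable:
  fixes r u :: real
  assumes "r > 0"
  shows "(\<lambda>y::int. exp (- (u - of_int y)\<^sup>2 / (2 * r\<^sup>2))) summable_on UNIV"
proof (rule summable_on_comparison_test)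
  show "(\<lambda>y::int. exp (u\<^sup>2 / (2 * r\<^sup>2)) * exp (- (of_int y)\<^sup>2 / (2 * (sqrt 2 * r)\<^sup>2))) summable_on UNIV"
    using assms by (intro summable_on_cmult_right discrete_gaussian_summable) auto
qed (use shifted_gaussian_le in auto)

lemma gauss_sum_add_int: "gauss_sum r (u + of_int k) = gauss_sum r u"
proof -
  have "gauss_sum r (u + of_int k) = (\<Sum>\<^sub>\<infinity>y\<in>range (\<lambda>y. y + k). exp (- (u + of_int k - of_int y)\<^sup>2 / (2 * r\<^sup>2)))"
    unfolding gauss_sum_def by (subst surj_plus_right) simp_all
  also have "\<dots> = gauss_sum r u"
    by (subst infsum_reindex) (auto simp: o_def gauss_sum_def)
  finally show ?thesis .
qed

lemma gauss_sum_minus: "gauss_sum r (- u) = gauss_sum r u"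
proof -
  have "gauss_sum r (- u) = (\<Sum>\<^sub>\<infinity>y\<in>range uminus. exp (- (- u - of_int y)\<^sup>2 / (2 * r\<^sup>2)))"
    unfolding gauss_sum_def by (subst surj_uminus) simp_all
  also have "\<dots> = gauss_sum r u"
    by (subst infsum_reindex) (auto simp: o_def gauss_sum_def power2_commute)
  finally show ?thesis .
qed

text \<open>Unfolding: the cosine has period 1, so integrating all translates over one period
  amounts to integrating a single Gaussian times a cosine over the whole line.\<close>

lemma gauss_sum_fourier_coefficient:
  fixes j :: nat
  assumes "r > 0"
  shows "continuous_on {0..1} (gauss_sum r)"
    and "((\<lambda>u. gauss_sum r u * cos (2 * pi * real j * u)) has_integral
      sqrt (2 * pi) * r * exp (- 2 * pi\<^sup>2 * r\<^sup>2) ^ (j\<^sup>2)) {0..1}"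
proof -
  define f where "f = (\<lambda>j v. exp (- v\<^sup>2 / (2 * r\<^sup>2)) * cos (2 * pi * real j * v))"
  define F where "F = (\<lambda>j (y::int) u. exp (- (u - of_int y)\<^sup>2 / (2 * r\<^sup>2)) * cos (2 * pi * real j * u))"
  define M where "M = (\<lambda>y::int. exp (1 / (2 * r\<^sup>2)) * exp (- (of_int y)\<^sup>2 / (2 * (sqrt 2 * r)\<^sup>2)))"
  have F_f: "F j y u = f j (u - of_int y)" for j y u
  proof -
    have "cos (2 * pi * real j * (u - of_int y)) = cos (2 * pi * real j * u + 2 * pi * of_int (- int j * y))"
      by (simp add: algebra_simps)
    also have "\<dots> = cos (2 * pi * real j * u)"
      unfolding cos_add by (simp only: sin_int_2pin cos_int_2pin)
    finally show ?thesis by (simp add: F_def f_def)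
  qed
  have f_cont: "continuous_on S (f j)" for S j
    unfolding f_def using assms by (intro continuous_intros) auto
  have F_cont: "continuous_on {0..1} (F j y)" for j y
    unfolding F_def using assms by (intro continuous_intros) auto
  have F_bound: "\<bar>F j y u\<bar> \<le> M y" if "u \<in> {0..1}" for j y u
  proof -
    have "u\<^sup>2 \<le> 1" using that by (simp add: power_le_one)
    have "\<bar>F j y u\<bar> \<le> exp (- (u - of_int y)\<^sup>2 / (2 * r\<^sup>2)) * 1"
      unfolding F_def abs_mult by (intro mult_mono) auto
    also have "\<dots> \<le> exp (u\<^sup>2 / (2 * r\<^sup>2)) * exp (- (of_int y)\<^sup>2 / (2 * (sqrt 2 * r)\<^sup>2))"
      using shifted_gaussian_le by simp
    also have "\<dots> \<le> M y"
      unfolding M_def using \<open>u\<^sup>2 \<le> 1\<close> by (intro mult_right_mono) (auto intro!: divide_right_mono)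
    finally show ?thesis .
  qed
  have M_summable: "M summable_on UNIV"
    unfolding M_def using assms by (intro summable_on_cmult_right discrete_gaussian_summable) auto
  have F_int: "(F j y has_integral integral {- of_int y..1 - of_int y} (f j)) {0..1}" for j y
  proof -
    have "(f j has_integral integral {- of_int y..1 - of_int y} (f j)) (cbox (- of_int y) (1 - of_int y))"
      by (simp add: integrable_integral integrable_continuous_interval f_cont)
    from has_integral_affinity[OF this, of 1 "- of_int y"] show ?thesis
      by (simp add: F_f[abs_def] add.commute)
  qed
  have F_sum: "(\<Sum>\<^sub>\<infinity>y. F j y u) = gauss_sum r u * cos (2 * pi * real j * u)" for j u
    unfolding F_def gauss_sum_def by (rule infsum_cmult_left) (use gauss_sum_summable[OF assms] in auto)
  show "continuous_on {0..1} (gauss_sum r)"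
    using has_sum_integral_M_test(1)[where f="F 0", OF F_bound M_summable F_cont F_int] by (simp add: F_sum)
  obtain S where S: "((\<lambda>u. gauss_sum r u * cos (2 * pi * real j * u)) has_integral S) {0..1}"
      "((\<lambda>y::int. integral {- of_int y..1 - of_int y} (f j)) has_sum S) UNIV"
    using has_sum_integral_M_test(2)[where f="F j", OF F_bound M_summable F_cont F_int] by (auto simp: F_sum)
  have combine: "integral {a..b} (f j) + integral {b..c} (f j) = integral {a..c} (f j)" if "a \<le> b" "b \<le> c" for a b c
    using that by (intro Henstock_Kurzweil_Integration.integral_combine integrable_continuous_interval f_cont)
  \<comment> \<open>The unit intervals [-y, 1 - y] with y from -N to N tile [-N, N + 1], slightly
    off centre; each step of the induction adds one unit at either end.\<close>
  have partial: "(\<Sum>y\<in>{- int N..int N}. integral {- of_int y..1 - of_int y} (f j)) = integral {- real N..real N + 1} (f j)" for N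
  proof (induction N)
    case (Suc N)
    have "{- int (Suc N)..int (Suc N)} = insert (- int (Suc N)) (insert (int (Suc N)) {- int N..int N})"
      by auto
    then show ?case
      using Suc combine[of "- 1 - real N" "- real N" "real N + 1"] combine[of "- 1 - real N" "real N + 1" "real N + 2"]
      by (simp add: algebra_simps)
  qed simp
  have hb: "has_bochner_integral lborel (f j) (sqrt (2 * pi) * r * exp (- (r * (2 * pi * real j))\<^sup>2 / 2))"
    using gaussian_cos_integral[OF assms, of "2 * pi * real j"] by (simp add: f_def)
  have "(\<lambda>N. LINT v|lborel. indicator {- real N..real N + 1} v * f j v) \<longlonglongrightarrow> (LINT v|lborel. f j v)"
  proof (rule integral_dominated_convergence[where w="\<lambda>v. \<bar>f j v\<bar>"])
    show "AE v in lborel. (\<lambda>N. indicator {- real N..real N + 1} v * f j v) \<longlonglongrightarrow> f j v"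
    proof (intro AE_I2 tendsto_eventually)
      fix v
      obtain K where "\<bar>v\<bar> \<le> real K" using real_arch_simple by blast
      then show "\<forall>\<^sub>F N in sequentially. indicator {- real N..real N + 1} v * f j v = f j v"
        unfolding eventually_sequentially by (intro exI[of _ K]) (auto simp: abs_le_iff indicator_def)
    qed
  qed (use hb in \<open>auto simp: has_bochner_integral_iff abs_mult indicator_def\<close>)
  moreover have "(LINT v|lborel. indicator {- real N..real N + 1} v * f j v) = integral {- real N..real N + 1} (f j)" for N
  proof -
    have "set_integrable lborel {- real N..real N + 1} (f j)"
      by (rule borel_integrable_atLeastAtMost') (rule f_cont)
    from set_borel_integral_eq_integral(2)[OF this] show ?thesis
      by (simp add: set_lebesgue_integral_def)
  qed
  ultimately have "(\<lambda>N. integral {- real N..real N + 1} (f j)) \<longlonglongrightarrow> sqrt (2 * pi) * r * exp (- (r * (2 * pi * real j))\<^sup>2 / 2)"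
    using hb by (simp add: has_bochner_integral_iff)
  moreover have "(\<lambda>N. integral {- real N..real N + 1} (f j)) \<longlonglongrightarrow> S"
    using has_sum_int_imp_tendsto[OF S(2)] by (simp add: partial)
  ultimately have "S = sqrt (2 * pi) * r * exp (- (r * (2 * pi * real j))\<^sup>2 / 2)"
    using LIMSEQ_unique by blast
  also have "- (r * (2 * pi * real j))\<^sup>2 / 2 = real (j\<^sup>2) * (- 2 * pi\<^sup>2 * r\<^sup>2)"
    by (simp add: power_mult_distrib)
  finally show "((\<lambda>u. gauss_sum r u * cos (2 * pi * real j * u)) has_integral
      sqrt (2 * pi) * r * exp (- 2 * pi\<^sup>2 * r\<^sup>2) ^ (j\<^sup>2)) {0..1}"
    using S(1) by (simp only: exp_of_nat_mult)
qed

section \<open>The cosine series on the frequency side\<close>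

lemma integral_cos_2pi:
  fixes m :: int
  shows "((\<lambda>u. cos (2 * pi * of_int m * u)) has_integral of_bool (m = 0)) {0..1::real}"
proof (cases "m = 0")
  case True
  then show ?thesis using has_integral_const_real[of "1::real" 0 1] by simp
next
  case False
  have "((\<lambda>u. cos (2 * pi * of_int m * u)) has_integral
      sin (2 * pi * of_int m * 1) / (2 * pi * of_int m) - sin (2 * pi * of_int m * 0) / (2 * pi * of_int m)) {0..1::real}"
    using False
    by (intro fundamental_theorem_of_calculus)
       (auto intro!: derivative_eq_intros simp flip: has_real_derivative_iff_has_vector_derivative)
  moreover have "sin (2 * pi * of_int m) = 0" by (simp only: sin_int_2pin)
  ultimately show ?thesis using False by simp
qed

text \<open>The theta series with nome \<open>q\<close>. It runs over all integers, so a frequency j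
  > 0 occurs twice; this cancels the 1/2 from the mean of a squared cosine and makes
  \<open>q ^ j\<^sup>2\<close> the coefficient for every \<open>j\<close>, including 0.\<close>

definition cos_series :: "real \<Rightarrow> real \<Rightarrow> real" where
  "cos_series q u = (\<Sum>\<^sub>\<infinity>k::int. q ^ (nat \<bar>k\<bar>)\<^sup>2 * cos (2 * pi * of_int k * u))"

lemma power_square_le:
  fixes q :: real
  assumes "0 \<le> q" "q < 1"
  shows "q ^ n\<^sup>2 \<le> q ^ n"
  using assms by (intro power_decreasing) (auto simp: power2_nat_le_imp_le power2_eq_square)

lemma cos_series_weights:
  fixes q :: real
  assumes "0 \<le> q" "q < 1"
  shows "(\<lambda>k::int. q ^ (nat \<bar>k\<bar>)\<^sup>2) summable_on UNIV"
    and "(\<Sum>\<^sub>\<infinity>k::int. q ^ (nat \<bar>k\<bar>)\<^sup>2) \<le> 1 + 2 * q / (1 - q)"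
proof -
  have partial: "(\<Sum>k\<in>{- int N..int N}. q ^ (nat \<bar>k\<bar>)\<^sup>2) \<le> 1 + 2 * q / (1 - q)" for N
  proof -
    \<comment> \<open>The quadratic exponents are weakened to linear ones, which gives a geometric
      series. The loss is harmless because \<open>q\<close> will be at most 1/9.\<close>
    have "(\<Sum>k\<in>{- int N..int N}. q ^ (nat \<bar>k\<bar>)\<^sup>2) \<le> 1 + 2 * q * (\<Sum>k<N. q ^ k)"
    proof (induction N)
      case (Suc N)
      have "{- int (Suc N)..int (Suc N)} = insert (- int (Suc N)) (insert (int (Suc N)) {- int N..int N})"
        by auto
      then have "(\<Sum>k\<in>{- int (Suc N)..int (Suc N)}. q ^ (nat \<bar>k\<bar>)\<^sup>2) =
          2 * q ^ (Suc N)\<^sup>2 + (\<Sum>k\<in>{- int N..int N}. q ^ (nat \<bar>k\<bar>)\<^sup>2)"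
        by (simp add: nat_add_distrib)
      also have "\<dots> \<le> 2 * q ^ Suc N + (1 + 2 * q * (\<Sum>k<N. q ^ k))"
        using power_square_le[OF assms, of "Suc N"] Suc by linarith
      finally show ?case by (simp add: algebra_simps)
    qed simp
    also have "(\<Sum>k<N. q ^ k) \<le> 1 / (1 - q)"
      using assms by (simp add: sum_gp_strict divide_right_mono)
    finally show ?thesis using assms by (simp add: mult_left_mono)
  qed
  show s: "(\<lambda>k::int. q ^ (nat \<bar>k\<bar>)\<^sup>2) summable_on UNIV"
  proof (rule nonneg_bdd_above_summable_on)
    show "bdd_above (sum (\<lambda>k::int. q ^ (nat \<bar>k\<bar>)\<^sup>2) ` {F. F \<subseteq> UNIV \<and> finite F})"
    proof (rule bdd_aboveI2)
      fix F :: "int set" assume F: "F \<in> {F. F \<subseteq> UNIV \<and> finite F}"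
      have "\<forall>\<^sub>F N in sequentially. F \<subseteq> {- int N..int N}"
        using filterlim_symmetric_int_intervals F
        unfolding filterlim_finite_subsets_at_top by (auto elim: eventually_mono)
      then obtain N where "F \<subseteq> {- int N..int N}" unfolding eventually_sequentially by blast
      then have "sum (\<lambda>k::int. q ^ (nat \<bar>k\<bar>)\<^sup>2) F \<le> (\<Sum>k\<in>{- int N..int N}. q ^ (nat \<bar>k\<bar>)\<^sup>2)"
        using assms by (intro sum_mono2) auto
      with partial show "sum (\<lambda>k::int. q ^ (nat \<bar>k\<bar>)\<^sup>2) F \<le> 1 + 2 * q / (1 - q)"
        by (meson order_trans)
    qed
  qed (use assms in auto)
  show "(\<Sum>\<^sub>\<infinity>k::int. q ^ (nat \<bar>k\<bar>)\<^sup>2) \<le> 1 + 2 * q / (1 - q)"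
    using partial by (intro LIMSEQ_le_const2[OF has_sum_int_imp_tendsto[OF has_sum_infsum[OF s]]]) auto
qed

lemma cos_series_summable:
  fixes q u :: real
  assumes "0 \<le> q" "q < 1"
  shows "(\<lambda>k::int. q ^ (nat \<bar>k\<bar>)\<^sup>2 * cos (2 * pi * of_int k * u)) summable_on UNIV"
proof (rule abs_summable_summable, rule summable_on_comparison_test[OF cos_series_weights(1)[OF assms]])
  fix k :: int
  have "\<bar>q ^ (nat \<bar>k\<bar>)\<^sup>2\<bar> * \<bar>cos (2 * pi * of_int k * u)\<bar> \<le> q ^ (nat \<bar>k\<bar>)\<^sup>2 * 1"
    using assms by (intro mult_mono) auto
  then show "norm (q ^ (nat \<bar>k\<bar>)\<^sup>2 * cos (2 * pi * of_int k * u)) \<le> q ^ (nat \<bar>k\<bar>)\<^sup>2"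
    by (simp add: abs_mult)
qed auto

lemma cos_series_fourier_coefficient:
  fixes j :: nat
  assumes "0 \<le> q" "q < 1"
  shows "continuous_on {0..1} (cos_series q)"
    and "((\<lambda>u. cos_series q u * cos (2 * pi * real j * u)) has_integral q ^ (j\<^sup>2)) {0..1}"
proof -
  define w where "w = (\<lambda>k::int. q ^ (nat \<bar>k\<bar>)\<^sup>2)"
  define F where "F = (\<lambda>j (k::int) u. w k * cos (2 * pi * of_int k * u) * cos (2 * pi * real j * u))"
  \<comment> \<open>The product of two cosines splits into the frequencies k - j and k + j, and only
    the zero frequency has a nonzero integral. For j = 0 both summands are active at k = 0 and
    together give the full weight.\<close>
  define c where "c = (\<lambda>(j::nat) (k::int). w k / 2 * of_bool (k - int j = 0) + w k / 2 * of_bool (k + int j = 0))"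
  have w: "w summable_on UNIV" unfolding w_def by (rule cos_series_weights[OF assms])
  have cont: "continuous_on {0..1} (F j k)" for j k
    unfolding F_def by (intro continuous_intros)
  have bound: "\<bar>F j k u\<bar> \<le> w k" for j k u
  proof -
    have "\<bar>w k\<bar> * \<bar>cos (2 * pi * of_int k * u)\<bar> * \<bar>cos (2 * pi * real j * u)\<bar> \<le> w k * 1 * 1"
      using assms by (intro mult_mono) (auto simp: w_def)
    then show ?thesis by (simp add: F_def abs_mult)
  qed
  have int: "(F j k has_integral c j k) {0..1}" for j k
  proof -
    have "((\<lambda>u. w k / 2 * cos (2 * pi * of_int (k - int j) * u) + w k / 2 * cos (2 * pi * of_int (k + int j) * u))
        has_integral c j k) {0..1}"
      unfolding c_def by (intro has_integral_add has_integral_mult_right integral_cos_2pi)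
    moreover have "w k / 2 * cos (2 * pi * of_int (k - int j) * u) + w k / 2 * cos (2 * pi * of_int (k + int j) * u) = F j k u" for u
    proof -
      have "2 * pi * of_int (k - int j) * u = 2 * pi * of_int k * u - 2 * pi * real j * u"
        "2 * pi * of_int (k + int j) * u = 2 * pi * of_int k * u + 2 * pi * real j * u"
        by (simp_all add: algebra_simps)
      then show ?thesis unfolding F_def by (simp only: cos_add cos_diff) (simp add: algebra_simps)
    qed
    ultimately show ?thesis by (simp add: fun_eq_iff)
  qed
  have F_sum: "(\<Sum>\<^sub>\<infinity>k. F j k u) = cos_series q u * cos (2 * pi * real j * u)" for j u
    unfolding F_def cos_series_def w_def by (rule infsum_cmult_left) (use cos_series_summable[OF assms] in auto)
  show "continuous_on {0..1} (cos_series q)"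
    using has_sum_integral_M_test(1)[where f="F 0", OF bound w cont int] by (simp add: F_sum)
  obtain S where S: "((\<lambda>u. cos_series q u * cos (2 * pi * real j * u)) has_integral S) {0..1}"
      "(c j has_sum S) UNIV"
    using has_sum_integral_M_test(2)[where f="F j", OF bound w cont int] by (auto simp: F_sum)
  have "(c j has_sum sum (c j) {int j, - int j}) UNIV"
    by (rule has_sum_finite_neutralI) (auto simp: c_def)
  moreover have "sum (c j) {int j, - int j} = q ^ j\<^sup>2"
    by (cases "j = 0") (auto simp: c_def w_def)
  ultimately have "S = q ^ j\<^sup>2" using S(2) has_sum_unique by metis
  then show "((\<lambda>u. cos_series q u * cos (2 * pi * real j * u)) has_integral q ^ (j\<^sup>2)) {0..1}"
    using S(1) by simp
qed

text \<open>The weights are nonnegative and the constant term is 1. Hence the maximum is at 0, and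
  the values at \<open>u\<close> and at 0 add up to a series of nonnegative terms whose term k = 0
  is already 2, which is the lower bound.\<close>

lemma cos_series_bounds:
  fixes q u :: real
  assumes "0 \<le> q" "q < 1"
  shows "cos_series q u \<le> cos_series q 0" "2 - cos_series q 0 \<le> cos_series q u"
    and "cos_series q 0 \<le> 1 + 2 * q / (1 - q)"
proof -
  note s = cos_series_summable[OF assms]
  show "cos_series q u \<le> cos_series q 0"
    unfolding cos_series_def using assms by (intro infsum_mono s mult_left_mono) auto
  have "(\<Sum>k\<in>{0::int}. q ^ (nat \<bar>k\<bar>)\<^sup>2 * cos (2 * pi * of_int k * u) + q ^ (nat \<bar>k\<bar>)\<^sup>2 * cos (2 * pi * of_int k * 0))
      \<le> (\<Sum>\<^sub>\<infinity>k::int. q ^ (nat \<bar>k\<bar>)\<^sup>2 * cos (2 * pi * of_int k * u) + q ^ (nat \<bar>k\<bar>)\<^sup>2 * cos (2 * pi * of_int k * 0))"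
  proof (intro finite_sum_le_infsum summable_on_add s)
    fix k :: int
    have "0 \<le> 1 + cos (2 * pi * of_int k * u)"
      using cos_ge_minus_one[of "2 * pi * of_int k * u"] by linarith
    then have "0 \<le> q ^ (nat \<bar>k\<bar>)\<^sup>2 * (1 + cos (2 * pi * of_int k * u))"
      using assms by (intro mult_nonneg_nonneg) auto
    then show "0 \<le> q ^ (nat \<bar>k\<bar>)\<^sup>2 * cos (2 * pi * of_int k * u) + q ^ (nat \<bar>k\<bar>)\<^sup>2 * cos (2 * pi * of_int k * 0)"
      by (simp add: algebra_simps)
  qed auto
  also have "\<dots> = cos_series q u + cos_series q 0"
    unfolding cos_series_def by (rule infsum_add[OF s s])
  finally show "2 - cos_series q 0 \<le> cos_series q u" by simp
  show "cos_series q 0 \<le> 1 + 2 * q / (1 - q)"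
    using cos_series_weights(2)[OF assms] by (simp add: cos_series_def)
qed

section \<open>Poisson summation and its consequences\<close>

lemma gauss_sum_eq_cos_series:
  assumes "r > 0" "u \<in> {0..1}"
  shows "gauss_sum r u = sqrt (2 * pi) * r * cos_series (exp (- 2 * pi\<^sup>2 * r\<^sup>2)) u"
proof -
  define q where "q = exp (- 2 * pi\<^sup>2 * r\<^sup>2)"
  define A where "A = sqrt (2 * pi) * r"
  have q: "0 \<le> q" "q < 1" using assms by (auto simp: q_def)
  \<comment> \<open>Poisson summation without inverting a Fourier series: the two sides are
    continuous, symmetric about 1/2 and have the same cosine coefficients.\<close>
  have "gauss_sum r u - A * cos_series q u = 0"
  proof (rule cosine_coefficients_unique[OF _ _ _ assms(2)])
    show "continuous_on {0..1} (\<lambda>u. gauss_sum r u - A * cos_series q u)"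
      by (intro continuous_intros gauss_sum_fourier_coefficient cos_series_fourier_coefficient assms q)
    show "((\<lambda>u. (gauss_sum r u - A * cos_series q u) * cos (2 * pi * real j * u)) has_integral 0) {0..1}" for j
    proof -
      have "((\<lambda>u. gauss_sum r u * cos (2 * pi * real j * u) - A * (cos_series q u * cos (2 * pi * real j * u)))
          has_integral A * q ^ j\<^sup>2 - A * q ^ j\<^sup>2) {0..1}"
        using gauss_sum_fourier_coefficient(2)[OF assms(1), of j, folded q_def A_def]
          cos_series_fourier_coefficient(2)[OF q, of j]
        by (intro has_integral_diff has_integral_mult_right)
      then show ?thesis by (simp add: algebra_simps)
    qed
    show "gauss_sum r (1 - u) - A * cos_series q (1 - u) = gauss_sum r u - A * cos_series q u" for u
    proof -
      have "gauss_sum r (1 - u) = gauss_sum r u"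
        using gauss_sum_add_int[of r "- u" 1] gauss_sum_minus[of r u] by simp
      moreover have "cos (2 * pi * of_int k * (1 - u)) = cos (2 * pi * of_int k * u)" for k :: int
      proof -
        have "2 * pi * of_int k * (1 - u) = 2 * pi * of_int k - 2 * pi * of_int k * u"
          by (simp add: algebra_simps)
        then show ?thesis by (simp only: cos_diff sin_int_2pin cos_int_2pin)
      qed
      then have "cos_series q (1 - u) = cos_series q u" by (simp add: cos_series_def)
      ultimately show ?thesis by simp
    qed
  qed
  then show ?thesis by (simp add: q_def A_def)
qed

lemma gauss_sum_frac:
  assumes "r > 0"
  shows "gauss_sum r u = sqrt (2 * pi) * r * cos_series (exp (- 2 * pi\<^sup>2 * r\<^sup>2)) (frac u)"
proof -
  have "gauss_sum r u = gauss_sum r (frac u)"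
    using gauss_sum_add_int[of r "frac u" "\<lfloor>u\<rfloor>"] by (simp add: frac_def)
  then show ?thesis
    using gauss_sum_eq_cos_series[OF assms, of "frac u"] frac_lt_1[of u] by simp
qed

text \<open>Invisible on the space side, immediate on the frequency side, where all coefficients are
  positive. It makes the discrete Gaussian subgaussian with the exact proxy
  \<open>\<sigma>\<^sup>2\<close>, and gives the upper half of the density bound for sums.\<close>

lemma gauss_sum_le_0:
  assumes "r > 0"
  shows "gauss_sum r u \<le> gauss_sum r 0"
proof -
  have "cos_series (exp (- 2 * pi\<^sup>2 * r\<^sup>2)) (frac u) \<le> cos_series (exp (- 2 * pi\<^sup>2 * r\<^sup>2)) 0"
    using assms by (intro cos_series_bounds) auto
  then show ?thesis
    using assms by (simp add: gauss_sum_frac)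
qed

text \<open>The ratio is at most (1 + e) / (1 - e) with e = 2q / (1 - q). The lower bound on r^2
  gives q \<le> 1/9, hence e \<le> 9q/4 and a ratio of about 1 + 9q/2; the constant 5 leaves room
  for the higher terms. It is half of the 10 in \<open>privacy_psi\<close>.\<close>

lemma gauss_sum_oscillation:
  assumes "r > 0" "r\<^sup>2 \<ge> 1 / 8"
  shows "gauss_sum r u \<le> exp (5 * exp (- 2 * pi\<^sup>2 * r\<^sup>2)) * gauss_sum r v"
proof -
  define q where "q = exp (- 2 * pi\<^sup>2 * r\<^sup>2)"
  have "9 \<le> pi\<^sup>2" using power_mono[of 3 pi 2] pi_gt3 by simp
  then have "9 * (1 / 8) \<le> pi\<^sup>2 * r\<^sup>2"
    using assms by (intro mult_mono) auto
  then have "q \<le> exp (- (3 / 4)) ^ 3"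
    by (simp add: q_def flip: exp_of_nat_mult)
  also have "\<dots> \<le> (12 / 25 :: real) ^ 3"
  proof (rule power_mono)
    \<comment> \<open>41/32 is the quadratic Taylor value of exp at 1/4. Its cube exceeds 25/12, and
      (12/25)^3 is just below 1/9.\<close>
    have "(41 / 32) ^ 3 \<le> exp (1 / 4 :: real) ^ 3"
      using exp_lower_Taylor_quadratic[of "1 / 4 :: real"]
      by (intro power_mono) (auto simp: power2_eq_square)
    also have "\<dots> = exp (3 / 4)" by (simp flip: exp_of_nat_mult)
    finally have "25 / 12 \<le> exp (3 / 4 :: real)" by (simp add: power3_eq_cube)
    then show "exp (- (3 / 4)) \<le> (12 / 25 :: real)" by (simp add: exp_minus field_simps)
  qed simp
  finally have q: "0 < q" "q \<le> 1 / 9" by (auto simp: q_def power3_eq_cube)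
  then have "q < 1" by simp
  define e where "e = 2 * q / (1 - q)"
  have e: "e \<le> 9 / 4 * q" using q by (simp add: e_def field_simps)
  have "cos_series q (frac u) \<le> 1 + e"
    using cos_series_bounds(1)[of q "frac u"] cos_series_bounds(3)[of q] q by (simp add: e_def)
  also have "\<dots> \<le> exp (5 * q) * (1 - e)"
  proof -
    have "1 + 5 * q + (5 * q)\<^sup>2 / 2 \<le> exp (5 * q)"
      using q by (intro exp_lower_Taylor_quadratic) auto
    have "1 + e \<le> 1 + 9 / 4 * q" using e by simp
    also have "\<dots> \<le> (1 + 5 * q + (5 * q)\<^sup>2 / 2) * (1 - 9 / 4 * q)"
    proof -
      have "0 \<le> q * (1 / 2 + 5 / 4 * q - 225 / 8 * q\<^sup>2)"
      proof (intro mult_nonneg_nonneg)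
        have "q\<^sup>2 \<le> 1 / 9 * q" unfolding power2_eq_square using q by (intro mult_right_mono) auto
        then show "0 \<le> 1 / 2 + 5 / 4 * q - 225 / 8 * q\<^sup>2" using q by simp
      qed (use q in auto)
      moreover have "(1 + 5 * q + (5 * q)\<^sup>2 / 2) * (1 - 9 / 4 * q) =
          1 + 9 / 4 * q + q * (1 / 2 + 5 / 4 * q - 225 / 8 * q\<^sup>2)"
        by (simp add: power2_eq_square field_simps)
      ultimately show ?thesis by linarith
    qed
    also have "\<dots> \<le> exp (5 * q) * (1 - e)"
      using e q \<open>1 + 5 * q + (5 * q)\<^sup>2 / 2 \<le> exp (5 * q)\<close> by (intro mult_mono) auto
    finally show ?thesis .
  qed
  also have "1 - e \<le> cos_series q (frac v)"
    using cos_series_bounds(2)[of q "frac v"] cos_series_bounds(3)[of q] q by (simp add: e_def)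
  finally have "cos_series q (frac u) \<le> exp (5 * q) * cos_series q (frac v)" by simp
  then show ?thesis
    using assms by (simp add: gauss_sum_frac q_def mult_left_mono mult.left_commute[of "exp _"])
qed

section \<open>Sums of discrete Gaussians\<close>

lemma nn_integral_count_space_infsum:
  fixes f :: "'a \<Rightarrow> real"
  assumes "f summable_on A" "\<And>x. x \<in> A \<Longrightarrow> 0 \<le> f x"
  shows "(\<integral>\<^sup>+ x. ennreal (f x) \<partial>count_space A) = ennreal (infsum f A)"
proof -
  have "(\<lambda>x. norm (f x)) summable_on A"
    using assms by (subst summable_on_cong[of A _ f]) auto
  then have "Infinite_Set_Sum.abs_summable_on f A"
    by (rule abs_summable_equivalent[THEN iffD1])
  then show ?thesis
    using assms by (simp add: nn_integral_conv_infsetsum infsetsum_infsum)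
qed

lemma gauss_sum_pos:
  assumes "r > 0"
  shows "gauss_sum r u > 0"
proof -
  have "exp (- u\<^sup>2 / (2 * r\<^sup>2)) \<le> gauss_sum r u"
    using finite_sum_le_infsum[OF gauss_sum_summable[OF assms, of u], of "{0}"]
    by (simp add: gauss_sum_def)
  then show ?thesis by (rule order_less_le_trans[OF exp_gt_zero])
qed

lemma pmf_discrete_gaussian_eq:
  assumes "\<sigma> > 0"
  shows "pmf (discrete_gaussian \<sigma>) k = exp (- (of_int k)\<^sup>2 / (2 * \<sigma>\<^sup>2)) / gauss_sum \<sigma> 0"
  using pmf_discrete_gaussian[OF assms] by (simp add: gauss_sum_def)

text \<open>Completing the square gives exactly the factor gauss_sum \<sigma> (\<sigma>^2 * t) /
  gauss_sum \<sigma> 0 beside the Gaussian value, and this ratio is at most 1.\<close>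

lemma discrete_gaussian_mgf:
  assumes "\<sigma> > 0"
  shows "(\<integral>\<^sup>+ x. ennreal (exp (t * of_int x)) \<partial>discrete_gaussian \<sigma>) \<le> ennreal (exp (\<sigma>\<^sup>2 * t\<^sup>2 / 2))"
proof -
  let ?G = "gauss_sum \<sigma>"
  define A where "A = exp (\<sigma>\<^sup>2 * t\<^sup>2 / 2) / ?G 0"
  have "A \<ge> 0" using gauss_sum_pos[OF assms, of 0] by (simp add: A_def)
  have sq: "exp (- (of_int k)\<^sup>2 / (2 * \<sigma>\<^sup>2)) * exp (t * of_int k) =
      exp (\<sigma>\<^sup>2 * t\<^sup>2 / 2) * exp (- (\<sigma>\<^sup>2 * t - of_int k)\<^sup>2 / (2 * \<sigma>\<^sup>2))" for k :: int
  proof -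
    have "- (of_int k)\<^sup>2 / (2 * \<sigma>\<^sup>2) + t * of_int k = \<sigma>\<^sup>2 * t\<^sup>2 / 2 + - (\<sigma>\<^sup>2 * t - of_int k)\<^sup>2 / (2 * \<sigma>\<^sup>2)"
      using assms by (simp add: power2_eq_square field_simps)
    then show ?thesis by (metis exp_add)
  qed
  have "(\<integral>\<^sup>+ x. ennreal (exp (t * of_int x)) \<partial>discrete_gaussian \<sigma>) =
      (\<integral>\<^sup>+ k. ennreal (A * exp (- (\<sigma>\<^sup>2 * t - of_int k)\<^sup>2 / (2 * \<sigma>\<^sup>2))) \<partial>count_space UNIV)"
    unfolding nn_integral_measure_pmf
    by (intro nn_integral_cong)
       (use sq in \<open>simp add: pmf_discrete_gaussian_eq[OF assms] A_def flip: ennreal_mult''\<close>)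
  also have "\<dots> = ennreal (A * ?G (\<sigma>\<^sup>2 * t))"
    using gauss_sum_summable[OF assms] \<open>A \<ge> 0\<close>
    by (subst nn_integral_count_space_infsum)
       (auto intro!: summable_on_cmult_right simp: gauss_sum_def infsum_cmult_right)
  also have "\<dots> \<le> ennreal (A * ?G 0)"
    using gauss_sum_le_0[OF assms] \<open>A \<ge> 0\<close> by (intro ennreal_leI mult_left_mono)
  also have "A * ?G 0 = exp (\<sigma>\<^sup>2 * t\<^sup>2 / 2)"
    using gauss_sum_pos[OF assms, of 0] by (simp add: A_def)
  finally show ?thesis .
qed

section \<open>Convolution powers of the discrete Gaussian\<close>

primrec gaussian_sum_pmf :: "real \<Rightarrow> nat \<Rightarrow> int pmf" where
  "gaussian_sum_pmf \<sigma> 0 = return_pmf 0"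
| "gaussian_sum_pmf \<sigma> (Suc n) =
     bind_pmf (gaussian_sum_pmf \<sigma> n) (\<lambda>y. map_pmf ((+) y) (discrete_gaussian \<sigma>))"

lemma gaussian_sum_mgf:
  assumes "\<sigma> > 0"
  shows "(\<integral>\<^sup>+ x. ennreal (exp (t * of_int x)) \<partial>gaussian_sum_pmf \<sigma> n) \<le> ennreal (exp (real n * \<sigma>\<^sup>2 * t\<^sup>2 / 2))"
proof (induction n)
  case (Suc n)
  have "(\<integral>\<^sup>+ x. ennreal (exp (t * of_int x)) \<partial>gaussian_sum_pmf \<sigma> (Suc n)) =
      (\<integral>\<^sup>+ y. ennreal (exp (t * of_int y)) * (\<integral>\<^sup>+ z. ennreal (exp (t * of_int z)) \<partial>discrete_gaussian \<sigma>) \<partial>gaussian_sum_pmf \<sigma> n)"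
    by (simp add: distrib_left exp_add ennreal_mult nn_integral_cmult)
  also have "\<dots> \<le> (\<integral>\<^sup>+ y. ennreal (exp (t * of_int y)) * ennreal (exp (\<sigma>\<^sup>2 * t\<^sup>2 / 2)) \<partial>gaussian_sum_pmf \<sigma> n)"
    by (intro nn_integral_mono mult_left_mono discrete_gaussian_mgf assms) auto
  also have "\<dots> \<le> ennreal (exp (real n * \<sigma>\<^sup>2 * t\<^sup>2 / 2)) * ennreal (exp (\<sigma>\<^sup>2 * t\<^sup>2 / 2))"
    using Suc by (simp add: nn_integral_multc mult_right_mono)
  also have "\<dots> = ennreal (exp (real (Suc n) * \<sigma>\<^sup>2 * t\<^sup>2 / 2))"
    by (simp flip: ennreal_mult exp_add add: field_simps)
  finally show ?case .
qed simp

lemma pmf_gaussian_sum_Suc: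
  "ennreal (pmf (gaussian_sum_pmf \<sigma> (Suc n)) x) =
    (\<integral>\<^sup>+ y. ennreal (pmf (gaussian_sum_pmf \<sigma> n) y * pmf (discrete_gaussian \<sigma>) (x - y)) \<partial>count_space UNIV)"
proof -
  have "pmf (map_pmf ((+) y) (discrete_gaussian \<sigma>)) x = pmf (discrete_gaussian \<sigma>) (x - y)" for y
    using pmf_map_inj'[of "(+) y" "discrete_gaussian \<sigma>" "x - y"] by simp
  then show ?thesis
    by (simp add: ennreal_pmf_bind nn_integral_measure_pmf ennreal_mult)
qed

text \<open>Completing the square in \<open>y\<close>. The variances n * \<sigma>^2 and \<sigma>^2
  combine harmonically to \<sigma>^2 * n / (n + 1), which is the origin of the fractions i / (i + 1)
  in \<open>privacy_psi\<close>.\<close>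

lemma gaussian_product:
  fixes x y \<sigma> :: real and n :: nat
  assumes "\<sigma> > 0" "n \<ge> 1"
  defines "\<rho> \<equiv> \<sigma> * sqrt (real n / (real n + 1))"
  shows "exp (- y\<^sup>2 / (2 * (real n * \<sigma>\<^sup>2))) * exp (- (x - y)\<^sup>2 / (2 * \<sigma>\<^sup>2)) =
    exp (- x\<^sup>2 / (2 * (real (Suc n) * \<sigma>\<^sup>2))) * exp (- (x * (real n / (real n + 1)) - y)\<^sup>2 / (2 * \<rho>\<^sup>2))"
proof -
  define N where "N = real n"
  have N: "N > 0" using assms by (simp add: N_def)
  have \<rho>: "\<rho>\<^sup>2 = \<sigma>\<^sup>2 * (N / (N + 1))" using N by (simp add: \<rho>_def N_def power_mult_distrib)
  have "- y\<^sup>2 / (2 * (N * \<sigma>\<^sup>2)) + - (x - y)\<^sup>2 / (2 * \<sigma>\<^sup>2) =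
      (- y\<^sup>2 / N - (x - y)\<^sup>2) / (2 * \<sigma>\<^sup>2)"
    using N assms by (simp add: field_simps)
  also have "- y\<^sup>2 / N - (x - y)\<^sup>2 = - x\<^sup>2 / (N + 1) - (x * (N / (N + 1)) - y)\<^sup>2 * ((N + 1) / N)"
  proof -
    have "N \<noteq> 0" "N + 1 \<noteq> 0" using N by auto
    then show ?thesis by (simp add: power2_eq_square divide_simps) algebra
  qed
  also have "\<dots> / (2 * \<sigma>\<^sup>2) = - x\<^sup>2 / (2 * ((N + 1) * \<sigma>\<^sup>2)) + - (x * (N / (N + 1)) - y)\<^sup>2 / (2 * \<rho>\<^sup>2)"
    unfolding \<rho> using N assms by (simp add: diff_divide_distrib mult.commute mult.left_commute)
  finally show ?thesis unfolding N_def[symmetric] by (simp add: N_def add.commute flip: exp_add)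
qed

text \<open>The Gaussian weights of the two factors of a convolution multiply to the Gaussian weight of
  the sum times a \<^const>\<open>gauss_sum\<close> term of variance \<open>\<sigma>\<^sup>2 n / (n + 1)\<close>, whose oscillation is
  controlled by Poisson summation.\<close>

lemma pmf_gaussian_sum_bounds:
  assumes "\<sigma> \<ge> 1 / 2" "n \<ge> 1"
  shows "\<exists>C>0. \<forall>x. C * exp (- (of_int x)\<^sup>2 / (2 * (real n * \<sigma>\<^sup>2))) \<le> pmf (gaussian_sum_pmf \<sigma> n) x \<and>
    pmf (gaussian_sum_pmf \<sigma> n) x \<le> C * exp (privacy_psi n \<sigma> / 2) * exp (- (of_int x)\<^sup>2 / (2 * (real n * \<sigma>\<^sup>2)))"
  using assms(2)
proof (induction n rule: dec_induct)
  case base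
  have "\<sigma> > 0" using assms by simp
  have "gaussian_sum_pmf \<sigma> 1 = discrete_gaussian \<sigma>"
  proof -
    have "(+) (0::int) = id" by auto
    then show ?thesis by (simp add: bind_return_pmf pmf.map_id)
  qed
  then show ?case
    using gauss_sum_pos[OF \<open>\<sigma> > 0\<close>, of 0]
    by (intro exI[of _ "1 / gauss_sum \<sigma> 0"])
       (auto simp: pmf_discrete_gaussian_eq[OF \<open>\<sigma> > 0\<close>] privacy_psi_def)
next
  case (step n)
  have "\<sigma> > 0" using assms by simp
  define \<rho> where "\<rho> = \<sigma> * sqrt (real n / (real n + 1))"
  define q where "q = exp (- 2 * pi\<^sup>2 * \<rho>\<^sup>2)"
  define \<psi> where "\<psi> = privacy_psi n \<sigma> / 2"
  define E where "E = (\<lambda>(x::int). exp (- (of_int x)\<^sup>2 / (2 * (real (Suc n) * \<sigma>\<^sup>2))))"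
  define E' where "E' = (\<lambda>(x::int). exp (- (of_int x)\<^sup>2 / (2 * (real n * \<sigma>\<^sup>2))))"
  define G where "G = gauss_sum \<sigma> 0"
  have \<rho>: "\<rho> > 0" "\<rho>\<^sup>2 = \<sigma>\<^sup>2 * (real n / (real n + 1))"
    using step \<open>\<sigma> > 0\<close> by (auto simp: \<rho>_def power_mult_distrib)
  \<comment> \<open>The worst case \<sigma> = 1/2, n = 1 meets the threshold 1/8 of the oscillation
    lemma exactly.\<close>
  have "(1/4) * (1/2) \<le> \<sigma>\<^sup>2 * (real n / (real n + 1))"
  proof (intro mult_mono)
    show "1 / 4 \<le> \<sigma>\<^sup>2" using power_mono[OF assms(1), of 2] by (simp add: power2_eq_square)
  qed (use step in \<open>auto simp: field_simps\<close>)
  then have "\<rho>\<^sup>2 \<ge> 1 / 8" by (simp add: \<rho>)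
  note osc = gauss_sum_oscillation[OF \<rho>(1) this, folded q_def]
  have "G > 0" unfolding G_def using gauss_sum_pos \<open>\<sigma> > 0\<close> by blast
  have \<psi>_Suc: "privacy_psi (Suc n) \<sigma> / 2 = \<psi> + 5 * q"
  proof -
    have "{1..Suc n - 1} = insert n {1..n - 1}" "n \<notin> {1..n - 1}" using step by auto
    then show ?thesis by (simp add: privacy_psi_def \<psi>_def q_def \<rho> ac_simps)
  qed
  from step.IH obtain C where C: "C > 0" "\<And>x. C * E' x \<le> pmf (gaussian_sum_pmf \<sigma> n) x"
      "\<And>x. pmf (gaussian_sum_pmf \<sigma> n) x \<le> C * exp \<psi> * E' x"
    by (auto simp: E'_def \<psi>_def)
  \<comment> \<open>Stated for a free constant \<open>c\<close> because it is used with
    \<open>C\<close> for the lower bound and with \<open>C * exp \<psi>\<close> for the upper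
    one.\<close>
  have conv: "(\<integral>\<^sup>+ y. ennreal (c * E' y * pmf (discrete_gaussian \<sigma>) (x - y)) \<partial>count_space UNIV) =
      ennreal (c / G * E x * gauss_sum \<rho> (of_int x * (real n / (real n + 1))))" if "c \<ge> 0" for c x
  proof -
    define K u where "K = c / G * E x" and "u = of_int x * (real n / (real n + 1))"
    have "K \<ge> 0" using \<open>c \<ge> 0\<close> \<open>G > 0\<close> by (simp add: K_def E_def)
    have "c * E' y * pmf (discrete_gaussian \<sigma>) (x - y) = K * exp (- (u - of_int y)\<^sup>2 / (2 * \<rho>\<^sup>2))" for y
      using gaussian_product[OF \<open>\<sigma> > 0\<close> step(1), of "of_int y" "of_int x", folded \<rho>_def]
      by (simp add: pmf_discrete_gaussian_eq[OF \<open>\<sigma> > 0\<close>] E_def E'_def G_def K_def u_def)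
    then have "(\<integral>\<^sup>+ y. ennreal (c * E' y * pmf (discrete_gaussian \<sigma>) (x - y)) \<partial>count_space UNIV) =
        (\<integral>\<^sup>+ y. ennreal (K * exp (- (u - of_int y)\<^sup>2 / (2 * \<rho>\<^sup>2))) \<partial>count_space UNIV)"
      by (simp only:)
    also have "\<dots> = ennreal (K * gauss_sum \<rho> u)"
      using gauss_sum_summable[OF \<rho>(1), of u] \<open>K \<ge> 0\<close>
      by (subst nn_integral_count_space_infsum)
         (auto intro!: summable_on_cmult_right simp: infsum_cmult_right gauss_sum_def)
    finally show ?thesis by (simp only: K_def u_def)
  qed
  \<comment> \<open>Built from the smallest value that the oscillation lemma leaves for the
    periodised factor. The upper bound uses its maximum, at 0, so the gap between the two grows by
    exp (5 * q), the new term of \<psi>/2.\<close>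
  define C' where "C' = C / G * exp (- (5 * q)) * gauss_sum \<rho> 0"
  have "C' > 0" using C \<open>G > 0\<close> gauss_sum_pos[OF \<rho>(1)] by (simp add: C'_def)
  moreover have "C' * E x \<le> pmf (gaussian_sum_pmf \<sigma> (Suc n)) x" for x
  proof -
    define u where "u = of_int x * (real n / (real n + 1))"
    have "C' * E x = C / G * E x * (exp (- (5 * q)) * gauss_sum \<rho> 0)"
      by (simp add: C'_def)
    also have "\<dots> \<le> C / G * E x * gauss_sum \<rho> u"
    proof (rule mult_left_mono)
      have "exp (- (5 * q)) * gauss_sum \<rho> 0 \<le> exp (- (5 * q)) * (exp (5 * q) * gauss_sum \<rho> u)"
        by (rule mult_left_mono[OF osc]) simp
      also have "\<dots> = gauss_sum \<rho> u" by (simp add: exp_minus)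
      finally show "exp (- (5 * q)) * gauss_sum \<rho> 0 \<le> gauss_sum \<rho> u" .
    qed (use C \<open>G > 0\<close> in \<open>simp add: E_def\<close>)
    finally have "ennreal (C' * E x) \<le> ennreal (C / G * E x * gauss_sum \<rho> u)"
      by (rule ennreal_leI)
    also have "\<dots> \<le> ennreal (pmf (gaussian_sum_pmf \<sigma> (Suc n)) x)"
      unfolding pmf_gaussian_sum_Suc u_def conv[OF less_imp_le[OF C(1)], symmetric]
      by (intro nn_integral_mono ennreal_leI mult_right_mono C) auto
    finally show ?thesis by simp
  qed
  moreover have "pmf (gaussian_sum_pmf \<sigma> (Suc n)) x \<le> C' * exp (privacy_psi (Suc n) \<sigma> / 2) * E x" for x
  proof -
    define u where "u = of_int x * (real n / (real n + 1))"
    have "ennreal (pmf (gaussian_sum_pmf \<sigma> (Suc n)) x) \<le> ennreal (C * exp \<psi> / G * E x * gauss_sum \<rho> u)"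
      unfolding pmf_gaussian_sum_Suc u_def
      unfolding conv[OF mult_nonneg_nonneg[OF less_imp_le[OF C(1)] exp_ge_zero], symmetric]
      by (intro nn_integral_mono ennreal_leI mult_right_mono C) auto
    moreover have "C * exp \<psi> / G * E x * gauss_sum \<rho> u \<le> C * exp \<psi> / G * E x * gauss_sum \<rho> 0"
      using C \<open>G > 0\<close> by (intro mult_left_mono gauss_sum_le_0 \<rho>) (auto simp: E_def)
    moreover have "\<dots> = C' * exp (privacy_psi (Suc n) \<sigma> / 2) * E x"
      by (simp add: C'_def \<psi>_Suc exp_add exp_minus)
    moreover have "0 \<le> C * exp \<psi> / G * E x * gauss_sum \<rho> u"
      using C \<open>G > 0\<close> gauss_sum_pos[OF \<rho>(1), of u] by (simp add: E_def)
    ultimately show ?thesis by (simp add: ennreal_le_iff)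
  qed
  ultimately show ?case
    unfolding E_def by (intro exI[of _ C'] conjI allI)
qed

section \<open>Moment bounds for the privacy loss of a shift\<close>

text \<open>The moment bound is an assumption of its own: deriving it from the pointwise bounds
  would cost a factor \<open>exp T\<close>.\<close>

locale gaussian_like =
  fixes P :: "int pmf" and v C T :: real
  assumes v_pos: "v > 0" and C_pos: "C > 0" and T_nonneg: "T \<ge> 0"
    and mgf: "\<And>t. (\<integral>\<^sup>+ x. ennreal (exp (t * of_int x)) \<partial>P) \<le> ennreal (exp (v * t\<^sup>2 / 2))"
    and lower: "\<And>x. C * exp (- (of_int x)\<^sup>2 / (2 * v)) \<le> pmf P x"
    and upper: "\<And>x. pmf P x \<le> C * exp T * exp (- (of_int x)\<^sup>2 / (2 * v))"
begin

lemma pmf_pos: "pmf P x > 0"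
  by (rule order_less_le_trans[OF _ lower]) (use C_pos in simp)

definition loss :: "int \<Rightarrow> int \<Rightarrow> real" where
  "loss d x = ln (pmf P x / pmf P (x - d))"

text \<open>The value that \<open>loss\<close> would have for weights exactly proportional to exp (-
  x^2 / (2v)). It is affine in \<open>x\<close>, so \<open>mgf\<close> applies to it
  directly.\<close>

definition gaussian_loss :: "int \<Rightarrow> int \<Rightarrow> real" where
  "gaussian_loss d x = (of_int d)\<^sup>2 / (2 * v) - of_int d / v * of_int x"

text \<open>The unknown \<open>C\<close> cancels in the ratio. Each log density lies in a window of
  width \<open>T\<close> above its Gaussian profile, so the difference of two of them errs by at
  most \<open>T\<close>, not 2T.\<close>

lemma loss_error: "\<bar>loss d x - gaussian_loss d x\<bar> \<le> T"
proof -
  have ln_bounds: "ln C - (of_int x)\<^sup>2 / (2 * v) \<le> ln (pmf P x)"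
      "ln (pmf P x) \<le> ln C + T - (of_int x)\<^sup>2 / (2 * v)" for x
  proof -
    have "ln (C * exp (- (of_int x)\<^sup>2 / (2 * v))) \<le> ln (pmf P x)"
      using lower[of x] C_pos by (subst ln_le_cancel_iff) (auto simp: pmf_pos)
    then show "ln C - (of_int x)\<^sup>2 / (2 * v) \<le> ln (pmf P x)"
      using C_pos by (simp add: ln_mult)
    have "ln (pmf P x) \<le> ln (C * exp T * exp (- (of_int x)\<^sup>2 / (2 * v)))"
      using upper[of x] C_pos by (subst ln_le_cancel_iff) (auto simp: pmf_pos)
    then show "ln (pmf P x) \<le> ln C + T - (of_int x)\<^sup>2 / (2 * v)"
      using C_pos by (simp add: ln_mult)
  qed
  have "loss d x = ln (pmf P x) - ln (pmf P (x - d))"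
    using pmf_pos[of x] pmf_pos[of "x - d"] by (simp add: loss_def ln_div)
  moreover have "gaussian_loss d x = (of_int (x - d))\<^sup>2 / (2 * v) - (of_int x)\<^sup>2 / (2 * v)"
    using v_pos by (simp add: gaussian_loss_def power2_eq_square field_simps)
  ultimately show ?thesis
    using ln_bounds[of x] ln_bounds[of "x - d"] by linarith
qed

definition shift_size :: "int \<Rightarrow> real" where
  "shift_size d = \<bar>of_int d\<bar> / sqrt v"

lemma shift_size_sq: "(shift_size d)\<^sup>2 = (of_int d)\<^sup>2 / v"
  using v_pos by (simp add: shift_size_def power_divide)

lemma gaussian_loss_mgf:
  "(\<integral>\<^sup>+ x. ennreal (exp (t * gaussian_loss d x)) \<partial>P)
    \<le> ennreal (exp (t * (shift_size d)\<^sup>2 / 2 + t\<^sup>2 * (shift_size d)\<^sup>2 / 2))"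
proof -
  have "t * gaussian_loss d x = t * (shift_size d)\<^sup>2 / 2 + (- t * of_int d / v) * of_int x" for x
    by (simp add: gaussian_loss_def shift_size_sq algebra_simps)
  then have "(\<integral>\<^sup>+ x. ennreal (exp (t * gaussian_loss d x)) \<partial>P) =
      ennreal (exp (t * (shift_size d)\<^sup>2 / 2)) * (\<integral>\<^sup>+ x. ennreal (exp ((- t * of_int d / v) * of_int x)) \<partial>P)"
    by (simp only: exp_add ennreal_mult[OF exp_ge_zero exp_ge_zero])
       (rule nn_integral_cmult, simp)
  also have "\<dots> \<le> ennreal (exp (t * (shift_size d)\<^sup>2 / 2)) * ennreal (exp (v * (- t * of_int d / v)\<^sup>2 / 2))"
    by (intro mult_left_mono mgf) auto
  also have "v * (- t * of_int d / v)\<^sup>2 / 2 = t\<^sup>2 * (shift_size d)\<^sup>2 / 2"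
    using v_pos unfolding shift_size_sq by (simp add: power2_eq_square)
  finally show ?thesis by (simp add: exp_add flip: ennreal_mult)
qed

lemma loss_mgf_additive:
  assumes "t \<ge> 0"
  shows "(\<integral>\<^sup>+ x. ennreal (exp (t * loss d x)) \<partial>P) \<le> ennreal (exp (t * (T + (1 + t) * (shift_size d)\<^sup>2 / 2)))"
proof -
  have "exp (t * loss d x) \<le> exp (t * T) * exp (t * gaussian_loss d x)" for x
  proof -
    have "t * loss d x \<le> t * (T + gaussian_loss d x)"
      using loss_error[of d x] assms by (intro mult_left_mono) auto
    then show ?thesis by (simp add: distrib_left flip: exp_add)
  qed
  then have "(\<integral>\<^sup>+ x. ennreal (exp (t * loss d x)) \<partial>P) \<le>
      (\<integral>\<^sup>+ x. ennreal (exp (t * T) * exp (t * gaussian_loss d x)) \<partial>P)"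
    by (intro nn_integral_mono ennreal_leI)
  also have "\<dots> = ennreal (exp (t * T)) * (\<integral>\<^sup>+ x. ennreal (exp (t * gaussian_loss d x)) \<partial>P)"
    by (simp add: ennreal_mult nn_integral_cmult)
  also have "\<dots> \<le> ennreal (exp (t * T)) * ennreal (exp (t * (shift_size d)\<^sup>2 / 2 + t\<^sup>2 * (shift_size d)\<^sup>2 / 2))"
    by (intro mult_left_mono gaussian_loss_mgf) auto
  also have "\<dots> = ennreal (exp (t * (T + (1 + t) * (shift_size d)\<^sup>2 / 2)))"
    by (simp add: power2_eq_square algebra_simps add_divide_distrib flip: ennreal_mult exp_add)
  finally show ?thesis .
qed

definition mean_error :: "int \<Rightarrow> real" where
  "mean_error d = measure_pmf.expectation P (\<lambda>x. loss d x - gaussian_loss d x)"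

lemma hoeffding_loss_error:
  assumes "t \<noteq> 0"
  shows "(\<integral>\<^sup>+ x. ennreal (exp (t * (loss d x - gaussian_loss d x - mean_error d))) \<partial>P) \<le> ennreal (exp (t\<^sup>2 * T\<^sup>2 / 2))"
proof -
  \<comment> \<open>Hoeffding's lemma is applied with the positive parameter
    \<open>\<bar>t\<bar>\<close>; the sign of \<open>t\<close> moves into the variable, whose range
    [-T, T] is symmetric. The range has length 2T, and (2T)^2 / 8 = T^2 / 2.\<close>
  define s where "s = sgn t"
  have s: "s * s = 1" "t = \<bar>t\<bar> * s" "s = 1 \<or> s = - 1" using assms by (auto simp: s_def sgn_if)
  define f where "f = (\<lambda>x. s * (loss d x - gaussian_loss d x))"
  have "f x \<in> {- T..T}" for x
    using s(3) loss_error[of d x] unfolding f_def abs_le_iff by auto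
  then interpret interval_bounded_random_variable P f "- T" T
    by unfold_locales auto
  have "measure_pmf.expectation P f = s * mean_error d"
    by (simp add: f_def mean_error_def)
  then have "(\<integral>\<^sup>+ x. ennreal (exp (\<bar>t\<bar> * (f x - s * mean_error d))) \<partial>P) \<le> ennreal (exp (\<bar>t\<bar>\<^sup>2 * (T - - T)\<^sup>2 / 8))"
    using Hoeffdings_lemma_nn_integral[of "\<bar>t\<bar>"] assms by simp
  moreover have "\<bar>t\<bar> * (f x - s * mean_error d) = t * (loss d x - gaussian_loss d x - mean_error d)" for x
    by (subst (2) s(2)) (simp add: f_def algebra_simps)
  ultimately show ?thesis by (simp add: power2_eq_square ac_simps)
qed

text \<open>Convexity of \<open>exp\<close> combines the bounds for the Gaussian part of the loss and for the bounded
  error with the weights \<open>a / (a + T)\<close> and \<open>T / (a + T)\<close>, which makes the two standard deviations add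
  up.\<close>

lemma loss_mgf_centered:
  assumes "t \<noteq> 0" "d \<noteq> 0" "T > 0"
  shows "(\<integral>\<^sup>+ x. ennreal (exp (t * loss d x)) \<partial>P) \<le>
    ennreal (exp (t * ((shift_size d)\<^sup>2 / 2 + mean_error d) + t\<^sup>2 * (shift_size d + T)\<^sup>2 / 2))"
proof -
  define a where "a = shift_size d"
  have a: "a > 0" using assms v_pos by (simp add: a_def shift_size_def)
  define \<mu> where "\<mu> = mean_error d"
  define w where "w = a / (a + T)"
  define w' where "w' = T / (a + T)"
  have w: "w > 0" "w' > 0" "w + w' = 1"
    using a assms by (simp_all add: w_def w'_def flip: add_divide_distrib)
  then have "w' = 1 - w" by simp
  note w = w this
  \<comment> \<open>The log moment bounds of the two parts at the stretched parameters t / w and t /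
    w'. Subtracting them inside the exponentials makes both expectations at most 1, so the convex
    combination has expectation at most 1 as well. As a / w = T / w' = a + T, both quadratic parts
    equal t^2 * (a + T)^2 / 2.\<close>
  define \<kappa> where "\<kappa> = (t / w) * a\<^sup>2 / 2 + (t / w)\<^sup>2 * a\<^sup>2 / 2"
  define \<kappa>' where "\<kappa>' = (t / w')\<^sup>2 * T\<^sup>2 / 2"
  define V where "V = t * (a\<^sup>2 / 2 + \<mu>) + t\<^sup>2 * (a + T)\<^sup>2 / 2"
  define U U' where "U = (\<lambda>x. exp ((t / w) * gaussian_loss d x))"
    and "U' = (\<lambda>x. exp ((t / w') * (loss d x - gaussian_loss d x - \<mu>)))"
  have V: "V = t * \<mu> + (w * \<kappa> + w' * \<kappa>')"
  proof -
    have "a / w = a + T" "T / w' = a + T" using a assms by (auto simp: w_def w'_def)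
    then have "(t / w)\<^sup>2 * a\<^sup>2 = t\<^sup>2 * (a + T)\<^sup>2" "(t / w')\<^sup>2 * T\<^sup>2 = t\<^sup>2 * (a + T)\<^sup>2"
      by (metis power_mult_distrib times_divide_eq_left times_divide_eq_right)+
    then have "w * \<kappa> + w' * \<kappa>' = t * a\<^sup>2 / 2 + (w + w') * (t\<^sup>2 * (a + T)\<^sup>2 / 2)"
      using w(1) by (simp add: \<kappa>_def \<kappa>'_def algebra_simps add_divide_distrib)
    then show ?thesis unfolding w(3) by (simp add: V_def algebra_simps)
  qed
  have pointwise: "exp (t * loss d x) \<le> exp V * (w * exp (- \<kappa>) * U x + w' * exp (- \<kappa>') * U' x)" for x
  proof -
    have "t * loss d x - V = w * ((t / w) * gaussian_loss d x - \<kappa>)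
        + w' * ((t / w') * (loss d x - gaussian_loss d x - \<mu>) - \<kappa>')"
      using w(1,2) by (simp add: V algebra_simps)
    also have "exp \<dots> \<le> w * exp ((t / w) * gaussian_loss d x - \<kappa>)
        + w' * exp ((t / w') * (loss d x - gaussian_loss d x - \<mu>) - \<kappa>')"
      using exp_convex w convex_onD[OF exp_convex, of w' "(t / w) * gaussian_loss d x - \<kappa>"
          "(t / w') * (loss d x - gaussian_loss d x - \<mu>) - \<kappa>'"] by simp
    also have "\<dots> = w * exp (- \<kappa>) * U x + w' * exp (- \<kappa>') * U' x"
      by (simp add: U_def U'_def exp_diff exp_minus field_simps)
    finally have "exp V * exp (t * loss d x - V) \<le> exp V * (w * exp (- \<kappa>) * U x + w' * exp (- \<kappa>') * U' x)"
      by (rule mult_left_mono) simp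
    then show ?thesis by (simp flip: exp_add)
  qed
  have "(\<integral>\<^sup>+ x. ennreal (exp (t * loss d x)) \<partial>P) \<le>
      (\<integral>\<^sup>+ x. ennreal (exp V) * (ennreal (w * exp (- \<kappa>)) * ennreal (U x) + ennreal (w' * exp (- \<kappa>')) * ennreal (U' x)) \<partial>P)"
  proof (rule nn_integral_mono)
    fix x
    have "ennreal (exp (t * loss d x)) \<le> ennreal (exp V * (w * exp (- \<kappa>) * U x + w' * exp (- \<kappa>') * U' x))"
      by (rule ennreal_leI[OF pointwise])
    also have "\<dots> = ennreal (exp V) * (ennreal (w * exp (- \<kappa>)) * ennreal (U x) + ennreal (w' * exp (- \<kappa>')) * ennreal (U' x))"
      using w by (simp add: U_def U'_def flip: ennreal_mult ennreal_plus)
    finally show "ennreal (exp (t * loss d x)) \<le> \<dots>" .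
  qed
  also have "\<dots> = ennreal (exp V) * (ennreal (w * exp (- \<kappa>)) * (\<integral>\<^sup>+ x. ennreal (U x) \<partial>P) + ennreal (w' * exp (- \<kappa>')) * (\<integral>\<^sup>+ x. ennreal (U' x) \<partial>P))"
    by (simp add: nn_integral_cmult nn_integral_add)
  also have "\<dots> \<le> ennreal (exp V) * (ennreal (w * exp (- \<kappa>)) * ennreal (exp \<kappa>) + ennreal (w' * exp (- \<kappa>')) * ennreal (exp \<kappa>'))"
  proof (intro mult_left_mono add_mono)
    show "(\<integral>\<^sup>+ x. ennreal (U x) \<partial>P) \<le> ennreal (exp \<kappa>)"
      unfolding U_def \<kappa>_def a_def by (rule gaussian_loss_mgf)
    show "(\<integral>\<^sup>+ x. ennreal (U' x) \<partial>P) \<le> ennreal (exp \<kappa>')"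
      unfolding U'_def \<kappa>'_def \<mu>_def using assms w by (intro hoeffding_loss_error) auto
  qed auto
  also have "\<dots> = ennreal (exp V * (w * exp (- \<kappa>) * exp \<kappa> + w' * exp (- \<kappa>') * exp \<kappa>'))"
    using w by (simp flip: ennreal_mult ennreal_plus)
  also have "w * exp (- \<kappa>) * exp \<kappa> + w' * exp (- \<kappa>') * exp \<kappa>' = 1"
    using w(3) by (simp add: mult.assoc flip: exp_add)
  finally show ?thesis by (simp add: V_def a_def \<mu>_def)
qed

text \<open>The expected inverse likelihood ratio is the total mass of the shifted law; full support
  of \<open>P\<close> makes this an equality.\<close>

lemma exp_minus_loss: "(\<integral>\<^sup>+ x. ennreal (exp ((- 1) * loss d x)) \<partial>P) = 1"
proof -
  have "exp (- loss d x) = pmf P (x - d) / pmf P x" for x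
    by (simp add: loss_def exp_minus pmf_pos)
  then have "pmf P x * exp ((- 1) * loss d x) = pmf P (x - d)" for x
    using pmf_pos[of x] by simp
  then have "(\<integral>\<^sup>+ x. ennreal (exp ((- 1) * loss d x)) \<partial>P) = (\<integral>\<^sup>+ x. ennreal (pmf P (x - d)) \<partial>count_space UNIV)"
    by (simp add: nn_integral_measure_pmf flip: ennreal_mult)
  also have "\<dots> = emeasure P (range (\<lambda>x. x - d))"
    by (rule nn_integral_pmf') (auto intro: injI)
  also have "range (\<lambda>x. x - d) = UNIV" by (metis surj_diff_right)
  finally show ?thesis by simp
qed

text \<open>The mean of the loss is bounded by its variance proxy because \<open>E [exp (- loss)] = 1\<close>.\<close>

lemma loss_mgf_root:
  assumes "t > 0"
  shows "(\<integral>\<^sup>+ x. ennreal (exp (t * loss d x)) \<partial>P) \<le> ennreal (exp (t * ((1 + t) * (shift_size d + T)\<^sup>2 / 2)))"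
\<comment> \<open>In these cases one of the two convexity weights would vanish.\<close>
proof (cases "d = 0 \<or> T = 0")
  case True
  then show ?thesis
  proof
    assume "d = 0"
    then have "loss d x = 0" for x using pmf_pos[of x] by (simp add: loss_def)
    then show ?thesis using assms by simp
  next
    assume "T = 0"
    then show ?thesis using loss_mgf_additive[of t d] assms by simp
  qed
next
  case False
  then have d: "d \<noteq> 0" "T > 0" using T_nonneg by auto
  define K where "K = (shift_size d)\<^sup>2 / 2 + mean_error d"
  define S where "S = (shift_size d + T)\<^sup>2 / 2"
  \<comment> \<open>At t = -1 the left-hand side of the centred bound is 1, so it bounds the mean
    instead of a moment. This is why that bound is proved for negative \<open>t\<close> too.\<close>
  have "ennreal 1 \<le> ennreal (exp (- K + S))"
    using loss_mgf_centered[OF _ d, of "- 1"] unfolding exp_minus_loss by (simp add: K_def S_def)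
  then have "K \<le> S" by simp
  have "(\<integral>\<^sup>+ x. ennreal (exp (t * loss d x)) \<partial>P) \<le> ennreal (exp (t * K + t\<^sup>2 * S))"
    using loss_mgf_centered[OF _ d, of t] assms by (simp add: K_def S_def)
  also have "\<dots> \<le> ennreal (exp (t * S + t\<^sup>2 * S))"
    using \<open>K \<le> S\<close> assms by (intro ennreal_leI) simp
  also have "t * S + t\<^sup>2 * S = t * ((1 + t) * (shift_size d + T)\<^sup>2 / 2)"
    by (simp add: S_def power2_eq_square algebra_simps add_divide_distrib)
  finally show ?thesis .
qed

end

section \<open>Renyi divergence from moments\<close>

text \<open>For t > 0 this is exp (t * D) with D the divergence of order 1 + t. As an extended
  nonnegative integral it can be manipulated before integrability is known; negative
  \<open>t\<close> correspond to orders below 1.\<close>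

definition renyi_moment :: "real \<Rightarrow> 'a pmf \<Rightarrow> 'a pmf \<Rightarrow> ennreal" where
  "renyi_moment t P Q = (\<integral>\<^sup>+ x. ennreal ((pmf P x / pmf Q x) powr t) \<partial>P)"

text \<open>The convex function v powr (- t) lies above its tangent at v = 1 / s. With v = Q(x) /
  P(x), the bound is linear in \<open>v\<close>, so integrating it against \<open>P\<close> turns
  the last term into an integral against \<open>Q\<close>.\<close>

lemma powr_tangent:
  fixes v s t :: real
  assumes "v > 0" "s > 0" "t > 0"
  shows "(1 + t) * s powr t \<le> v powr (- t) + t * (s powr (t + 1) * v)"
proof -
  have "1 + t - t * (s * v) \<le> 1 + - t * ln (s * v)"
    using ln_le_minus_one[of "s * v"] assms mult_left_mono[of "ln (s * v)" "s * v - 1" t]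
    by (simp add: algebra_simps)
  also have "\<dots> \<le> (s * v) powr (- t)"
    using assms exp_ge_add_one_self[of "- t * ln (s * v)"] by (simp add: powr_def)
  finally have "s powr t * (1 + t - t * (s * v)) \<le> s powr t * (s * v) powr (- t)"
    by (intro mult_left_mono) auto
  moreover have "s powr t * (s * v) powr (- t) = v powr (- t)"
    using assms by (simp add: powr_mult powr_minus)
  moreover have "s powr (t + 1) = s powr t * s" using assms by (simp add: powr_add)
  ultimately show ?thesis by (simp add: algebra_simps)
qed

text \<open>Truncating the likelihood ratio of the images at \<open>N\<close> makes its moment finite, so that it can be
  cancelled after integrating the tangent inequality.\<close>

lemma renyi_moment_map_le:
  assumes "t > 0" "set_pmf P \<subseteq> set_pmf Q"
  shows "renyi_moment t (map_pmf f P) (map_pmf f Q) \<le> renyi_moment t P Q"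
proof (cases "renyi_moment t P Q = \<infinity>")
  case False
  define P' Q' where "P' = map_pmf f P" and "Q' = map_pmf f Q"
  define r where "r = (\<lambda>y. pmf P' y / pmf Q' y)"
  define s where "s = (\<lambda>N y. min (r y) (real N))"
  have r_nonneg: "r y \<ge> 0" for y by (simp add: r_def)
  have s_nonneg: "s N y \<ge> 0" for N y using r_nonneg by (simp add: s_def)
  define X where "X = (\<lambda>N. \<integral>\<^sup>+ y. ennreal (s N y powr t) \<partial>P')"
  have X_le: "X N \<le> renyi_moment t P Q" if "N > 0" for N
  proof -
    have "X N \<le> (\<integral>\<^sup>+ y. ennreal (real N powr t) \<partial>P')"
      unfolding X_def using s_nonneg \<open>t > 0\<close> by (intro nn_integral_mono ennreal_leI powr_mono2) (auto simp: s_def)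
    then have X_fin: "X N \<noteq> \<infinity>" by (auto simp: top_unique)
    have X_P: "X N = (\<integral>\<^sup>+ x. ennreal (s N (f x) powr t) \<partial>P)" by (simp add: X_def P'_def)
    \<comment> \<open>The linear term of the tangent inequality: the factor Q / P changes the
      measure from \<open>P\<close> to \<open>Q\<close>, and on the image side Q' * s \<le> P'
      lowers the exponent by one. It is therefore bounded by \<open>X N\<close> itself, and t * X N
      cancels later.\<close>
    have "(\<integral>\<^sup>+ x. ennreal (s N (f x) powr (t + 1) * (pmf Q x / pmf P x)) \<partial>P)
        \<le> (\<integral>\<^sup>+ x. ennreal (s N (f x) powr (t + 1)) \<partial>Q)"
      unfolding nn_integral_measure_pmf
    proof (rule nn_integral_mono)
      fix x
      show "ennreal (pmf P x) * ennreal (s N (f x) powr (t + 1) * (pmf Q x / pmf P x))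
          \<le> ennreal (pmf Q x) * ennreal (s N (f x) powr (t + 1))"
        by (cases "pmf P x = 0") (auto simp flip: ennreal_mult simp: mult.commute)
    qed
    also have "\<dots> = (\<integral>\<^sup>+ y. ennreal (s N y powr (t + 1)) \<partial>Q')" by (simp add: Q'_def)
    also have "\<dots> \<le> X N"
      unfolding X_def nn_integral_measure_pmf
    proof (rule nn_integral_mono)
      fix y
      have "pmf Q' y * s N y powr (t + 1) = (pmf Q' y * s N y) * s N y powr t"
        using s_nonneg[of N y] by (cases "s N y = 0") (auto simp: powr_add)
      also have "\<dots> \<le> pmf P' y * s N y powr t"
      proof (rule mult_right_mono)
        have "pmf Q' y * s N y \<le> pmf Q' y * r y" by (intro mult_left_mono) (auto simp: s_def)
        also have "\<dots> \<le> pmf P' y" by (cases "pmf Q' y = 0") (auto simp: r_def)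
        finally show "pmf Q' y * s N y \<le> pmf P' y" .
      qed auto
      finally show "ennreal (pmf Q' y) * ennreal (s N y powr (t + 1)) \<le> ennreal (pmf P' y) * ennreal (s N y powr t)"
        by (simp add: ennreal_leI flip: ennreal_mult)
    qed
    finally have second: "(\<integral>\<^sup>+ x. ennreal (s N (f x) powr (t + 1) * (pmf Q x / pmf P x)) \<partial>P) \<le> X N" .
    have "X N + ennreal t * X N = (\<integral>\<^sup>+ x. ennreal ((1 + t) * s N (f x) powr t) \<partial>P)"
      unfolding X_P using \<open>t > 0\<close>
      by (simp add: ennreal_mult ennreal_plus distrib_right)
         (subst nn_integral_add, auto simp: nn_integral_cmult)
    also have "\<dots> \<le> (\<integral>\<^sup>+ x. (ennreal ((pmf P x / pmf Q x) powr t) +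
        ennreal t * ennreal (s N (f x) powr (t + 1) * (pmf Q x / pmf P x))) \<partial>P)"
    proof (intro nn_integral_mono_AE AE_pmfI)
      fix x assume x: "x \<in> set_pmf P"
      then have pos: "pmf P x > 0" "pmf Q x > 0" using assms by (auto simp: pmf_positive)
      have "f x \<in> set_pmf P'" "f x \<in> set_pmf Q'" using x assms by (auto simp: P'_def Q'_def)
      then have "s N (f x) > 0" using \<open>N > 0\<close> by (auto simp: s_def r_def pmf_positive)
      from powr_tangent[OF _ this \<open>t > 0\<close>, of "pmf Q x / pmf P x"] pos
      have "(1 + t) * s N (f x) powr t \<le> (pmf P x / pmf Q x) powr t +
          t * (s N (f x) powr (t + 1) * (pmf Q x / pmf P x))"
        by (simp add: powr_minus powr_divide)
      then have "ennreal ((1 + t) * s N (f x) powr t) \<le> ennreal ((pmf P x / pmf Q x) powr t +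
          t * (s N (f x) powr (t + 1) * (pmf Q x / pmf P x)))"
        by (rule ennreal_leI)
      also have "\<dots> = ennreal ((pmf P x / pmf Q x) powr t) +
          ennreal t * ennreal (s N (f x) powr (t + 1) * (pmf Q x / pmf P x))"
        unfolding ennreal_mult'[OF less_imp_le[OF \<open>t > 0\<close>], symmetric]
        using \<open>t > 0\<close> by (intro ennreal_plus) auto
      finally show "ennreal ((1 + t) * s N (f x) powr t) \<le> \<dots>" .
    qed
    also have "\<dots> = renyi_moment t P Q + ennreal t * (\<integral>\<^sup>+ x. ennreal (s N (f x) powr (t + 1) * (pmf Q x / pmf P x)) \<partial>P)"
      by (simp add: renyi_moment_def nn_integral_add nn_integral_cmult)
    also have "\<dots> \<le> renyi_moment t P Q + ennreal t * X N"
      by (intro add_left_mono mult_left_mono second) auto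
    finally have "X N + ennreal t * X N \<le> renyi_moment t P Q + ennreal t * X N" .
    then have "ennreal t * X N + X N \<le> ennreal t * X N + renyi_moment t P Q"
      by (simp only: add.commute)
    then show ?thesis
      using X_fin by (simp add: ennreal_add_left_cancel_le ennreal_mult_eq_top_iff)
  qed
  have "renyi_moment t P' Q' \<le> (\<integral>\<^sup>+ y. (SUP N. ennreal (s N y powr t)) \<partial>P')"
    unfolding renyi_moment_def
  proof (rule nn_integral_mono)
    fix y
    obtain N where "r y \<le> real N" using real_arch_simple by blast
    then have "ennreal ((pmf P' y / pmf Q' y) powr t) = ennreal (s N y powr t)"
      by (simp add: s_def r_def min_def)
    also have "\<dots> \<le> (SUP N. ennreal (s N y powr t))" by (rule SUP_upper) simp
    finally show "ennreal ((pmf P' y / pmf Q' y) powr t) \<le> \<dots>" .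
  qed
  also have "\<dots> = (SUP N. X N)"
    unfolding X_def
  proof (rule nn_integral_monotone_convergence_SUP)
    show "incseq (\<lambda>N y. ennreal (s N y powr t))"
      using s_nonneg \<open>t > 0\<close>
      by (auto simp: incseq_def le_fun_def s_def intro!: ennreal_leI powr_mono2 r_nonneg)
  qed auto
  also have "\<dots> \<le> renyi_moment t P Q"
  proof (rule SUP_least)
    fix N :: nat
    show "X N \<le> renyi_moment t P Q"
    proof (cases "N = 0")
      case True
      have "s 0 y = 0" for y using r_nonneg[of y] by (simp add: s_def)
      then show ?thesis using True by (simp add: X_def)
    qed (use X_le in simp)
  qed
  finally show ?thesis by (simp add: P'_def Q'_def)
qed simp

section \<open>Divergences of all orders from moments\<close>

lemma expectation_pmf_pos:
  fixes f :: "'a \<Rightarrow> real"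
  assumes "integrable (measure_pmf P) f" "\<And>x. x \<in> set_pmf P \<Longrightarrow> f x > 0"
  shows "measure_pmf.expectation P f > 0"
proof -
  have "measure_pmf.expectation P f \<ge> 0"
    using assms by (intro integral_nonneg_AE AE_pmfI) (auto simp: less_imp_le)
  moreover have "measure_pmf.expectation P f \<noteq> 0"
  proof
    assume "measure_pmf.expectation P f = 0"
    then have "AE x in P. f x = 0"
      using assms by (subst (asm) integral_nonneg_eq_0_iff_AE) (auto intro!: AE_pmfI simp: less_imp_le)
    then show False
      using assms(2) set_pmf_not_empty[of P] by (force simp: AE_measure_pmf_iff)
  qed
  ultimately show ?thesis by simp
qed

lemma renyi_moment_finite:
  assumes "renyi_moment t P Q \<le> ennreal B"
  shows "integrable (measure_pmf P) (\<lambda>x. (pmf P x / pmf Q x) powr t)"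
    and "B \<ge> 0 \<Longrightarrow> measure_pmf.expectation P (\<lambda>x. (pmf P x / pmf Q x) powr t) \<le> B"
proof -
  show i: "integrable (measure_pmf P) (\<lambda>x. (pmf P x / pmf Q x) powr t)"
    using assms unfolding renyi_moment_def
    by (intro integrableI_nonneg) (auto simp: le_less_trans)
  have e: "renyi_moment t P Q = ennreal (measure_pmf.expectation P (\<lambda>x. (pmf P x / pmf Q x) powr t))"
    unfolding renyi_moment_def using i by (intro nn_integral_eq_integral) auto
  show "measure_pmf.expectation P (\<lambda>x. (pmf P x / pmf Q x) powr t) \<le> B" if "B \<ge> 0"
    using assms that unfolding e by simp
qed

text \<open>It supplies an integrable majorant for the powers with exponent between -1 and 0 and for
  the negative part of the log ratio, independently of any privacy bound.\<close>

lemma renyi_moment_minus_one: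
  assumes "set_pmf P \<subseteq> set_pmf Q"
  shows "renyi_moment (- 1) P Q \<le> 1"
proof -
  have "renyi_moment (- 1) P Q \<le> (\<integral>\<^sup>+ x. ennreal (pmf Q x) \<partial>count_space UNIV)"
    unfolding renyi_moment_def nn_integral_measure_pmf
  proof (rule nn_integral_mono)
    fix x
    show "ennreal (pmf P x) * ennreal ((pmf P x / pmf Q x) powr - 1) \<le> ennreal (pmf Q x)"
      by (cases "pmf P x = 0"; cases "pmf Q x = 0")
         (auto simp: powr_minus_divide simp flip: ennreal_mult)
  qed
  then show ?thesis by (simp add: nn_integral_pmf)
qed

text \<open>The limit t \<rightarrow> 0 of the moment bound. The inequality 1 + x \<le> exp x gives
  the mean bound u + (1 + t) * w for each fixed \<open>t\<close>, so no limit of divergences has to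
  be taken; integrability comes from \<bar>ln r\<bar> \<le> r + 1/r.\<close>

lemma kl_bound:
  assumes supp: "set_pmf P = set_pmf Q"
    and moment: "\<And>t. t > 0 \<Longrightarrow> renyi_moment t P Q \<le> ennreal (exp (t * (u + (1 + t) * w)))"
    and w: "w \<ge> 0"
  shows "integrable (measure_pmf P) (\<lambda>x. ln (pmf P x / pmf Q x))"
    and "measure_pmf.expectation P (\<lambda>x. ln (pmf P x / pmf Q x)) \<le> u + w"
proof -
  define r where "r x = pmf P x / pmf Q x" for x
  have r_pos: "r x > 0" if "x \<in> set_pmf P" for x
    using that supp by (simp add: r_def pmf_positive)
  have i1: "integrable (measure_pmf P) (\<lambda>x. r x powr 1)"
    unfolding r_def using moment[of 1] by (intro renyi_moment_finite) auto
  have i2: "integrable (measure_pmf P) (\<lambda>x. r x powr (- 1))"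
    unfolding r_def using renyi_moment_minus_one[of P Q] supp
    by (intro renyi_moment_finite[where B=1]) auto
  show int: "integrable (measure_pmf P) (\<lambda>x. ln (pmf P x / pmf Q x))"
    unfolding r_def[symmetric]
  proof (rule Bochner_Integration.integrable_bound[OF Bochner_Integration.integrable_add[OF i1 i2]])
    show "AE x in P. norm (ln (r x)) \<le> norm (r x powr 1 + r x powr (- 1))"
    proof (rule AE_pmfI)
      fix x assume "x \<in> set_pmf P"
      then have r: "r x > 0" by (rule r_pos)
      have "ln (r x) \<le> r x - 1" "ln (inverse (r x)) \<le> inverse (r x) - 1"
        using r by (auto intro: ln_le_minus_one)
      moreover have "0 < inverse (r x)" using r by simp
      ultimately have "\<bar>ln (r x)\<bar> \<le> r x + inverse (r x)"
        using r unfolding ln_inverse by linarith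
      then show "norm (ln (r x)) \<le> norm (r x powr 1 + r x powr (- 1))"
        using r by (simp add: powr_minus)
    qed
  qed simp
  have le: "measure_pmf.expectation P (\<lambda>x. ln (r x)) \<le> u + (1 + t) * w" if "t > 0" for t
  proof -
    define m where "m = u + (1 + t) * w"
    have i: "integrable (measure_pmf P) (\<lambda>x. r x powr t)"
      and e: "measure_pmf.expectation P (\<lambda>x. r x powr t) \<le> exp (t * m)"
      unfolding r_def m_def using moment[OF that] by (auto intro: renyi_moment_finite)
    have "measure_pmf.expectation P (\<lambda>x. 1 + t * (ln (r x) - m)) \<le>
        measure_pmf.expectation P (\<lambda>x. exp (- t * m) * r x powr t)"
    proof (rule integral_mono_AE)
      show "AE x in P. 1 + t * (ln (r x) - m) \<le> exp (- t * m) * r x powr t"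
      proof (rule AE_pmfI)
        fix x assume "x \<in> set_pmf P"
        then have "exp (- t * m) * r x powr t = exp (t * (ln (r x) - m))"
          using r_pos[of x] by (simp add: powr_def algebra_simps flip: exp_add)
        then show "1 + t * (ln (r x) - m) \<le> exp (- t * m) * r x powr t"
          by (metis exp_ge_add_one_self)
      qed
    qed (use i int[folded r_def] in auto)
    also have "\<dots> \<le> exp (- t * m) * exp (t * m)"
      using e by (simp add: mult_left_mono)
    also have "\<dots> = 1" by (simp flip: exp_add)
    finally have "t * (measure_pmf.expectation P (\<lambda>x. ln (r x)) - m) \<le> 0"
      using int[folded r_def] by simp
    then show ?thesis using that by (simp add: mult_le_0_iff m_def)
  qed
  show "measure_pmf.expectation P (\<lambda>x. ln (pmf P x / pmf Q x)) \<le> u + w"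
    unfolding r_def[symmetric]
  proof (rule field_le_epsilon)
    fix e :: real assume "e > 0"
    have "e / (w + 1) * w \<le> e" using \<open>e > 0\<close> w by (simp add: field_simps)
    then show "measure_pmf.expectation P (\<lambda>x. ln (r x)) \<le> u + w + e"
      using le[of "e / (w + 1)"] \<open>e > 0\<close> w by (simp add: distrib_right)
  qed
qed

text \<open>Jensen's inequality, again through 1 + x \<le> exp x. For orders below 1 the logarithm
  is divided by a negative number, so a lower bound on the moment is what bounds the divergence from
  above.\<close>

lemma renyi_moment_negative:
  assumes supp: "set_pmf P = set_pmf Q" and s: "0 < s" "s < 1"
    and int: "integrable (measure_pmf P) (\<lambda>x. ln (pmf P x / pmf Q x))"
    and K: "measure_pmf.expectation P (\<lambda>x. ln (pmf P x / pmf Q x)) \<le> K"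
  shows "integrable (measure_pmf P) (\<lambda>x. (pmf P x / pmf Q x) powr (- s))"
    and "exp (- s * K) \<le> measure_pmf.expectation P (\<lambda>x. (pmf P x / pmf Q x) powr (- s))"
proof -
  define r where "r x = pmf P x / pmf Q x" for x
  have r_pos: "r x > 0" if "x \<in> set_pmf P" for x
    using that supp by (simp add: r_def pmf_positive)
  have i2: "integrable (measure_pmf P) (\<lambda>x. 1 + r x powr (- 1))"
    unfolding r_def using renyi_moment_minus_one[of P Q] supp
    by (intro Bochner_Integration.integrable_add renyi_moment_finite[where B=1]) auto
  show i: "integrable (measure_pmf P) (\<lambda>x. (pmf P x / pmf Q x) powr (- s))"
    unfolding r_def[symmetric]
  proof (rule Bochner_Integration.integrable_bound[OF i2])
    show "AE x in P. norm (r x powr (- s)) \<le> norm (1 + r x powr (- 1))"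
    proof (rule AE_pmfI)
      fix x assume "x \<in> set_pmf P"
      then have r: "r x > 0" by (rule r_pos)
      have "r x powr (- s) \<le> max 1 (r x powr (- 1))"
      proof (cases "r x \<ge> 1")
        case True
        then show ?thesis using powr_mono[of "- s" 0 "r x"] s by simp
      next
        case False
        then show ?thesis using powr_mono'[of "- 1" "- s" "r x"] s r by (simp add: le_max_iff_disj)
      qed
      moreover have "0 \<le> r x powr (- 1)" "0 \<le> r x powr (- s)" by simp_all
      ultimately show "norm (r x powr (- s)) \<le> norm (1 + r x powr (- 1))"
        unfolding real_norm_def by linarith
    qed
  qed simp
  have "measure_pmf.expectation P (\<lambda>x. 1 + - s * (ln (r x) - K)) \<le>
      measure_pmf.expectation P (\<lambda>x. exp (s * K) * r x powr (- s))"
  proof (rule integral_mono_AE)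
    show "AE x in P. 1 + - s * (ln (r x) - K) \<le> exp (s * K) * r x powr (- s)"
    proof (rule AE_pmfI)
      fix x assume "x \<in> set_pmf P"
      then have "exp (s * K) * r x powr (- s) = exp (- s * (ln (r x) - K))"
        using r_pos[of x] by (simp add: powr_def algebra_simps flip: exp_add)
      then show "1 + - s * (ln (r x) - K) \<le> exp (s * K) * r x powr (- s)"
        by (metis exp_ge_add_one_self)
    qed
  qed (use i[folded r_def] int[folded r_def] in auto)
  moreover have "1 \<le> measure_pmf.expectation P (\<lambda>x. 1 + - s * (ln (r x) - K))"
    using int[folded r_def] K[folded r_def] s by (simp add: mult_le_0_iff)
  ultimately have "1 \<le> exp (s * K) * measure_pmf.expectation P (\<lambda>x. r x powr (- s))" by simp
  then show "exp (- s * K) \<le> measure_pmf.expectation P (\<lambda>x. (pmf P x / pmf Q x) powr (- s))"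
    unfolding r_def[symmetric] by (simp add: exp_minus field_simps)
qed

text \<open>Both sides are the sum of P^a * Q^(1 - a).\<close>

lemma renyi_moment_skew:
  assumes "set_pmf P = set_pmf Q"
  shows "renyi_moment (a - 1) P Q = renyi_moment (- a) Q P"
  unfolding renyi_moment_def nn_integral_measure_pmf
proof (rule nn_integral_cong)
  fix x
  show "ennreal (pmf P x) * ennreal ((pmf P x / pmf Q x) powr (a - 1)) =
      ennreal (pmf Q x) * ennreal ((pmf Q x / pmf P x) powr (- a))"
  proof (cases "x \<in> set_pmf P")
    case True
    then have "pmf P x > 0" "pmf Q x > 0" using assms by (auto simp: pmf_positive)
    then show ?thesis
      by (simp add: powr_divide powr_minus powr_diff flip: ennreal_mult)
  next
    case False
    then have "pmf P x = 0" "pmf Q x = 0" using assms by (auto simp: pmf_eq_0_set_pmf)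
    then show ?thesis by simp
  qed
qed

lemma renyi_divergence_le_of_moments:
  assumes supp: "set_pmf P = set_pmf Q" and w: "w \<ge> 0" and "\<alpha> \<ge> 1"
    and moment: "\<And>t. t > 0 \<Longrightarrow> renyi_moment t P Q \<le> ennreal (exp (t * (u + (1 + t) * w)))"
  shows "renyi_divergence \<alpha> P Q \<le> ereal (u + \<alpha> * w)"
proof (cases "\<alpha> = 1")
  case True
  then show ?thesis
    using kl_bound[OF supp moment w] supp by (simp add: renyi_divergence_def Let_def)
next
  case False
  then have \<alpha>: "\<alpha> > 1" using assms by simp
  define f where "f = (\<lambda>x. (pmf P x / pmf Q x) powr (\<alpha> - 1))"
  have i: "integrable (measure_pmf P) f"
    and e: "measure_pmf.expectation P f \<le> exp ((\<alpha> - 1) * (u + \<alpha> * w))"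
    unfolding f_def using moment[of "\<alpha> - 1"] \<alpha> by (auto intro: renyi_moment_finite)
  have pos: "measure_pmf.expectation P f > 0"
    using i supp by (intro expectation_pmf_pos) (auto simp: f_def pmf_eq_0_set_pmf)
  have "ln (measure_pmf.expectation P f) \<le> (\<alpha> - 1) * (u + \<alpha> * w)"
    using e pos by (metis exp_gt_zero ln_exp ln_le_cancel_iff)
  then show ?thesis
    using \<alpha> i pos supp by (simp add: renyi_divergence_def Let_def f_def[symmetric] divide_le_eq mult.commute)
qed

text \<open>Jensen for \<open>P\<close> against \<open>Q\<close> gives - ln E \<le> (1 - \<alpha>) *
  K, which alone bounds the divergence only by K, without the factor \<alpha>. Jensen for the
  reversed pair gives - ln E \<le> \<alpha> * K. The minimum of \<alpha> and 1 - \<alpha> is at most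
  2 * \<alpha> * (1 - \<alpha>), since the larger of them is at least 1/2.\<close>

lemma renyi_divergence_le_of_moments_small_order:
  assumes supp: "set_pmf P = set_pmf Q" and w: "w \<ge> 0" "u \<ge> 0" and \<alpha>: "0 < \<alpha>" "\<alpha> < 1"
    and moment: "\<And>t. t > 0 \<Longrightarrow> renyi_moment t P Q \<le> ennreal (exp (t * (u + (1 + t) * w)))"
    and moment': "\<And>t. t > 0 \<Longrightarrow> renyi_moment t Q P \<le> ennreal (exp (t * (u + (1 + t) * w)))"
  shows "renyi_divergence \<alpha> P Q \<le> ereal (2 * \<alpha> * (u + w))"
proof -
  define K where "K = u + w"
  have "K \<ge> 0" using w by (simp add: K_def)
  define E where "E = measure_pmf.expectation P (\<lambda>x. (pmf P x / pmf Q x) powr (\<alpha> - 1))"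
  note PQ = renyi_moment_negative[OF supp _ _ kl_bound[OF supp moment w(1)], of "1 - \<alpha>"]
  note QP = renyi_moment_negative[OF supp[symmetric] _ _ kl_bound[OF supp[symmetric] moment' w(1)], of \<alpha>]
  have i: "integrable (measure_pmf P) (\<lambda>x. (pmf P x / pmf Q x) powr (\<alpha> - 1))"
    and E1: "exp (- (1 - \<alpha>) * K) \<le> E"
    using PQ \<alpha> by (auto simp: E_def K_def)
  have "E > 0" using E1 by (rule order_less_le_trans[OF exp_gt_zero])
  have "ennreal E = renyi_moment (\<alpha> - 1) P Q"
    unfolding renyi_moment_def E_def using i by (intro nn_integral_eq_integral[symmetric]) auto
  also have "\<dots> = renyi_moment (- \<alpha>) Q P" by (rule renyi_moment_skew[OF supp])
  also have "\<dots> = ennreal (measure_pmf.expectation Q (\<lambda>x. (pmf Q x / pmf P x) powr (- \<alpha>)))"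
    unfolding renyi_moment_def using QP(1) \<alpha> by (intro nn_integral_eq_integral) auto
  finally have "E = measure_pmf.expectation Q (\<lambda>x. (pmf Q x / pmf P x) powr (- \<alpha>))"
    using \<open>E > 0\<close> by (subst (asm) ennreal_inj) auto
  then have E2: "exp (- \<alpha> * K) \<le> E" using QP(2) \<alpha> by (simp add: K_def)
  have "- (1 - \<alpha>) * K \<le> ln E" "- \<alpha> * K \<le> ln E"
    using E1 E2 \<open>E > 0\<close> by (simp_all add: ln_ge_iff)
  then have ineq: "- ln E \<le> (1 - \<alpha>) * K" "- ln E \<le> \<alpha> * K" by linarith+
  have "- ln E \<le> (1 - \<alpha>) * (2 * \<alpha> * K)"
  proof (cases "\<alpha> \<le> 1 / 2")
    case True
    have "\<alpha> * K * 1 \<le> \<alpha> * K * (2 * (1 - \<alpha>))"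
      using True \<alpha> \<open>K \<ge> 0\<close> by (intro mult_left_mono) auto
    then show ?thesis using ineq(2) by (simp add: ac_simps)
  next
    case False
    have "(1 - \<alpha>) * K * 1 \<le> (1 - \<alpha>) * K * (2 * \<alpha>)"
      using False \<alpha> \<open>K \<ge> 0\<close> by (intro mult_left_mono) auto
    then show ?thesis using ineq(1) by (simp add: ac_simps)
  qed
  then have "ln E / (\<alpha> - 1) \<le> 2 * \<alpha> * K"
    using \<alpha> by (simp add: neg_divide_le_eq algebra_simps)
  then show ?thesis
    using \<alpha> i \<open>E > 0\<close> by (simp add: renyi_divergence_def Let_def E_def[symmetric] K_def)
qed

section \<open>The law of the aggregated noise\<close>

lemma gaussian_sum_gaussian_like:
  assumes "\<sigma> \<ge> 1 / 2" "n \<ge> 1"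
  obtains C where "gaussian_like (gaussian_sum_pmf \<sigma> n) (real n * \<sigma>\<^sup>2) C (privacy_psi n \<sigma> / 2)"
proof -
  obtain C where C: "C > 0"
    "\<And>x. C * exp (- (of_int x)\<^sup>2 / (2 * (real n * \<sigma>\<^sup>2))) \<le> pmf (gaussian_sum_pmf \<sigma> n) x"
    "\<And>x. pmf (gaussian_sum_pmf \<sigma> n) x \<le> C * exp (privacy_psi n \<sigma> / 2) * exp (- (of_int x)\<^sup>2 / (2 * (real n * \<sigma>\<^sup>2)))"
    using pmf_gaussian_sum_bounds[OF assms] by blast
  have "gaussian_like (gaussian_sum_pmf \<sigma> n) (real n * \<sigma>\<^sup>2) C (privacy_psi n \<sigma> / 2)"
  proof
    show "privacy_psi n \<sigma> / 2 \<ge> 0" by (simp add: privacy_psi_def sum_nonneg)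
  qed (use assms C gaussian_sum_mgf in auto)
  then show thesis by (rule that)
qed

text \<open>The moment of \<open>p\<close> against its translate by \<open>d\<close>, that is, the
  contribution of one node to the moment of the product law.\<close>

definition shift_moment :: "real \<Rightarrow> int pmf \<Rightarrow> int \<Rightarrow> ennreal" where
  "shift_moment t p d = (\<integral>\<^sup>+ x. ennreal ((pmf p x / pmf p (x - d)) powr t) \<partial>p)"

text \<open>The two bounds are written in the common shape u + (1 + t) * v, including the idle 0, so
  that everything up to the divergence is proved once for generic \<open>u\<close> and
  \<open>v\<close>.\<close>

lemma shift_moment_gaussian_sum:
  fixes d :: int
  assumes "\<sigma> \<ge> 1 / 2" "n \<ge> 1" "t > 0"
  defines "T \<equiv> privacy_psi n \<sigma> / 2" and "a \<equiv> \<bar>real_of_int d\<bar> / (sqrt (real n) * \<sigma>)"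
  shows "shift_moment t (gaussian_sum_pmf \<sigma> n) d \<le> ennreal (exp (t * (T + (1 + t) * (a\<^sup>2 / 2))))"
    and "shift_moment t (gaussian_sum_pmf \<sigma> n) d \<le> ennreal (exp (t * (0 + (1 + t) * ((a + T)\<^sup>2 / 2))))"
proof -
  obtain C where "gaussian_like (gaussian_sum_pmf \<sigma> n) (real n * \<sigma>\<^sup>2) C (privacy_psi n \<sigma> / 2)"
    using gaussian_sum_gaussian_like assms by blast
  then interpret gaussian_like "gaussian_sum_pmf \<sigma> n" "real n * \<sigma>\<^sup>2" C T
    by (simp add: T_def)
  have a: "shift_size d = a"
    using assms by (simp add: shift_size_def a_def real_sqrt_mult)
  have "exp (t * loss d x) = (pmf (gaussian_sum_pmf \<sigma> n) x / pmf (gaussian_sum_pmf \<sigma> n) (x - d)) powr t" for x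
    using pmf_pos[of x] pmf_pos[of "x - d"] by (auto simp: loss_def powr_def)
  then have "shift_moment t (gaussian_sum_pmf \<sigma> n) d = (\<integral>\<^sup>+ x. ennreal (exp (t * loss d x)) \<partial>gaussian_sum_pmf \<sigma> n)"
    by (simp add: shift_moment_def)
  then show "shift_moment t (gaussian_sum_pmf \<sigma> n) d \<le> ennreal (exp (t * (T + (1 + t) * (a\<^sup>2 / 2))))"
    "shift_moment t (gaussian_sum_pmf \<sigma> n) d \<le> ennreal (exp (t * (0 + (1 + t) * ((a + T)\<^sup>2 / 2))))"
    using loss_mgf_additive[of t d] loss_mgf_root[of t d] assms(3) by (simp_all add: a)
qed

lemma set_gaussian_sum:
  assumes "\<sigma> \<ge> 1 / 2" "n \<ge> 1"
  shows "set_pmf (gaussian_sum_pmf \<sigma> n) = UNIV"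
proof -
  obtain C where "gaussian_like (gaussian_sum_pmf \<sigma> n) (real n * \<sigma>\<^sup>2) C (privacy_psi n \<sigma> / 2)"
    using gaussian_sum_gaussian_like assms by blast
  from gaussian_like.pmf_pos[OF this] have "pmf (gaussian_sum_pmf \<sigma> n) x \<noteq> 0" for x
    by (rule less_imp_neq[symmetric])
  then show ?thesis by (auto simp: set_pmf_iff)
qed

section \<open>Reduction of the protocol to independent noise at the nodes\<close>

lemma sum_Pi_pmf_gaussian:
  "map_pmf (\<lambda>f. \<Sum>i = 1..n. f i) (Pi_pmf {1..n} 0 (\<lambda>_. discrete_gaussian \<sigma>)) = gaussian_sum_pmf \<sigma> n"
proof (induction n)
  case (Suc n)
  have ins: "{1..Suc n} = insert (Suc n) {1..n}" by auto
  have "(\<Sum>i = 1..Suc n. (f(Suc n := y)) i) = (\<Sum>i = 1..n. f i) + y" for f :: "nat \<Rightarrow> int" and y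
    unfolding ins by (subst sum.insert) (auto intro!: sum.cong)
  then have "map_pmf (\<lambda>f. \<Sum>i = 1..Suc n. f i) (Pi_pmf {1..Suc n} 0 (\<lambda>_. discrete_gaussian \<sigma>)) =
      bind_pmf (Pi_pmf {1..n} 0 (\<lambda>_. discrete_gaussian \<sigma>)) (\<lambda>f. map_pmf (\<lambda>y. (\<Sum>i = 1..n. f i) + y) (discrete_gaussian \<sigma>))"
    unfolding ins
    by (subst Pi_pmf_insert)
       (simp_all add: map_pmf_def pair_pmf_def bind_assoc_pmf bind_return_pmf add.commute
          bind_commute_pmf[of "discrete_gaussian \<sigma>"])
  then show ?case
    by (simp flip: Suc.IH add: bind_map_pmf)
qed simp

text \<open>Groups the noise by node with the clients as inner index, so that the sum over clients
  acts inside each factor. A node outside \<open>B\<close> gets the constant function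
  \<open>d\<close>, in agreement with the default of the joint family.\<close>

lemma Pi_pmf_uncurry:
  assumes "finite A" "finite B"
  shows "Pi_pmf (A \<times> B) d (\<lambda>_. p) =
    map_pmf (\<lambda>f (i, \<nu>). f \<nu> i) (Pi_pmf B (\<lambda>_. d) (\<lambda>_. Pi_pmf A d (\<lambda>_. p)))"
proof (rule pmf_eqI)
  fix \<xi> :: "'a \<times> 'b \<Rightarrow> 'c"
  let ?g = "\<lambda>(f :: 'b \<Rightarrow> 'a \<Rightarrow> 'c) (i, \<nu>). f \<nu> i"
  define f where "f = (\<lambda>\<nu> i. \<xi> (i, \<nu>))"
  have "inj ?g" by (rule injI) (auto simp: fun_eq_iff)
  have \<xi>: "\<xi> = ?g f" by (simp add: f_def fun_eq_iff)
  have "pmf (map_pmf ?g (Pi_pmf B (\<lambda>_. d) (\<lambda>_. Pi_pmf A d (\<lambda>_. p)))) \<xi> =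
      pmf (Pi_pmf B (\<lambda>_. d) (\<lambda>_. Pi_pmf A d (\<lambda>_. p))) f"
    unfolding \<xi> by (rule pmf_map_inj'[OF \<open>inj ?g\<close>])
  also have "\<dots> = pmf (Pi_pmf (A \<times> B) d (\<lambda>_. p)) \<xi>"
  proof (cases "\<forall>z. z \<notin> A \<times> B \<longrightarrow> \<xi> z = d")
    case True
    then have out: "\<And>\<nu>. \<nu> \<notin> B \<Longrightarrow> f \<nu> = (\<lambda>_. d)" "\<And>\<nu> i. i \<notin> A \<Longrightarrow> f \<nu> i = d"
      by (auto simp: f_def)
    have "(\<Prod>\<nu>\<in>B. pmf (Pi_pmf A d (\<lambda>_. p)) (f \<nu>)) = (\<Prod>\<nu>\<in>B. \<Prod>i\<in>A. pmf p (\<xi> (i, \<nu>)))"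
      using out assms by (intro prod.cong) (auto simp: pmf_Pi' f_def)
    also have "\<dots> = (\<Prod>z\<in>A \<times> B. pmf p (\<xi> z))"
      using assms by (subst prod.swap) (simp add: prod.cartesian_product case_prod_unfold)
    finally show ?thesis
      using True out assms by (simp add: pmf_Pi' pmf_Pi)
  next
    case False
    then obtain i \<nu> where i\<nu>: "(i, \<nu>) \<notin> A \<times> B" "f \<nu> i \<noteq> d" by (auto simp: f_def)
    have "pmf (Pi_pmf B (\<lambda>_. d) (\<lambda>_. Pi_pmf A d (\<lambda>_. p))) f = 0"
    proof (cases "\<nu> \<in> B")
      case True
      then have "pmf (Pi_pmf A d (\<lambda>_. p)) (f \<nu>) = 0"
        using i\<nu> assms by (intro pmf_Pi_outside) auto
      then have "(\<Prod>\<nu>\<in>B. pmf (Pi_pmf A d (\<lambda>_. p)) (f \<nu>)) = 0"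
        using True assms by (intro prod_zero) auto
      then show ?thesis using assms by (subst pmf_Pi) auto
    next
      case False
      then show ?thesis using i\<nu> assms by (intro pmf_Pi_outside) auto
    qed
    then show ?thesis using False assms by (subst (2) pmf_Pi) auto
  qed
  finally show "pmf (Pi_pmf (A \<times> B) d (\<lambda>_. p)) \<xi> =
      pmf (map_pmf ?g (Pi_pmf B (\<lambda>_. d) (\<lambda>_. Pi_pmf A d (\<lambda>_. p)))) \<xi>" by simp
qed

lemma finite_nodes [simp]: "finite (nodes b)"
proof (rule finite_subset)
  show "nodes b \<subseteq> {r. real r \<le> log 2 (real b) - 1} \<times> {1..b}"
    unfolding nodes_def by (auto intro: order_trans[OF _ div_le_dividend])
  have "{r. real r \<le> log 2 (real b) - 1} \<subseteq> {..nat \<lfloor>log 2 (real b) - 1\<rfloor>}"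
    using le_nat_floor by blast
  then show "finite ({r. real r \<le> log 2 (real b) - 1} \<times> {1..b})"
    using finite_subset by blast
qed

definition node_noise :: "nat \<Rightarrow> nat \<Rightarrow> real \<Rightarrow> (nat \<times> nat \<Rightarrow> int) pmf" where
  "node_noise n b \<sigma> = Pi_pmf (nodes b) 0 (\<lambda>_. gaussian_sum_pmf \<sigma> n)"

lemma node_noise_eq_client_noise:
  "map_pmf (\<lambda>\<xi> \<nu>. \<Sum>i = 1..n. \<xi> (i, \<nu>)) (client_noise n b \<sigma>) = node_noise n b \<sigma>"
  unfolding client_noise_def node_noise_def sum_Pi_pmf_gaussian[symmetric]
  by (subst Pi_pmf_uncurry, simp, simp, subst Pi_pmf_map[where dflt="\<lambda>_. 0"])
     (auto simp: pmf.map_comp fun_eq_iff intro!: map_pmf_cong)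

lemma centered_mod_eqI: "x mod M = y mod M \<Longrightarrow> centered_mod x M = centered_mod y M"
  unfolding centered_mod_def by (metis mod_add_left_eq)

text \<open>Reducing the single messages has no effect after the final reduction, so the oracle sees
  only the sum of the clients' noise at each node.\<close>

lemma secure_sum_messages:
  "secure_sum n b M (\<lambda>i. client_message l c M (X i) (\<lambda>\<nu>. \<xi> (i, \<nu>))) =
    (\<lambda>\<nu>. if \<nu> \<in> nodes b then centered_mod (int c * total_histogram n l X \<nu> + (\<Sum>i = 1..n. \<xi> (i, \<nu>))) M else 0)"
proof -
  have "centered_mod (\<Sum>i = 1..n. client_message l c M (X i) (\<lambda>\<nu>. \<xi> (i, \<nu>)) \<nu>) M =
      centered_mod (int c * total_histogram n l X \<nu> + (\<Sum>i = 1..n. \<xi> (i, \<nu>))) M" for \<nu>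
  proof (rule centered_mod_eqI)
    have "(\<Sum>i = 1..n. client_message l c M (X i) (\<lambda>\<nu>. \<xi> (i, \<nu>)) \<nu>) mod M =
        (\<Sum>i = 1..n. client_message l c M (X i) (\<lambda>\<nu>. \<xi> (i, \<nu>)) \<nu> mod M) mod M"
      by (rule mod_sum_eq[symmetric])
    also have "\<dots> = (\<Sum>i = 1..n. (int c * histogram l (X i) \<nu> + \<xi> (i, \<nu>)) mod M) mod M"
      by (simp add: client_message_def centered_mod_cong)
    also have "\<dots> = (\<Sum>i = 1..n. int c * histogram l (X i) \<nu> + \<xi> (i, \<nu>)) mod M"
      by (rule mod_sum_eq)
    finally show "(\<Sum>i = 1..n. client_message l c M (X i) (\<lambda>\<nu>. \<xi> (i, \<nu>)) \<nu>) mod M =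
        (int c * total_histogram n l X \<nu> + (\<Sum>i = 1..n. \<xi> (i, \<nu>))) mod M"
      by (simp add: total_histogram_def sum.distrib sum_distrib_left)
  qed
  then show ?thesis by (auto simp: secure_sum_def fun_eq_iff)
qed

text \<open>Everything after the exact noisy sums, including the reduction modulo \<open>M\<close>.
  The protocol becomes additive noise followed by a deterministic map, to which data processing
  applies.\<close>

definition server ::
  "nat \<Rightarrow> (nat \<Rightarrow> real) \<Rightarrow> nat \<Rightarrow> int \<Rightarrow> ((nat \<Rightarrow> real) \<Rightarrow> nat) \<Rightarrow> (nat \<times> nat \<Rightarrow> int) \<Rightarrow>
    (nat \<times> nat \<Rightarrow> int) \<times> (nat \<Rightarrow> real) \<times> real" where
  "server b l c M jst z =
    (let s = (\<lambda>\<nu>. if \<nu> \<in> nodes b then centered_mod (z \<nu>) M else 0);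
         Hhat = cumulative b (\<lambda>\<nu>. real_of_int (s \<nu>) / real c)
     in (s, Hhat, l (jst Hhat)))"

lemma private_quantile_eq_client:
  "private_quantile n b l c M \<sigma> jst X =
    map_pmf (\<lambda>\<xi>. server b l c M jst (\<lambda>\<nu>. int c * total_histogram n l X \<nu> + (\<Sum>i = 1..n. \<xi> (i, \<nu>))))
      (client_noise n b \<sigma>)"
  unfolding private_quantile_def secure_sum_messages by (simp add: server_def Let_def del: One_nat_def)

text \<open>The aggregated form serves privacy. Utility returns to the noise of single clients,
  because the condition on \<open>M\<close> is \<open>n\<close> times the tail radius of one
  client.\<close>

lemma private_quantile_eq:
  "private_quantile n b l c M \<sigma> jst X =
    map_pmf (\<lambda>y. server b l c M jst (\<lambda>\<nu>. int c * total_histogram n l X \<nu> + y \<nu>)) (node_noise n b \<sigma>)"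
  unfolding private_quantile_eq_client node_noise_eq_client_noise[symmetric]
  by (simp add: pmf.map_comp o_def)

section \<open>Moments of a shift of product noise\<close>

lemma pmf_map_add:
  fixes V :: "('a \<Rightarrow> int) pmf"
  shows "pmf (map_pmf (\<lambda>y \<nu>. y \<nu> + w \<nu>) V) y = pmf V (\<lambda>\<nu>. y \<nu> - w \<nu>)"
proof -
  have "inj (\<lambda>(y :: 'a \<Rightarrow> int) \<nu>. y \<nu> + w \<nu>)" by (rule injI) (auto simp: fun_eq_iff)
  from pmf_map_inj'[OF this, of V "\<lambda>\<nu>. y \<nu> - w \<nu>"] show ?thesis by simp
qed

text \<open>The density ratio factorises over the nodes. The shift vanishes outside
  \<open>A\<close>, so the shifted points keep the default value 0 there and both densities are
  products over \<open>A\<close>.\<close>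

lemma renyi_moment_shift_Pi:
  fixes p :: "int pmf"
  assumes "finite A" "t > 0" "\<And>\<nu>. \<nu> \<notin> A \<Longrightarrow> w \<nu> = 0"
  shows "renyi_moment t (Pi_pmf A 0 (\<lambda>_. p)) (map_pmf (\<lambda>y \<nu>. y \<nu> + w \<nu>) (Pi_pmf A 0 (\<lambda>_. p))) =
    (\<Prod>\<nu>\<in>A. shift_moment t p (w \<nu>))"
proof -
  let ?V = "Pi_pmf A 0 (\<lambda>_. p)"
  have "renyi_moment t ?V (map_pmf (\<lambda>y \<nu>. y \<nu> + w \<nu>) ?V) =
      (\<integral>\<^sup>+ y. (\<Prod>\<nu>\<in>A. ennreal ((pmf p (y \<nu>) / pmf p (y \<nu> - w \<nu>)) powr t)) \<partial>?V)"
    unfolding renyi_moment_def pmf_map_add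
  proof (intro nn_integral_cong_AE AE_pmfI)
    fix y assume "y \<in> set_pmf ?V"
    from subsetD[OF set_Pi_pmf_subset[OF assms(1)] this]
    have out: "y \<nu> = 0" if "\<nu> \<notin> A" for \<nu> using that by simp
    have "pmf ?V y / pmf ?V (\<lambda>\<nu>. y \<nu> - w \<nu>) = (\<Prod>\<nu>\<in>A. pmf p (y \<nu>) / pmf p (y \<nu> - w \<nu>))"
      using out assms by (simp add: pmf_Pi' prod_dividef)
    then show "ennreal ((pmf ?V y / pmf ?V (\<lambda>\<nu>. y \<nu> - w \<nu>)) powr t) =
        (\<Prod>\<nu>\<in>A. ennreal ((pmf p (y \<nu>) / pmf p (y \<nu> - w \<nu>)) powr t))"
      by (simp add: prod_ennreal prod_powr_distrib)
  qed
  also have "\<dots> = (\<Prod>\<nu>\<in>A. shift_moment t p (w \<nu>))"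
    unfolding shift_moment_def
    by (rule nn_integral_prod_Pi_pmf[OF assms(1), where f="\<lambda>\<nu> x. ennreal ((pmf p x / pmf p (x - w \<nu>)) powr t)"])
  finally show ?thesis .
qed

lemma renyi_moment_sparse_shift:
  fixes p :: "int pmf"
  assumes A: "finite A" and t: "t > 0" and w: "\<And>\<nu>. \<nu> \<notin> A \<Longrightarrow> w \<nu> = 0"
    and full: "set_pmf p = UNIV"
    and bound: "\<And>\<nu>. w \<nu> \<noteq> 0 \<Longrightarrow> shift_moment t p (w \<nu>) \<le> ennreal (exp (t * (u + (1 + t) * v)))"
    and nonneg: "u \<ge> 0" "v \<ge> 0" and card: "card {\<nu>\<in>A. w \<nu> \<noteq> 0} \<le> m"
  shows "renyi_moment t (Pi_pmf A 0 (\<lambda>_. p)) (map_pmf (\<lambda>y \<nu>. y \<nu> + w \<nu>) (Pi_pmf A 0 (\<lambda>_. p))) \<le>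
    ennreal (exp (t * (real m * u + (1 + t) * (real m * v))))"
proof -
  define K where "K = t * (u + (1 + t) * v)"
  have "K \<ge> 0" using t nonneg by (simp add: K_def)
  have "shift_moment t p 0 = 1"
    using full by (simp add: shift_moment_def pmf_eq_0_set_pmf)
  then have le: "shift_moment t p (w \<nu>) \<le> (if w \<nu> \<noteq> 0 then ennreal (exp K) else 1)" for \<nu>
    using bound[of \<nu>] by (simp add: K_def)
  have "(\<Prod>\<nu>\<in>A. shift_moment t p (w \<nu>)) \<le> (\<Prod>\<nu>\<in>A. if w \<nu> \<noteq> 0 then ennreal (exp K) else 1)"
    by (rule prod_mono_ennreal) (rule le)
  also have "\<dots> = ennreal (exp K) ^ card {\<nu>\<in>A. w \<nu> \<noteq> 0}"
    using A by (simp add: prod.If_cases Int_def)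
  also have "\<dots> = ennreal (exp (real (card {\<nu>\<in>A. w \<nu> \<noteq> 0}) * K))"
    by (simp add: ennreal_power exp_of_nat_mult)
  also have "\<dots> \<le> ennreal (exp (real m * K))"
    using card \<open>K \<ge> 0\<close> by (intro ennreal_leI) (auto intro: mult_right_mono)
  also have "real m * K = t * (real m * u + (1 + t) * (real m * v))"
    by (simp add: K_def algebra_simps)
  finally show ?thesis using renyi_moment_shift_Pi[OF A t w] by simp
qed

section \<open>Concentrated differential privacy\<close>

lemma nodes_power2: "(r, j) \<in> nodes (2 ^ m) \<longleftrightarrow> r < m \<and> 1 \<le> j \<and> j \<le> 2 ^ (m - r)"
proof (cases "r < m")
  case True
  then have "(2::nat) ^ m div 2 ^ r = 2 ^ (m - r)" by (simp add: power_diff)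
  then show ?thesis using True by (auto simp: nodes_def log_nat_power)
next
  case False
  then show ?thesis by (auto simp: nodes_def log_nat_power)
qed

lemma node_right_end_le:
  assumes "(r, j) \<in> nodes (2 ^ m)"
  shows "2 ^ r * j \<le> 2 ^ m"
proof -
  have "2 ^ r * j \<le> 2 ^ r * 2 ^ (m - r)" using assms by (auto simp: nodes_power2)
  also have "\<dots> = 2 ^ m" using assms by (simp add: nodes_power2 flip: power_add)
  finally show ?thesis .
qed

text \<open>The nodes of one level represent disjoint half-open intervals, so at most one per level
  contains \<open>u\<close>. A value at or beyond the last edge lies in none.\<close>

lemma card_histogram_support:
  assumes "strict_mono_on {0..2 ^ m} l"
  shows "card {\<nu> \<in> nodes (2 ^ m). histogram l (Some u) \<nu> \<noteq> 0} \<le> m"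
proof -
  let ?S = "{\<nu> \<in> nodes (2 ^ m). histogram l (Some u) \<nu> \<noteq> 0}"
  have unique: False if "(r, j) \<in> ?S" "(r, j') \<in> ?S" "j < j'" for r j j'
  proof -
    have "2 ^ r * j \<le> 2 ^ r * (j' - 1)" using that(3) by (intro mult_left_mono) auto
    moreover have right: "2 ^ r * (j' - 1) \<le> 2 ^ m"
    proof (rule order_trans)
      show "2 ^ r * (j' - 1) \<le> 2 ^ r * j'" by (intro mult_left_mono) auto
      show "2 ^ r * j' \<le> 2 ^ m" using that(2) by (intro node_right_end_le) auto
    qed
    ultimately have "2 ^ r * j \<in> {0..2 ^ m}" "2 ^ r * (j' - 1) \<in> {0..2 ^ m}" "2 ^ r * j \<le> 2 ^ r * (j' - 1)"
      unfolding atLeastAtMost_iff by (blast intro: le0 order_trans)+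
    then have "l (2 ^ r * j) \<le> l (2 ^ r * (j' - 1))" by (rule strict_mono_on_leD[OF assms])
    then show False using that(1,2) by (auto simp: histogram_def)
  qed
  have "inj_on fst ?S"
  proof (rule inj_onI)
    fix x y assume xy: "x \<in> ?S" "y \<in> ?S" "fst x = fst y"
    then obtain r j j' where "x = (r, j)" "y = (r, j')" by (metis prod.collapse)
    then show "x = y" using xy unique[of r j j'] unique[of r j' j] by (cases j j' rule: linorder_cases) auto
  qed
  then have "card ?S = card (fst ` ?S)" by (simp add: card_image)
  also have "\<dots> \<le> card {..<m}"
    by (intro card_mono) (auto simp: nodes_power2)
  finally show ?thesis by simp
qed

lemma set_node_noise:
  assumes "\<sigma> \<ge> 1 / 2" "n \<ge> 1"
  shows "set_pmf (node_noise n b \<sigma>) = {y. \<forall>\<nu>. \<nu> \<notin> nodes b \<longrightarrow> y \<nu> = 0}"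
  using set_gaussian_sum[OF assms] by (auto simp: node_noise_def set_Pi_pmf PiE_dflt_def)

lemma histogram_difference:
  assumes "add_remove_neighbours n B X X'"
  obtains u s :: real where "s = 1 \<or> s = - 1"
    "\<And>\<nu>. real_of_int (total_histogram n l X' \<nu> - total_histogram n l X \<nu>) = s * real_of_int (histogram l (Some u) \<nu>)"
proof -
  from assms obtain i where i: "i \<in> {1..n}" "\<forall>k\<in>{1..n} - {i}. X k = X' k" "X i = None \<longleftrightarrow> X' i \<noteq> None"
    unfolding add_remove_neighbours_def by (elim conjE bexE) (rule that)
  have "total_histogram n l Y \<nu> = histogram l (Y i) \<nu> + (\<Sum>k\<in>{1..n} - {i}. histogram l (Y k) \<nu>)" for Y \<nu>
    unfolding total_histogram_def using i(1) by (simp add: sum.remove)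
  moreover have "(\<Sum>k\<in>{1..n} - {i}. histogram l (X k) \<nu>) = (\<Sum>k\<in>{1..n} - {i}. histogram l (X' k) \<nu>)" for \<nu>
    using i(2) by (intro sum.cong) auto
  ultimately have diff: "total_histogram n l X' \<nu> - total_histogram n l X \<nu> = histogram l (X' i) \<nu> - histogram l (X i) \<nu>" for \<nu>
    by simp
  have none: "histogram l None \<nu> = 0" for \<nu> by (simp add: histogram_def case_prod_unfold)
  show thesis
  proof (cases "X i")
    case None
    then obtain u where "X' i = Some u" using i(3) by auto
    then show thesis using that[of 1 u] None by (simp only: diff) (simp add: none)
  next
    case (Some u)
    then have "X' i = None" using i(3) by auto
    then show thesis using that[of "- 1" u] Some by (simp only: diff) (simp add: none)
  qed
qed

text \<open>Replacing \<open>X\<close> by \<open>X'\<close> shifts the noisy sums by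
  \<open>c\<close> or \<open>- c\<close> on the support of one client's histogram, while the map
  applied to them stays the same.\<close>

lemma private_quantile_renyi_moment:
  assumes "strict_mono_on {0..2 ^ m} l" "add_remove_neighbours n B X X'"
    and "n \<ge> 1" "\<sigma> \<ge> 1 / 2" "t > 0" "u \<ge> 0" "v \<ge> 0"
    and bound: "\<And>d. \<bar>d\<bar> = int c \<Longrightarrow> shift_moment t (gaussian_sum_pmf \<sigma> n) d \<le> ennreal (exp (t * (u + (1 + t) * v)))"
  shows "renyi_moment t (private_quantile n (2 ^ m) l c M \<sigma> jst X) (private_quantile n (2 ^ m) l c M \<sigma> jst X')
      \<le> ennreal (exp (t * (real m * u + (1 + t) * (real m * v))))" (is ?moment)
    and "set_pmf (private_quantile n (2 ^ m) l c M \<sigma> jst X) = set_pmf (private_quantile n (2 ^ m) l c M \<sigma> jst X')" (is ?supp)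
proof -
  let ?N = "nodes (2 ^ m)" and ?V = "node_noise n (2 ^ m) \<sigma>"
  define h h' where "h = total_histogram n l X" and "h' = total_histogram n l X'"
  \<comment> \<open>Histograms need not vanish outside the tree, for instance at the root, whereas
    the noise does. Cutting the shift off keeps it within the support of the noise, and the server
    ignores the other coordinates.\<close>
  define w where "w = (\<lambda>\<nu>. if \<nu> \<in> ?N then int c * (h' \<nu> - h \<nu>) else 0)"
  define g where "g = (\<lambda>y. server (2 ^ m) l c M jst (\<lambda>\<nu>. int c * h \<nu> + y \<nu>))"
  have server_cong: "server b l c M jst z = server b l c M jst z'" if "\<And>\<nu>. \<nu> \<in> nodes b \<Longrightarrow> z \<nu> = z' \<nu>" for b z z'
    using that by (simp add: server_def cong: if_cong)
  have X: "private_quantile n (2 ^ m) l c M \<sigma> jst X = map_pmf g ?V"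
    unfolding private_quantile_eq g_def h_def ..
  have X': "private_quantile n (2 ^ m) l c M \<sigma> jst X' = map_pmf g (map_pmf (\<lambda>y \<nu>. y \<nu> + w \<nu>) ?V)"
    unfolding private_quantile_eq g_def pmf.map_comp o_def
    by (intro map_pmf_cong refl server_cong) (simp add: w_def h'_def algebra_simps)
  have V: "set_pmf ?V = {y. \<forall>\<nu>. \<nu> \<notin> ?N \<longrightarrow> y \<nu> = 0}"
    using assms by (intro set_node_noise)
  have shift: "set_pmf (map_pmf (\<lambda>y \<nu>. y \<nu> + w \<nu>) ?V) = set_pmf ?V"
  proof -
    have "y \<in> (\<lambda>y \<nu>. y \<nu> + w \<nu>) ` set_pmf ?V" if "y \<in> set_pmf ?V" for y
      using that by (intro image_eqI[of _ _ "\<lambda>\<nu>. y \<nu> - w \<nu>"]) (auto simp: V w_def)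
    moreover have "(\<lambda>\<nu>. y \<nu> + w \<nu>) \<in> set_pmf ?V" if "y \<in> set_pmf ?V" for y
      using that by (auto simp: V w_def)
    ultimately show ?thesis by (auto simp only: set_map_pmf)
  qed
  then show ?supp unfolding X X' set_map_pmf by simp
  obtain x s :: real where s: "s = 1 \<or> s = - 1"
    and hx: "\<And>\<nu>. real_of_int (h' \<nu> - h \<nu>) = s * real_of_int (histogram l (Some x) \<nu>)"
    using histogram_difference[OF assms(2), of l] unfolding h_def h'_def by metis
  have w_cases: "\<bar>w \<nu>\<bar> = int c \<and> histogram l (Some x) \<nu> \<noteq> 0" if "w \<nu> \<noteq> 0" for \<nu>
  proof -
    have h: "histogram l (Some x) \<nu> \<in> {0, 1}" by (cases \<nu>) (auto simp: histogram_def)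
    have "\<nu> \<in> ?N" "h' \<nu> - h \<nu> \<noteq> 0" using that by (auto simp: w_def split: if_splits)
    then have "real_of_int (h' \<nu> - h \<nu>) \<noteq> 0" by (simp only: of_int_eq_0_iff not_False_eq_True)
    then have "histogram l (Some x) \<nu> = 1" using h hx[of \<nu>] by auto
    moreover from this have "real_of_int (h' \<nu> - h \<nu>) = 1 \<or> real_of_int (h' \<nu> - h \<nu>) = real_of_int (- 1)"
      using hx[of \<nu>] s by auto
    then have "h' \<nu> - h \<nu> = 1 \<or> h' \<nu> - h \<nu> = - 1"
      by (simp only: of_int_eq_1_iff of_int_eq_iff)
    ultimately show ?thesis using \<open>\<nu> \<in> ?N\<close> by (auto simp: w_def)
  qed
  have "renyi_moment t (map_pmf g ?V) (map_pmf g (map_pmf (\<lambda>y \<nu>. y \<nu> + w \<nu>) ?V)) \<le>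
      renyi_moment t ?V (map_pmf (\<lambda>y \<nu>. y \<nu> + w \<nu>) ?V)"
    using shift assms by (intro renyi_moment_map_le) auto
  also have "\<dots> \<le> ennreal (exp (t * (real m * u + (1 + t) * (real m * v))))"
    unfolding node_noise_def
  proof (rule renyi_moment_sparse_shift)
    have "card {\<nu> \<in> ?N. w \<nu> \<noteq> 0} \<le> card {\<nu> \<in> ?N. histogram l (Some x) \<nu> \<noteq> 0}"
      using w_cases by (intro card_mono) auto
    also have "\<dots> \<le> m" by (rule card_histogram_support[OF assms(1)])
    finally show "card {\<nu> \<in> ?N. w \<nu> \<noteq> 0} \<le> m" .
    show "shift_moment t (gaussian_sum_pmf \<sigma> n) (w \<nu>) \<le> ennreal (exp (t * (u + (1 + t) * v)))" if "w \<nu> \<noteq> 0" for \<nu>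
      using w_cases[OF that] by (intro bound) auto
  qed (use assms set_gaussian_sum in \<open>auto simp: w_def\<close>)
  finally show ?moment unfolding X X' .
qed

lemma add_remove_neighbours_sym: "add_remove_neighbours n B X X' \<Longrightarrow> add_remove_neighbours n B X' X"
  unfolding add_remove_neighbours_def by (metis (no_types, lifting))

lemma private_quantile_renyi_divergence:
  fixes M :: int and jst :: "(nat \<Rightarrow> real) \<Rightarrow> nat"
  assumes "strict_mono_on {0..2 ^ m} l" "add_remove_neighbours n B X X'"
    and "n \<ge> 1" "\<sigma> \<ge> 1 / 2" "u \<ge> 0" "v \<ge> 0"
    and bound: "\<And>t d. t > 0 \<Longrightarrow> \<bar>d\<bar> = int c \<Longrightarrow>
      shift_moment t (gaussian_sum_pmf \<sigma> n) d \<le> ennreal (exp (t * (u + (1 + t) * v)))"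
  defines "P \<equiv> private_quantile n (2 ^ m) l c M \<sigma> jst X"
    and "Q \<equiv> private_quantile n (2 ^ m) l c M \<sigma> jst X'"
  shows "\<alpha> \<ge> 1 \<Longrightarrow> renyi_divergence \<alpha> P Q \<le> ereal (real m * u + \<alpha> * (real m * v))"
    and "0 < \<alpha> \<Longrightarrow> \<alpha> < 1 \<Longrightarrow> renyi_divergence \<alpha> P Q \<le> ereal (2 * \<alpha> * (real m * u + real m * v))"
proof -
  have PQ: "renyi_moment t P Q \<le> ennreal (exp (t * (real m * u + (1 + t) * (real m * v))))" if "t > 0" for t
    unfolding P_def Q_def using assms that by (intro private_quantile_renyi_moment(1)) auto
  have QP: "renyi_moment t Q P \<le> ennreal (exp (t * (real m * u + (1 + t) * (real m * v))))" if "t > 0" for t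
    unfolding P_def Q_def using assms that add_remove_neighbours_sym
    by (intro private_quantile_renyi_moment(1)) auto
  have supp: "set_pmf P = set_pmf Q"
    unfolding P_def Q_def
    by (rule private_quantile_renyi_moment(2)[OF assms(1-4) zero_less_one assms(5,6) bound[OF zero_less_one]])
  show "\<alpha> \<ge> 1 \<Longrightarrow> renyi_divergence \<alpha> P Q \<le> ereal (real m * u + \<alpha> * (real m * v))"
    using PQ assms by (intro renyi_divergence_le_of_moments[OF supp]) auto
  show "0 < \<alpha> \<Longrightarrow> \<alpha> < 1 \<Longrightarrow> renyi_divergence \<alpha> P Q \<le> ereal (2 * \<alpha> * (real m * u + real m * v))"
    using PQ QP assms by (intro renyi_divergence_le_of_moments_small_order[OF supp]) auto
qed

text \<open>For \<alpha> \<ge> 1 the slack needed is m \<le> m^2 and m \<le> 2^m. Below 1 the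
  doubled cost needs 2m \<le> m^2 and 2m \<le> 2^m; the first fails at m = 1, which is why the range
  of orders is smaller for b = 2.\<close>

lemma privacy_epsilon_arith:
  fixes a \<psi> :: real and m :: nat
  assumes "a \<ge> 0" "\<psi> \<ge> 0" "m \<ge> 1"
  shows "\<alpha> \<ge> 1 \<Longrightarrow> real m * (\<psi> / 2) + \<alpha> * (real m * (a\<^sup>2 / 2)) \<le> \<alpha> * (a\<^sup>2 * (real m)\<^sup>2 + \<psi> * 2 ^ m) / 2"
    and "\<alpha> \<ge> 1 \<Longrightarrow> real m * 0 + \<alpha> * (real m * ((a + \<psi> / 2)\<^sup>2 / 2)) \<le> \<alpha> * (a * real m + \<psi> * sqrt (2 * 2 ^ m))\<^sup>2 / 2"
    and "0 < \<alpha> \<Longrightarrow> m \<noteq> 1 \<Longrightarrow> 2 * \<alpha> * (real m * (\<psi> / 2) + real m * (a\<^sup>2 / 2)) \<le> \<alpha> * (a\<^sup>2 * (real m)\<^sup>2 + \<psi> * 2 ^ m) / 2"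
    and "0 < \<alpha> \<Longrightarrow> m \<noteq> 1 \<Longrightarrow> 2 * \<alpha> * (real m * 0 + real m * ((a + \<psi> / 2)\<^sup>2 / 2)) \<le> \<alpha> * (a * real m + \<psi> * sqrt (2 * 2 ^ m))\<^sup>2 / 2"
proof -
  have m_pow: "real m \<le> 2 ^ m" by (metis less_exp less_imp_le of_nat_le_iff of_nat_numeral of_nat_power)
  then have m_2pow: "real m \<le> 2 * 2 ^ m" by linarith
  have m_sq: "real m \<le> (real m)\<^sup>2" using assms by (simp add: power2_eq_square)
  have m2_pow: "2 * real m \<le> 2 ^ m" if "m \<noteq> 1"
  proof -
    have "2 * k \<le> 2 ^ k" if "k \<ge> 2" for k :: nat using that by (induction k rule: dec_induct) auto
    from this[of m] have "2 * m \<le> 2 ^ m" using that assms by auto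
    then show ?thesis by (metis of_nat_le_iff of_nat_mult of_nat_numeral of_nat_power)
  qed
  have m2_sq: "2 * real m \<le> (real m)\<^sup>2" if "m \<noteq> 1"
    using that assms by (simp add: power2_eq_square)
  \<comment> \<open>Used with k = m and k = 2m. Under the square root the two summands separate:
    sqrt k is at most m, and sqrt k / 2 is at most the coefficient of \<psi>.\<close>
  have root: "k * (a + \<psi> / 2)\<^sup>2 \<le> (a * real m + \<psi> * sqrt (2 * 2 ^ m))\<^sup>2"
    if "0 \<le> k" "k \<le> (real m)\<^sup>2" "k \<le> 2 * 2 ^ m" for k
  proof -
    have "sqrt k \<le> real m" using that by (simp add: real_le_lsqrt)
    moreover have "sqrt k / 2 \<le> sqrt (2 * 2 ^ m)"
      using real_sqrt_le_mono[OF that(3)] real_sqrt_ge_zero[OF that(1)] by linarith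
    ultimately have "sqrt k * a + sqrt k / 2 * \<psi> \<le> real m * a + sqrt (2 * 2 ^ m) * \<psi>"
      using assms by (intro add_mono mult_right_mono)
    then have "(sqrt k * (a + \<psi> / 2))\<^sup>2 \<le> (a * real m + \<psi> * sqrt (2 * 2 ^ m))\<^sup>2"
      using assms that by (intro power_mono) (auto simp: algebra_simps)
    then show ?thesis using that by (simp add: power_mult_distrib)
  qed
  show "real m * (\<psi> / 2) + \<alpha> * (real m * (a\<^sup>2 / 2)) \<le> \<alpha> * (a\<^sup>2 * (real m)\<^sup>2 + \<psi> * 2 ^ m) / 2" if "\<alpha> \<ge> 1"
  proof -
    have "1 * (real m * \<psi>) \<le> \<alpha> * (2 ^ m * \<psi>)" using that m_pow assms by (intro mult_mono mult_right_mono) auto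
    moreover have "\<alpha> * (real m * a\<^sup>2) \<le> \<alpha> * ((real m)\<^sup>2 * a\<^sup>2)" using m_sq that by (intro mult_left_mono mult_right_mono) auto
    ultimately show ?thesis by (simp add: algebra_simps)
  qed
  show "real m * 0 + \<alpha> * (real m * ((a + \<psi> / 2)\<^sup>2 / 2)) \<le> \<alpha> * (a * real m + \<psi> * sqrt (2 * 2 ^ m))\<^sup>2 / 2" if "\<alpha> \<ge> 1"
  proof -
    have "\<alpha> * (real m * (a + \<psi> / 2)\<^sup>2) \<le> \<alpha> * (a * real m + \<psi> * sqrt (2 * 2 ^ m))\<^sup>2"
      using that by (intro mult_left_mono root m_sq m_2pow) auto
    then show ?thesis by simp
  qed
  show "2 * \<alpha> * (real m * (\<psi> / 2) + real m * (a\<^sup>2 / 2)) \<le> \<alpha> * (a\<^sup>2 * (real m)\<^sup>2 + \<psi> * 2 ^ m) / 2" if "0 < \<alpha>" "m \<noteq> 1"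
  proof -
    have "\<alpha> * ((2 * real m) * \<psi> + (2 * real m) * a\<^sup>2) \<le> \<alpha> * (2 ^ m * \<psi> + (real m)\<^sup>2 * a\<^sup>2)"
      using that m2_pow m2_sq assms by (intro mult_left_mono add_mono mult_right_mono) auto
    then show ?thesis by (simp add: algebra_simps)
  qed
  show "2 * \<alpha> * (real m * 0 + real m * ((a + \<psi> / 2)\<^sup>2 / 2)) \<le> \<alpha> * (a * real m + \<psi> * sqrt (2 * 2 ^ m))\<^sup>2 / 2" if "0 < \<alpha>" "m \<noteq> 1"
  proof -
    have "\<alpha> * ((2 * real m) * (a + \<psi> / 2)\<^sup>2) \<le> \<alpha> * (a * real m + \<psi> * sqrt (2 * 2 ^ m))\<^sup>2"
      using that m_pow by (intro mult_left_mono root m2_sq) auto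
    then show ?thesis by simp
  qed
qed

lemma private_quantile_concentrated_dp:
  assumes "strict_mono_on {0..2 ^ m} l" "n \<ge> 1" "\<sigma> \<ge> 1 / 2" "m \<ge> 1"
  shows "concentrated_dp (private_quantile n (2 ^ m) l c M \<sigma> jst) (add_remove_neighbours n B)
    (privacy_epsilon n (2 ^ m) c \<sigma>) (if m = 1 then {1..} else {0<..})"
  unfolding concentrated_dp_def
proof (intro allI impI ballI)
  fix X X' and \<alpha> :: real
  assume nb: "add_remove_neighbours n B X X'" and \<alpha>: "\<alpha> \<in> (if m = 1 then {1..} else {0<..})"
  define P Q where "P = private_quantile n (2 ^ m) l c M \<sigma> jst X"
    and "Q = private_quantile n (2 ^ m) l c M \<sigma> jst X'"
  define \<psi> where "\<psi> = privacy_psi n \<sigma>"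
  define a where "a = \<bar>real_of_int (int c)\<bar> / (sqrt (real n) * \<sigma>)"
  define \<epsilon> \<epsilon>' where "\<epsilon> = sqrt (a\<^sup>2 * (real m)\<^sup>2 + \<psi> * 2 ^ m)"
    and "\<epsilon>' = a * real m + \<psi> * sqrt (2 * 2 ^ m)"
  have "\<psi> \<ge> 0" by (simp add: \<psi>_def privacy_psi_def sum_nonneg)
  have "a \<ge> 0" using assms by (simp add: a_def)
  have moment1: "shift_moment t (gaussian_sum_pmf \<sigma> n) d \<le> ennreal (exp (t * (\<psi> / 2 + (1 + t) * (a\<^sup>2 / 2))))"
    and moment2: "shift_moment t (gaussian_sum_pmf \<sigma> n) d \<le> ennreal (exp (t * (0 + (1 + t) * ((a + \<psi> / 2)\<^sup>2 / 2))))"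
    if "t > 0" "\<bar>d\<bar> = int c" for t d
  proof -
    have "\<bar>real_of_int d\<bar> = \<bar>real_of_int (int c)\<bar>" using that(2) by (metis abs_of_nat of_int_abs)
    then have "\<bar>real_of_int d\<bar> / (sqrt (real n) * \<sigma>) = a" by (simp add: a_def)
    then show "shift_moment t (gaussian_sum_pmf \<sigma> n) d \<le> ennreal (exp (t * (\<psi> / 2 + (1 + t) * (a\<^sup>2 / 2))))"
      "shift_moment t (gaussian_sum_pmf \<sigma> n) d \<le> ennreal (exp (t * (0 + (1 + t) * ((a + \<psi> / 2)\<^sup>2 / 2))))"
      using shift_moment_gaussian_sum[OF assms(3,2) that(1), of d] by (simp_all only: \<psi>_def)
  qed
  have div1: "\<alpha> \<ge> 1 \<Longrightarrow> renyi_divergence \<alpha> P Q \<le> ereal (real m * (\<psi> / 2) + \<alpha> * (real m * (a\<^sup>2 / 2)))"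
    "0 < \<alpha> \<Longrightarrow> \<alpha> < 1 \<Longrightarrow> renyi_divergence \<alpha> P Q \<le> ereal (2 * \<alpha> * (real m * (\<psi> / 2) + real m * (a\<^sup>2 / 2)))"
    unfolding P_def Q_def using \<open>\<psi> \<ge> 0\<close> moment1
    by (intro private_quantile_renyi_divergence[OF assms(1) nb assms(2,3)]; simp)+
  have div2: "\<alpha> \<ge> 1 \<Longrightarrow> renyi_divergence \<alpha> P Q \<le> ereal (real m * 0 + \<alpha> * (real m * ((a + \<psi> / 2)\<^sup>2 / 2)))"
    "0 < \<alpha> \<Longrightarrow> \<alpha> < 1 \<Longrightarrow> renyi_divergence \<alpha> P Q \<le> ereal (2 * \<alpha> * (real m * 0 + real m * ((a + \<psi> / 2)\<^sup>2 / 2)))"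
    unfolding P_def Q_def using \<open>\<psi> \<ge> 0\<close> moment2
    by (intro private_quantile_renyi_divergence[OF assms(1) nb assms(2,3)]; simp)+
  note arith = privacy_epsilon_arith[OF \<open>a \<ge> 0\<close> \<open>\<psi> \<ge> 0\<close> assms(4)]
  have \<epsilon>_sq: "\<epsilon>\<^sup>2 = a\<^sup>2 * (real m)\<^sup>2 + \<psi> * 2 ^ m"
    unfolding \<epsilon>_def using \<open>\<psi> \<ge> 0\<close> by simp
  have "renyi_divergence \<alpha> P Q \<le> ereal (\<alpha> * \<epsilon>\<^sup>2 / 2) \<and> renyi_divergence \<alpha> P Q \<le> ereal (\<alpha> * \<epsilon>'\<^sup>2 / 2)"
  proof (cases "\<alpha> \<ge> 1")
    case True
    then show ?thesis
      unfolding \<epsilon>_sq unfolding \<epsilon>'_def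
      using order_trans[OF div1(1) ereal_less_eq(3)[THEN iffD2, OF arith(1)]]
        order_trans[OF div2(1) ereal_less_eq(3)[THEN iffD2, OF arith(2)]] \<open>\<psi> \<ge> 0\<close> by simp
  next
    case False
    then have "0 < \<alpha>" "\<alpha> < 1" "m \<noteq> 1" using \<alpha> by (auto split: if_splits)
    then show ?thesis
      unfolding \<epsilon>_sq unfolding \<epsilon>'_def
      using order_trans[OF div1(2) ereal_less_eq(3)[THEN iffD2, OF arith(3)]]
        order_trans[OF div2(2) ereal_less_eq(3)[THEN iffD2, OF arith(4)]] \<open>\<psi> \<ge> 0\<close> by simp
  qed
  moreover have "privacy_epsilon n (2 ^ m) c \<sigma> = min \<epsilon> \<epsilon>'"
  proof -
    have "log 2 (real (2 ^ m)) = real m" by (simp add: log_nat_power)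
    then show ?thesis
      using assms by (simp add: privacy_epsilon_def \<epsilon>_def \<epsilon>'_def \<psi>_def a_def power_divide power_mult_distrib)
  qed
  ultimately show "renyi_divergence \<alpha> (private_quantile n (2 ^ m) l c M \<sigma> jst X) (private_quantile n (2 ^ m) l c M \<sigma> jst X')
      \<le> ereal (\<alpha> * (privacy_epsilon n (2 ^ m) c \<sigma>)\<^sup>2 / 2)"
    unfolding P_def[symmetric] Q_def[symmetric] by (simp add: min_def)
qed

section \<open>Utility\<close>

lemma dyadic_partition_extend:
  assumes "dyadic_partition b (2 ^ r * q) S" "(r, Suc q) \<in> nodes b"
  shows "dyadic_partition b (2 ^ r * Suc q) (insert (r, Suc q) S)" "card (insert (r, Suc q) S) \<le> Suc (card S)"
proof -
  have S: "S \<subseteq> nodes b" "disjoint_family_on block S" "(\<Union>\<nu>\<in>S. block \<nu>) = {1..2 ^ r * q}"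
    using assms by (auto simp: dyadic_partition_def)
  have new: "block (r, Suc q) = {2 ^ r * q + 1..2 ^ r * q + 2 ^ r}" by (simp add: block_def add.commute)
  then have disj: "block (r, Suc q) \<inter> (\<Union>\<nu>\<in>S. block \<nu>) = {}" and "2 ^ r * q + 1 \<in> block (r, Suc q)"
    unfolding S(3) by auto
  then have "(r, Suc q) \<notin> S" by blast
  then have "disjoint_family_on block (insert (r, Suc q) S)"
    using disj S(2) by (simp add: disjoint_family_on_insert)
  moreover have "(\<Union>\<nu>\<in>insert (r, Suc q) S. block \<nu>) = {1..2 ^ r * Suc q}"
    using S(3) new by auto
  ultimately show "dyadic_partition b (2 ^ r * Suc q) (insert (r, Suc q) S)"
    using S(1) assms(2) by (simp add: dyadic_partition_def)
  show "card (insert (r, Suc q) S) \<le> Suc (card S)"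
    using finite_subset[OF S(1) finite_nodes] by (simp add: card_insert_if)
qed

text \<open>The root is not a node, so the recursion over the binary digits starts with two half blocks.\<close>

lemma dyadic_partition_exists_multiple:
  assumes "1 \<le> k" "k \<le> m" "q \<le> 2 ^ k"
  shows "\<exists>S. dyadic_partition (2 ^ m) (2 ^ (m - k) * q) S \<and> card S \<le> k + 1"
  using assms
proof (induction k arbitrary: q rule: dec_induct)
  case base
  have empty: "dyadic_partition (2 ^ m) (2 ^ (m - 1) * 0) {}" by (simp add: dyadic_partition_def disjoint_family_on_def)
  have node: "(m - 1, j) \<in> nodes (2 ^ m)" if "1 \<le> j" "j \<le> 2" for j
    using base that by (simp add: nodes_power2)
  note one = dyadic_partition_extend[OF empty node]
  note two = dyadic_partition_extend[OF one(1) node]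
  from base consider "q = 0" | "q = 1" | "q = 2" by force
  then show ?case
  proof cases
    case 1
    then show ?thesis using empty by (intro exI[of _ "{}"]) simp
  next
    case 2
    then show ?thesis using one by (intro exI[of _ "{(m - 1, Suc 0)}"]) simp
  next
    case 3
    then show ?thesis using two one(2)
      by (intro exI[of _ "{(m - 1, Suc (Suc 0)), (m - 1, Suc 0)}"]) (simp add: numeral_2_eq_2)
  qed
next
  case (step k)
  define q' where "q' = q div 2"
  have "q' \<le> 2 ^ k" using step.prems by (simp add: q'_def)
  then obtain S where S: "dyadic_partition (2 ^ m) (2 ^ (m - k) * q') S" "card S \<le> k + 1"
    using step by force
  have pow: "(2::nat) ^ (m - k) = 2 ^ (m - Suc k) * 2"
    using step.prems by (simp add: Suc_diff_Suc flip: power_Suc2)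
  show ?case
  proof (cases "even q")
    case True
    then have eq: "2 ^ (m - k) * q' = 2 ^ (m - Suc k) * q" by (simp add: pow q'_def)
    show ?thesis using S unfolding eq by (intro exI[of _ S]) simp
  next
    case False
    then have q: "2 ^ (m - k) * q' = 2 ^ (m - Suc k) * (2 * q')" "Suc (2 * q') = q"
      by (simp add: pow, simp add: q'_def)
    have "(m - Suc k, q) \<in> nodes (2 ^ m)" using step.prems q(2) by (simp add: nodes_power2)
    from dyadic_partition_extend[OF S(1)[unfolded q(1)], unfolded q(2), OF this] S(2)
    show ?thesis by (intro exI[of _ "insert (m - Suc k, q) S"]) simp
  qed
qed

text \<open>The explicit partition shows that the minimum is taken over a nonempty family and bounds
  its size by m + 1. Weakening this to 2m makes the variance proportional to log 2 b, with no
  additive term.\<close>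

lemma max_dyadic_partition:
  assumes "m \<ge> 1" "j \<le> 2 ^ m"
  shows "max_dyadic_partition (2 ^ m) j \<subseteq> nodes (2 ^ m)" "card (max_dyadic_partition (2 ^ m) j) \<le> 2 * m"
proof -
  obtain S where S: "dyadic_partition (2 ^ m) j S" "card S \<le> m + 1"
    using dyadic_partition_exists_multiple[of m m j] assms by auto
  then have "dyadic_partition (2 ^ m) j (max_dyadic_partition (2 ^ m) j)"
    "card (max_dyadic_partition (2 ^ m) j) \<le> card S"
    unfolding max_dyadic_partition_def using arg_min_nat_lemma[of "dyadic_partition (2 ^ m) j" S card] by auto
  then show "max_dyadic_partition (2 ^ m) j \<subseteq> nodes (2 ^ m)" "card (max_dyadic_partition (2 ^ m) j) \<le> 2 * m"
    using S(2) assms(1) by (auto simp: dyadic_partition_def)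
qed

lemma card_nodes_le: "card (nodes (2 ^ m)) \<le> 2 * 2 ^ m"
proof -
  have "card (nodes (2 ^ m)) \<le> card (SIGMA r:{..<m}. {1..2 ^ (m - r)::nat})"
    by (intro card_mono) (auto simp: nodes_power2)
  also have "\<dots> = (\<Sum>r<m. 2 ^ (m - r))" by simp
  also have "\<dots> \<le> 2 * 2 ^ m"
  proof (induction m)
    case (Suc m)
    have "(\<Sum>r<Suc m. 2 ^ (Suc m - r)) = 2 ^ Suc m + (\<Sum>r<m. 2 ^ (m - r) :: nat)"
      by (subst sum.lessThan_Suc_shift) simp
    then show ?case using Suc by simp
  qed simp
  finally show ?thesis .
qed

section \<open>Tail bounds for the noise\<close>

lemma subgaussian_tail:
  fixes f :: "'a \<Rightarrow> real"
  assumes mgf: "\<And>t. (\<integral>\<^sup>+ x. ennreal (exp (t * f x)) \<partial>measure_pmf P) \<le> ennreal (exp (v * t\<^sup>2 / 2))"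
    and "v > 0" "r \<ge> 0"
  shows "measure_pmf.prob P {x. \<bar>f x\<bar> > r} \<le> 2 * exp (- r\<^sup>2 / (2 * v))"
proof -
  have one_sided: "measure_pmf.prob P {x. s * f x > r} \<le> exp (- r\<^sup>2 / (2 * v))" if "s\<^sup>2 = 1" for s
  proof -
    \<comment> \<open>The minimiser of the Chernoff exponent - t * r + v * t^2 / 2. The sign
      \<open>s\<close> yields both tails from one computation.\<close>
    define t where "t = r / v"
    have "t \<ge> 0" using assms by (simp add: t_def)
    have "emeasure P {x. s * f x > r} = (\<integral>\<^sup>+ x. indicator {x. s * f x > r} x \<partial>P)" by simp
    also have "\<dots> \<le> (\<integral>\<^sup>+ x. ennreal (exp (- t * r)) * ennreal (exp ((t * s) * f x)) \<partial>P)"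
    proof (rule nn_integral_mono)
      fix x
      have "1 \<le> exp (- t * r + (t * s) * f x)" if "s * f x > r"
      proof -
        have "t * r \<le> t * (s * f x)" using that \<open>t \<ge> 0\<close> by (intro mult_left_mono) auto
        then show ?thesis by (simp add: mult.assoc)
      qed
      then show "indicator {x. s * f x > r} x \<le> ennreal (exp (- t * r)) * ennreal (exp ((t * s) * f x))"
        by (auto simp: indicator_def simp flip: ennreal_mult exp_add)
    qed
    also have "\<dots> = ennreal (exp (- t * r)) * (\<integral>\<^sup>+ x. ennreal (exp ((t * s) * f x)) \<partial>P)"
      by (rule nn_integral_cmult) simp
    also have "\<dots> \<le> ennreal (exp (- t * r)) * ennreal (exp (v * (t * s)\<^sup>2 / 2))"
      by (intro mult_left_mono mgf) auto
    also have "\<dots> = ennreal (exp (- t * r + v * (t * s)\<^sup>2 / 2))"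
      by (simp flip: ennreal_mult exp_add)
    also have "- t * r + v * (t * s)\<^sup>2 / 2 = - r\<^sup>2 / (2 * v)"
      using \<open>v > 0\<close> that by (simp add: t_def power_mult_distrib) (simp add: power2_eq_square field_simps)
    finally show ?thesis by (simp add: measure_pmf.emeasure_eq_measure)
  qed
  have "{x. \<bar>f x\<bar> > r} = {x. 1 * f x > r} \<union> {x. - 1 * f x > r}" by auto
  then have "measure_pmf.prob P {x. \<bar>f x\<bar> > r} \<le>
      measure_pmf.prob P {x. 1 * f x > r} + measure_pmf.prob P {x. - 1 * f x > r}"
    by (simp only:) (rule measure_Un_le, auto)
  then show ?thesis using one_sided[of 1] one_sided[of "- 1"] by simp
qed

lemma client_noise_tail:
  assumes "\<sigma> > 0" "r \<ge> 0" "i \<in> {1..n}" "\<nu> \<in> nodes b"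
  shows "measure_pmf.prob (client_noise n b \<sigma>) {\<xi>. \<bar>real_of_int (\<xi> (i, \<nu>))\<bar> > r} \<le> 2 * exp (- r\<^sup>2 / (2 * \<sigma>\<^sup>2))"
proof (rule subgaussian_tail)
  fix t
  have "(\<integral>\<^sup>+ \<xi>. ennreal (exp (t * real_of_int (\<xi> (i, \<nu>)))) \<partial>client_noise n b \<sigma>) =
      (\<integral>\<^sup>+ x. ennreal (exp (t * real_of_int x)) \<partial>map_pmf (\<lambda>\<xi>. \<xi> (i, \<nu>)) (client_noise n b \<sigma>))"
    by simp
  also have "map_pmf (\<lambda>\<xi>. \<xi> (i, \<nu>)) (client_noise n b \<sigma>) = discrete_gaussian \<sigma>"
    unfolding client_noise_def using assms by (subst Pi_pmf_component) auto
  finally show "(\<integral>\<^sup>+ \<xi>. ennreal (exp (t * real_of_int (\<xi> (i, \<nu>)))) \<partial>client_noise n b \<sigma>) \<le> ennreal (exp (\<sigma>\<^sup>2 * t\<^sup>2 / 2))"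
    using discrete_gaussian_mgf[OF assms(1)] by simp
qed (use assms in auto)

text \<open>By independence the variance proxies add up over \<open>S\<close>. Passing from
  \<open>card S\<close> to \<open>k\<close> \<ge> 1 keeps the proxy positive even for empty
  \<open>S\<close>.\<close>

lemma node_noise_sum_tail:
  assumes "\<sigma> > 0" "n \<ge> 1" "r \<ge> 0" "S \<subseteq> nodes b" "card S \<le> k" "k \<ge> 1"
  shows "measure_pmf.prob (node_noise n b \<sigma>) {y. \<bar>real_of_int (\<Sum>\<nu>\<in>S. y \<nu>)\<bar> > r} \<le> 2 * exp (- r\<^sup>2 / (2 * (real k * (real n * \<sigma>\<^sup>2))))"
proof (rule subgaussian_tail)
  fix t :: real
  define e where "e = (\<lambda>\<nu> x. if \<nu> \<in> S then ennreal (exp (t * real_of_int x)) else 1)"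
  define K where "K = real n * \<sigma>\<^sup>2 * t\<^sup>2 / 2"
  have "finite S" using assms(4) finite_nodes by (rule finite_subset)
  have "ennreal (exp (t * real_of_int (\<Sum>\<nu>\<in>S. y \<nu>))) = (\<Prod>\<nu>\<in>nodes b. e \<nu> (y \<nu>))" for y
  proof -
    have "nodes b \<inter> S = S" using assms(4) by auto
    then have "(\<Prod>\<nu>\<in>nodes b. e \<nu> (y \<nu>)) = (\<Prod>\<nu>\<in>S. ennreal (exp (t * real_of_int (y \<nu>))))"
      by (simp add: e_def prod.If_cases)
    also have "\<dots> = ennreal (exp (t * real_of_int (\<Sum>\<nu>\<in>S. y \<nu>)))"
      using \<open>finite S\<close> by (simp add: prod_ennreal exp_sum sum_distrib_left)
    finally show ?thesis ..
  qed
  then have "(\<integral>\<^sup>+ y. ennreal (exp (t * real_of_int (\<Sum>\<nu>\<in>S. y \<nu>))) \<partial>node_noise n b \<sigma>) =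
      (\<Prod>\<nu>\<in>nodes b. (\<integral>\<^sup>+ x. e \<nu> x \<partial>gaussian_sum_pmf \<sigma> n))"
    unfolding node_noise_def by (simp only: nn_integral_prod_Pi_pmf[OF finite_nodes])
  also have "\<dots> \<le> (\<Prod>\<nu>\<in>nodes b. if \<nu> \<in> S then ennreal (exp K) else 1)"
    using gaussian_sum_mgf[where t=t and n=n, OF assms(1)] by (intro prod_mono_ennreal) (auto simp: e_def K_def)
  also have "\<dots> = ennreal (exp K) ^ card S"
    using assms(4) by (simp add: prod.If_cases Int_absorb1)
  also have "\<dots> = ennreal (exp (real (card S) * K))" by (simp add: ennreal_power exp_of_nat_mult)
  also have "\<dots> \<le> ennreal (exp (real k * K))"
    using assms(5) by (intro ennreal_leI) (auto intro!: mult_right_mono simp: K_def)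
  finally show "(\<integral>\<^sup>+ y. ennreal (exp (t * real_of_int (\<Sum>\<nu>\<in>S. y \<nu>))) \<partial>node_noise n b \<sigma>) \<le>
      ennreal (exp (real k * (real n * \<sigma>\<^sup>2) * t\<^sup>2 / 2))"
    by (simp add: K_def mult.assoc)
qed (use assms in auto)

section \<open>From noise bounds to the quantile error\<close>

lemma centered_mod_ident:
  assumes "\<bar>real_of_int x\<bar> \<le> real_of_int M / 2 - 1"
  shows "centered_mod x M = x"
proof -
  \<comment> \<open>The margin 1 absorbs the rounding in \<open>M div 2\<close> and the open right
    end of the interval; doubled, it is the summand 2 in the condition on \<open>M\<close>.\<close>
  have "real_of_int (2 * x) \<le> real_of_int (M - 2)" "real_of_int (- 2 * x) \<le> real_of_int (M - 2)"
    using assms by (auto simp: abs_le_iff)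
  then have "2 * x \<le> M - 2" "- 2 * x \<le> M - 2" by (simp_all only: of_int_le_iff)
  moreover have "2 * (M div 2) \<le> M" "M \<le> 2 * (M div 2) + 1" by linarith+
  ultimately have "0 \<le> x + M div 2" "x + M div 2 < M" by linarith+
  then show ?thesis by (simp add: centered_mod_def)
qed

text \<open>Only the selected index matters: its risk under \<open>K\<close> is the minimal one, and
  exchanging \<open>K\<close> for \<open>H\<close> at that index changes the risk by at most e /
  n.\<close>

lemma quantile_error_le:
  assumes "quantile_selector n b \<theta> jst" "n \<ge> 1"
    and "\<And>j. j \<in> {1..b} \<Longrightarrow> \<bar>K j - H j\<bar> \<le> e"
  shows "quantile_error n \<theta> jst K H \<le> min_quantile_risk n b \<theta> K + e / real n"
proof -
  define j where "j = jst K"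
  have j: "j \<in> {1..b}" and min: "\<And>i. i \<in> {1..b} \<Longrightarrow> quantile_risk n \<theta> K j \<le> quantile_risk n \<theta> K i"
    using assms(1) unfolding quantile_selector_def is_arg_min_def j_def by (auto simp: not_less)
  have "min_quantile_risk n b \<theta> K = quantile_risk n \<theta> K j"
    unfolding min_quantile_risk_def using j min by (intro Min_eqI) auto
  moreover have "quantile_risk n \<theta> H j \<le> quantile_risk n \<theta> K j + \<bar>K j - H j\<bar> / real n"
  proof -
    have "H j / real n - (1 - \<theta>) = (K j / real n - (1 - \<theta>)) - (K j - H j) / real n"
      by (simp add: diff_divide_distrib)
    then have "quantile_risk n \<theta> H j \<le> quantile_risk n \<theta> K j + \<bar>(K j - H j) / real n\<bar>"
      unfolding quantile_risk_def by linarith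
    then show ?thesis by simp
  qed
  moreover have "\<bar>K j - H j\<bar> / real n \<le> e / real n"
    using assms(2) j by (intro divide_right_mono assms(3)) auto
  ultimately show ?thesis unfolding quantile_error_def j_def[symmetric] by linarith
qed

lemma total_histogram_bounds: "0 \<le> total_histogram n l X \<nu>" "total_histogram n l X \<nu> \<le> int n"
proof -
  have "0 \<le> histogram l v \<nu>" "histogram l v \<nu> \<le> 1" for v
    by (auto simp: histogram_def split: prod.splits option.splits)
  then show "0 \<le> total_histogram n l X \<nu>" "total_histogram n l X \<nu> \<le> int n"
    using sum_bounded_above[of "{1..n}" "\<lambda>i. histogram l (X i) \<nu>" 1]
    by (auto simp: total_histogram_def intro: sum_nonneg)
qed

text \<open>The deterministic half of the utility claim. Without wrap-around, the error of a
  cumulative value is the noise summed over its partition and divided by \<open>c\<close>.\<close>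

lemma server_error:
  assumes m: "m \<ge> 1" and sel: "quantile_selector n (2 ^ m) \<theta> jst" and n: "n \<ge> 1" and c: "c > 0"
    and M: "real_of_int M \<ge> 2 + 2 * real c * real n + 2 * real n * R"
    and noise: "\<And>i \<nu>. i \<in> {1..n} \<Longrightarrow> \<nu> \<in> nodes (2 ^ m) \<Longrightarrow> \<bar>real_of_int (\<xi> (i, \<nu>))\<bar> \<le> R"
    and sums: "\<And>j. j \<in> {1..2 ^ m} \<Longrightarrow>
      \<bar>real_of_int (\<Sum>\<nu>\<in>max_dyadic_partition (2 ^ m) j. \<Sum>i = 1..n. \<xi> (i, \<nu>))\<bar> \<le> \<tau>"
  shows "quantile_error n \<theta> jst (fst (snd (server (2 ^ m) l c M jst (\<lambda>\<nu>. int c * total_histogram n l X \<nu> + (\<Sum>i = 1..n. \<xi> (i, \<nu>))))))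
      (true_cumulative n (2 ^ m) l X)
    \<le> min_quantile_risk n (2 ^ m) \<theta> (fst (snd (server (2 ^ m) l c M jst (\<lambda>\<nu>. int c * total_histogram n l X \<nu> + (\<Sum>i = 1..n. \<xi> (i, \<nu>))))))
      + \<tau> / real c / real n"
proof (rule quantile_error_le[OF sel n])
  fix j assume j: "j \<in> {1..2 ^ m :: nat}"
  let ?P = "max_dyadic_partition (2 ^ m) j"
  define h y where "h = total_histogram n l X" and "y = (\<lambda>\<nu>. \<Sum>i = 1..n. \<xi> (i, \<nu>))"
  have P: "?P \<subseteq> nodes (2 ^ m)" using max_dyadic_partition[OF m] j by auto
  have no_wrap: "centered_mod (int c * h \<nu> + y \<nu>) M = int c * h \<nu> + y \<nu>" if "\<nu> \<in> nodes (2 ^ m)" for \<nu>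
  proof (rule centered_mod_ident)
    have "\<bar>real_of_int (y \<nu>)\<bar> \<le> (\<Sum>i = 1..n. \<bar>real_of_int (\<xi> (i, \<nu>))\<bar>)"
      unfolding y_def of_int_sum by (rule sum_abs)
    also have "\<dots> \<le> real n * R"
      using sum_bounded_above[of "{1..n}" "\<lambda>i. \<bar>real_of_int (\<xi> (i, \<nu>))\<bar>" R] noise that by simp
    finally have "\<bar>real_of_int (y \<nu>)\<bar> \<le> real n * R" .
    moreover have "0 \<le> real c * real_of_int (h \<nu>)" "real c * real_of_int (h \<nu>) \<le> real c * real n"
      using total_histogram_bounds[of n l X \<nu>] unfolding h_def by (auto intro!: mult_left_mono)
    ultimately have "\<bar>real c * real_of_int (h \<nu>) + real_of_int (y \<nu>)\<bar> \<le> real c * real n + real n * R"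
      by linarith
    then show "\<bar>real_of_int (int c * h \<nu> + y \<nu>)\<bar> \<le> real_of_int M / 2 - 1"
      using M by simp
  qed
  have "fst (snd (server (2 ^ m) l c M jst (\<lambda>\<nu>. int c * h \<nu> + y \<nu>))) j =
      (\<Sum>\<nu>\<in>?P. real_of_int (int c * h \<nu> + y \<nu>) / real c)"
    unfolding server_def Let_def cumulative_def using P no_wrap by (auto intro!: sum.cong)
  also have "\<dots> = true_cumulative n (2 ^ m) l X j + real_of_int (\<Sum>\<nu>\<in>?P. y \<nu>) / real c"
    using c by (simp add: true_cumulative_def cumulative_def h_def add_divide_distrib sum.distrib sum_divide_distrib)
  finally show "\<bar>fst (snd (server (2 ^ m) l c M jst (\<lambda>\<nu>. int c * total_histogram n l X \<nu> + (\<Sum>i = 1..n. \<xi> (i, \<nu>))))) j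
      - true_cumulative n (2 ^ m) l X j\<bar> \<le> \<tau> / real c"
    using sums[OF j] by (simp add: h_def y_def divide_right_mono)
qed

text \<open>The fraction i / (i + 1) is at least 1/2 and reaches it at i = 1, so \<pi>^2 *
  \<sigma>^2 is the best common rate; for n = 2 the bound is an equality.\<close>

lemma privacy_psi_le:
  assumes "n \<ge> 1"
  shows "privacy_psi n \<sigma> \<le> 10 * (real n - 1) * exp (- pi\<^sup>2 * \<sigma>\<^sup>2)"
proof -
  have "exp (- 2 * pi\<^sup>2 * \<sigma>\<^sup>2 * (real i / (real i + 1))) \<le> exp (- pi\<^sup>2 * \<sigma>\<^sup>2)" if "i \<in> {1..n - 1}" for i
  proof -
    have "1 / 2 \<le> real i / (real i + 1)" using that by (simp add: field_simps)
    then have "2 * pi\<^sup>2 * \<sigma>\<^sup>2 * (1 / 2) \<le> 2 * pi\<^sup>2 * \<sigma>\<^sup>2 * (real i / (real i + 1))"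
      by (intro mult_left_mono) auto
    then show ?thesis by simp
  qed
  then have "(\<Sum>i = 1..n - 1. exp (- 2 * pi\<^sup>2 * \<sigma>\<^sup>2 * (real i / (real i + 1))))
      \<le> real (card {1..n - 1}) * exp (- pi\<^sup>2 * \<sigma>\<^sup>2)"
    by (rule sum_bounded_above)
  also have "real (card {1..n - 1}) = real n - 1"
    using assms by (simp add: of_nat_diff)
  finally show ?thesis
    unfolding privacy_psi_def mult.assoc[of 10] by (rule mult_left_mono) simp
qed

text \<open>The 16 and the 4 in the logarithms come from union bounds: at most 2nb noise
  coordinates, each failing with probability at most \<delta> / (8nb), and b cumulative sums, each
  failing with probability at most \<delta> / (2b).\<close>

lemma private_quantile_utility:
  assumes sel: "quantile_selector n (2 ^ m) \<theta> jst" and n: "n \<ge> 1" and m: "m \<ge> 1" and c: "c > 0"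
    and \<sigma>: "\<sigma> > 0" and \<delta>: "0 < \<delta>"
    and M: "real_of_int M \<ge> 2 + 2 * real c * real n + 2 * real n * sqrt (2 * \<sigma>\<^sup>2 * ln (16 * real n * 2 ^ m / \<delta>))"
  shows "measure_pmf.prob (private_quantile n (2 ^ m) l c M \<sigma> jst X)
      {(s, Hhat, q). quantile_error n \<theta> jst Hhat (true_cumulative n (2 ^ m) l X)
        \<le> min_quantile_risk n (2 ^ m) \<theta> Hhat +
          sqrt (4 * \<sigma>\<^sup>2 / ((real c)\<^sup>2 * real n) * real m * ln (4 * 2 ^ m / \<delta>))} \<ge> 1 - \<delta>"
    (is "measure_pmf.prob _ ?Good \<ge> _")
\<comment> \<open>For \<delta> \<ge> 1 the claim is trivial. Below 1 both logarithms are
  nonnegative, so the square roots defining \<open>R\<close> and \<open>\<tau>\<close> can be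
  squared back.\<close>
proof (cases "\<delta> < 1")
  case False
  have "0 \<le> measure_pmf.prob (private_quantile n (2 ^ m) l c M \<sigma> jst X) ?Good" by simp
  then show ?thesis using False by linarith
next
  case True
  define b :: nat where "b = 2 ^ m"
  define \<xi>_law where "\<xi>_law = client_noise n b \<sigma>"
  define A L where "A = ln (16 * real n * 2 ^ m / \<delta>)" and "L = ln (4 * 2 ^ m / \<delta>)"
  \<comment> \<open>Solved from the tail bounds so that their exponents become - A and - L. The 4 in
    \<open>\<tau>\<close> is 2 from the Gaussian exponent times 2 from the bound 2m on the number of
    blocks.\<close>
  define R \<tau> where "R = sqrt (2 * \<sigma>\<^sup>2 * A)" and "\<tau> = sqrt (4 * \<sigma>\<^sup>2 * real n * real m * L)"
  have ge1: "(1::real) \<le> 2 ^ m" "1 \<le> real n" using n by simp_all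
  have prod1: "1 \<le> real n * 2 ^ m" using mult_mono[OF ge1(2,1)] by simp
  have "\<delta> \<le> 16 * (real n * 2 ^ m)" "\<delta> \<le> 4 * 2 ^ m"
    using True ge1(1) prod1 by linarith+
  then have "A \<ge> 0" "L \<ge> 0"
    unfolding A_def L_def using \<delta> by (auto intro!: ln_ge_zero simp: le_divide_eq)
  then have R: "R \<ge> 0" "R\<^sup>2 = 2 * \<sigma>\<^sup>2 * A" and \<tau>: "\<tau> \<ge> 0" "\<tau>\<^sup>2 = 4 * \<sigma>\<^sup>2 * real n * real m * L"
    by (simp_all add: R_def \<tau>_def)
  define Y where "Y = (\<lambda>(\<xi> :: nat \<times> (nat \<times> nat) \<Rightarrow> int) \<nu>. \<Sum>i = 1..n. \<xi> (i, \<nu>))"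
  define bad1 where "bad1 = (\<lambda>(i, \<nu>). {\<xi> :: nat \<times> (nat \<times> nat) \<Rightarrow> int. \<bar>real_of_int (\<xi> (i, \<nu>))\<bar> > R})"
  define bad2 where "bad2 = (\<lambda>j. {\<xi>. \<bar>real_of_int (\<Sum>\<nu>\<in>max_dyadic_partition b j. Y \<xi> \<nu>)\<bar> > \<tau>})"
  define bad where "bad = (\<Union>z\<in>{1..n} \<times> nodes b. bad1 z) \<union> (\<Union>j\<in>{1..b}. bad2 j)"
  have p1: "measure_pmf.prob \<xi>_law (bad1 z) \<le> \<delta> / (8 * real n * 2 ^ m)" if "z \<in> {1..n} \<times> nodes b" for z
  proof -
    obtain i \<nu> where z: "z = (i, \<nu>)" by (cases z)
    have "measure_pmf.prob \<xi>_law (bad1 z) \<le> 2 * exp (- R\<^sup>2 / (2 * \<sigma>\<^sup>2))"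
      unfolding z bad1_def \<xi>_law_def prod.case using that \<sigma> R(1) by (intro client_noise_tail) (auto simp: z)
    also have "- R\<^sup>2 / (2 * \<sigma>\<^sup>2) = - A" using \<sigma> by (simp add: R)
    also have "2 * exp (- A) = \<delta> / (8 * real n * 2 ^ m)"
      using \<delta> n by (simp add: A_def exp_minus)
    finally show ?thesis .
  qed
  have p2: "measure_pmf.prob \<xi>_law (bad2 j) \<le> \<delta> / (2 * 2 ^ m)" if "j \<in> {1..b}" for j
  proof -
    let ?P = "max_dyadic_partition b j"
    have P: "?P \<subseteq> nodes b" "card ?P \<le> 2 * m"
      using max_dyadic_partition[OF m, of j] that by (auto simp: b_def)
    have "measure_pmf.prob \<xi>_law (bad2 j) = measure_pmf.prob (map_pmf Y \<xi>_law) {y. \<bar>real_of_int (\<Sum>\<nu>\<in>?P. y \<nu>)\<bar> > \<tau>}"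
      by (simp add: bad2_def vimage_def)
    also have "map_pmf Y \<xi>_law = node_noise n b \<sigma>"
      unfolding Y_def \<xi>_law_def by (rule node_noise_eq_client_noise)
    also have "measure_pmf.prob (node_noise n b \<sigma>) {y. \<bar>real_of_int (\<Sum>\<nu>\<in>?P. y \<nu>)\<bar> > \<tau>}
        \<le> 2 * exp (- \<tau>\<^sup>2 / (2 * (real (2 * m) * (real n * \<sigma>\<^sup>2))))"
      using m \<tau>(1) by (intro node_noise_sum_tail \<sigma> n P) auto
    also have "- \<tau>\<^sup>2 / (2 * (real (2 * m) * (real n * \<sigma>\<^sup>2))) = - L"
      using \<sigma> n m by (simp add: \<tau>)
    also have "2 * exp (- L) = \<delta> / (2 * 2 ^ m)"
      using \<delta> by (simp add: L_def exp_minus)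
    finally show ?thesis .
  qed
  have "measure_pmf.prob \<xi>_law (\<Union>z\<in>{1..n} \<times> nodes b. bad1 z) \<le> (\<Sum>z\<in>{1..n} \<times> nodes b. measure_pmf.prob \<xi>_law (bad1 z))"
    by (intro measure_UNION_le) auto
  also have "\<dots> \<le> real (card ({1..n} \<times> nodes b)) * (\<delta> / (8 * real n * 2 ^ m))"
    by (rule sum_bounded_above) (rule p1)
  also have "\<dots> \<le> real (n * (2 * 2 ^ m)) * (\<delta> / (8 * real n * 2 ^ m))"
    using card_nodes_le[of m] \<delta>
    by (intro mult_right_mono of_nat_mono) (auto simp: card_cartesian_product b_def)
  also have "\<dots> = \<delta> / 4" using n by simp
  finally have u1: "measure_pmf.prob \<xi>_law (\<Union>z\<in>{1..n} \<times> nodes b. bad1 z) \<le> \<delta> / 4" .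
  have "measure_pmf.prob \<xi>_law (\<Union>j\<in>{1..b}. bad2 j) \<le> (\<Sum>j\<in>{1..b}. measure_pmf.prob \<xi>_law (bad2 j))"
    by (intro measure_UNION_le) auto
  also have "\<dots> \<le> real (card {1..b}) * (\<delta> / (2 * 2 ^ m))"
    by (rule sum_bounded_above) (rule p2)
  also have "\<dots> = \<delta> / 2" by (simp add: b_def)
  finally have u2: "measure_pmf.prob \<xi>_law (\<Union>j\<in>{1..b}. bad2 j) \<le> \<delta> / 2" .
  have "measure_pmf.prob \<xi>_law bad \<le> measure_pmf.prob \<xi>_law (\<Union>z\<in>{1..n} \<times> nodes b. bad1 z) + measure_pmf.prob \<xi>_law (\<Union>j\<in>{1..b}. bad2 j)"
    unfolding bad_def by (rule measure_Un_le) auto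
  then have "measure_pmf.prob \<xi>_law bad \<le> \<delta>" using u1 u2 \<delta> by linarith
  then have "1 - \<delta> \<le> measure_pmf.prob \<xi>_law (- bad)"
    using measure_pmf.prob_compl[of bad \<xi>_law] by (simp add: Compl_eq_Diff_UNIV)
  also have "\<dots> \<le> measure_pmf.prob \<xi>_law
      ((\<lambda>\<xi>. server (2 ^ m) l c M jst (\<lambda>\<nu>. int c * total_histogram n l X \<nu> + (\<Sum>i = 1..n. \<xi> (i, \<nu>)))) -` ?Good)"
  proof (intro measure_pmf.finite_measure_mono subsetI)
    fix \<xi> assume \<xi>: "\<xi> \<in> - bad"
    let ?Hhat = "fst (snd (server (2 ^ m) l c M jst (\<lambda>\<nu>. int c * total_histogram n l X \<nu> + (\<Sum>i = 1..n. \<xi> (i, \<nu>)))))"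
    have "quantile_error n \<theta> jst ?Hhat (true_cumulative n (2 ^ m) l X)
        \<le> min_quantile_risk n (2 ^ m) \<theta> ?Hhat + \<tau> / real c / real n"
    proof (rule server_error[OF m sel n c])
      show "real_of_int M \<ge> 2 + 2 * real c * real n + 2 * real n * R" using M by (simp add: R_def A_def)
      show "\<bar>real_of_int (\<xi> (i, \<nu>))\<bar> \<le> R" if "i \<in> {1..n}" "\<nu> \<in> nodes (2 ^ m)" for i \<nu>
        using \<xi> that by (force simp: bad_def bad1_def b_def)
      show "\<bar>real_of_int (\<Sum>\<nu>\<in>max_dyadic_partition (2 ^ m) j. \<Sum>i = 1..n. \<xi> (i, \<nu>))\<bar> \<le> \<tau>" if "j \<in> {1..2 ^ m}" for j
        using \<xi> that by (simp add: bad_def bad2_def b_def Y_def not_less)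
    qed
    also have "\<tau> / real c / real n = sqrt (4 * \<sigma>\<^sup>2 / ((real c)\<^sup>2 * real n) * real m * ln (4 * 2 ^ m / \<delta>))"
    proof (rule real_sqrt_unique[symmetric])
      have "(\<tau> / real c / real n)\<^sup>2 = \<tau>\<^sup>2 / (real c)\<^sup>2 / (real n)\<^sup>2"
        by (simp add: power_divide power_mult_distrib)
      also have "\<dots> = 4 * \<sigma>\<^sup>2 / ((real c)\<^sup>2 * real n) * real m * L"
        unfolding \<tau>(2) using n c by (simp add: power2_eq_square)
      finally show "(\<tau> / real c / real n)\<^sup>2 = 4 * \<sigma>\<^sup>2 / ((real c)\<^sup>2 * real n) * real m * ln (4 * 2 ^ m / \<delta>)"
        by (simp add: L_def)
    qed (use \<tau> in simp)
    finally show "\<xi> \<in> (\<lambda>\<xi>. server (2 ^ m) l c M jst (\<lambda>\<nu>. int c * total_histogram n l X \<nu> + (\<Sum>i = 1..n. \<xi> (i, \<nu>)))) -` ?Good"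
      by (simp add: case_prod_unfold)
  qed auto
  also have "\<dots> = measure_pmf.prob (private_quantile n (2 ^ m) l c M \<sigma> jst X) ?Good"
    unfolding private_quantile_eq_client \<xi>_law_def b_def by (simp only: measure_map_pmf)
  finally show ?thesis .
qed

theorem theorem6:
  fixes n b c :: nat and M :: int and B \<theta> \<delta> \<sigma> :: real
    and l scalar :: "nat \<Rightarrow> real" and jst :: "(nat \<Rightarrow> real) \<Rightarrow> nat"
  assumes "n \<ge> 1"
    and "\<And>i. i \<in> {1..n} \<Longrightarrow> scalar i \<in> {0..B}"
    and "b \<ge> 2" and "\<exists>m. b = 2 ^ m"
    and "l 0 = 0" and "l b = B" and "strict_mono_on {0..b} l"
    and "0 < \<theta>" and "\<theta> < 1"
    and "quantile_selector n b \<theta> jst"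
    and "\<delta> > 0" and "\<sigma> \<ge> 1 / 2" and "c > 0"
    and "real_of_int M \<ge> 2 + 2 * real c * real n +
           2 * real n * sqrt (2 * \<sigma>\<^sup>2 * ln (16 * real n * real b / \<delta>))"
  shows "concentrated_dp (private_quantile n b l c M \<sigma> jst) (add_remove_neighbours n B)
           (privacy_epsilon n b c \<sigma>) (if b = 2 then {1..} else {0<..})
       \<and> privacy_psi n \<sigma> \<le> 10 * (real n - 1) * exp (- pi\<^sup>2 * \<sigma>\<^sup>2)
       \<and> measure_pmf.prob (private_quantile n b l c M \<sigma> jst (\<lambda>i. Some (scalar i)))
           {(s, Hhat, q).
              quantile_error n \<theta> jst Hhat (true_cumulative n b l (\<lambda>i. Some (scalar i)))
              \<le> min_quantile_risk n b \<theta> Hhat +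
                 sqrt (4 * \<sigma>\<^sup>2 / ((real c)\<^sup>2 * real n) * log 2 (real b) * ln (4 * real b / \<delta>))}
         \<ge> 1 - \<delta>"
proof -
  obtain m where b: "b = 2 ^ m" using assms(4) by blast
  have m: "m \<ge> 1" using assms(3) b by (cases m) auto
  have "b = 2 \<longleftrightarrow> m = 1" using power_inject_exp[of "2::nat" m 1] by (simp add: b)
  then have dp: "concentrated_dp (private_quantile n b l c M \<sigma> jst) (add_remove_neighbours n B)
      (privacy_epsilon n b c \<sigma>) (if b = 2 then {1..} else {0<..})"
    using private_quantile_concentrated_dp[of m l n \<sigma> c M jst B] assms m by (simp add: b)
  have log: "log 2 (real b) = real m" "real b = 2 ^ m" by (simp_all add: b log_nat_power)
  have utility: "measure_pmf.prob (private_quantile n b l c M \<sigma> jst (\<lambda>i. Some (scalar i)))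
      {(s, Hhat, q). quantile_error n \<theta> jst Hhat (true_cumulative n b l (\<lambda>i. Some (scalar i)))
        \<le> min_quantile_risk n b \<theta> Hhat +
          sqrt (4 * \<sigma>\<^sup>2 / ((real c)\<^sup>2 * real n) * log 2 (real b) * ln (4 * real b / \<delta>))} \<ge> 1 - \<delta>"
    unfolding log(1) unfolding log(2) unfolding b
    by (rule private_quantile_utility) (use assms m in \<open>auto simp: b\<close>)
  show ?thesis using dp privacy_psi_le[OF assms(1)] utility by blast
qed

end
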